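(* Let $k$ be a perfect field of positive characteristic, $G$ a finite group, and $V$ a (finite rank) monomial representation of $G$ over $k$. Then the ring of invariants $(\mathrm{Sym}\,V)^G$ has finite Frobenius representation type (FFRT).
   Context: Let $V$ be a finite rank $k$-vector space that is a $G$-module. A $k$-basis $\Gamma$ of $V$ is a monomial basis for the action of $G$ if for each $g\in G$ and $\gamma\in\Gamma$, one has $g\gamma\in k\gamma'$ for some $\gamma'\in\Gamma$. The $G$-module $V$ is a monomial representation of $G$ if $V$ admits a monomial basis. The action of $G$ on $V$ extends to an action on the symmetric algebra $\mathrm{Sym}\,V$ (a polynomial ring with the standard $\mathbb{N}$-grading in which $V$ has degree $1$) by degree-preserving $k$-algebra automorphisms, and the invariant ring inherits this grading. FFRT: let $k$ be a perfect field of characteristic $p>0$, and let $R$ be a positively graded finitely generated commutative $k$-algebra (i.e., $R$ is $\mathbb{N}$-graded with $[R]_0=k$). For an integer $e\ge 0$, let ${}^eR=\{{}^er \mid r\in R\}$ be a copy of the ring $R$, regarded as an $R$-module via $r\cdot {}^es = {}^e(r^{p^e}s)$, with the $\mathbb{Q}$-grading in which $\deg {}^er = (\deg r)/p^e$ for $r$ homogeneous (for $R$ reduced, ${}^eR$ is identified with $R^{1/p^e}$, with ${}^er$ corresponding to $r^{1/p^e}$). For a $\mathbb{Q}$-graded module $M$ and $d\in\mathbb{Q}$, $M(d)$ denotes the degree shift $[M(d)]_i=[M]_{d+i}$. The ring $R$ has FFRT (in the graded sense) if there exist finitely many finitely generated $\mathbb{Q}$-graded $R$-modules $M_1,\dots,M_\ell$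 such that for each $e\ge 1$, the module ${}^eR$ is isomorphic, as a $\mathbb{Q}$-graded $R$-module, to a finite direct sum of copies of modules of the form $M_i(d)$ with $1\le i\le \ell$ and $d\in\mathbb{Q}$. *)

theory Defs
  imports
    "HOL-Algebra.Algebra"
    "HOL-Algebra.Algebraic_Closure_Type"
    "HOL-Library.Poly_Mapping"
    "HOL-Library.FuncSet"
begin

section \<open>Graded algebras and graded modules\<close>

text \<open>
  The type \<open>'i\<close> of degrees is \<^typ>\<open>nat\<close> for algebras and \<^typ>\<open>rat\<close> for modules. For modules the
  fields \<open>mult\<close> and \<open>one\<close> inherited from the ring record carry no meaning.
\<close>

record ('i, 'r, 'a) graded = "('r, 'a) module" +
  hcomp :: "'i \<Rightarrow> 'a set"

definition is_direct_sum_of_hcomps :: "('i, 'r, 'a) graded \<Rightarrow> bool" where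
  "is_direct_sum_of_hcomps M \<longleftrightarrow>
     (\<forall>i. additive_subgroup (hcomp M i) M) \<and>
     (\<forall>x \<in> carrier M. \<exists>!c. (\<forall>i. c i \<in> hcomp M i) \<and> finite {i. c i \<noteq> \<zero>\<^bsub>M\<^esub>} \<and>
        x = (\<Oplus>\<^bsub>M\<^esub>i \<in> {i. c i \<noteq> \<zero>\<^bsub>M\<^esub>}. c i))"

definition fg_positively_graded_algebra :: "(nat, 'k::field, 'a) graded \<Rightarrow> bool" where
  "fg_positively_graded_algebra R \<longleftrightarrow>
     algebra (ring_of_type_algebra :: 'k ring) R \<and>
     is_direct_sum_of_hcomps R \<and>
     (\<forall>i j. \<forall>x \<in> hcomp R i. \<forall>y \<in> hcomp R j. x \<otimes>\<^bsub>R\<^esub> y \<in> hcomp R (i + j)) \<and>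
     bij_betw (\<lambda>c. c \<odot>\<^bsub>R\<^esub> \<one>\<^bsub>R\<^esub>) UNIV (hcomp R 0) \<and>
     (\<exists>S. finite S \<and> S \<subseteq> carrier R \<and> carrier R = generate_ring R (hcomp R 0 \<union> S))"

definition fg_graded_module ::
    "(nat, 'k, 'a) graded \<Rightarrow> (rat, 'a, 'm) graded \<Rightarrow> bool" where
  "fg_graded_module R M \<longleftrightarrow>
     module R M \<and>
     is_direct_sum_of_hcomps M \<and>
     (\<forall>n q. \<forall>r \<in> hcomp R n. \<forall>x \<in> hcomp M q. r \<odot>\<^bsub>M\<^esub> x \<in> hcomp M (of_nat n + q)) \<and>
     (\<exists>S. finite S \<and> S \<subseteq> carrier M \<and>
        (\<forall>x \<in> carrier M. \<exists>c \<in> S \<rightarrow> carrier R. x = (\<Oplus>\<^bsub>M\<^esub>y \<in> S. c y \<odot>\<^bsub>M\<^esub> y)))"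

definition graded_iso ::
    "(nat, 'k, 'a) graded \<Rightarrow> (rat, 'a, 'm) graded \<Rightarrow> (rat, 'a, 'n) graded \<Rightarrow> bool" where
  "graded_iso R M N \<longleftrightarrow>
     (\<exists>\<phi>. bij_betw \<phi> (carrier M) (carrier N) \<and>
        (\<forall>x \<in> carrier M. \<forall>y \<in> carrier M. \<phi> (x \<oplus>\<^bsub>M\<^esub> y) = \<phi> x \<oplus>\<^bsub>N\<^esub> \<phi> y) \<and>
        (\<forall>r \<in> carrier R. \<forall>x \<in> carrier M. \<phi> (r \<odot>\<^bsub>M\<^esub> x) = r \<odot>\<^bsub>N\<^esub> \<phi> x) \<and>
        (\<forall>q. \<phi> ` hcomp M q = hcomp N q))"

definition shift :: "rat \<Rightarrow> (rat, 'r, 'm) graded \<Rightarrow> (rat, 'r, 'm) graded" where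
  "shift d M = M\<lparr>hcomp := \<lambda>q. hcomp M (d + q)\<rparr>"

definition direct_sum ::
    "nat \<Rightarrow> (nat \<Rightarrow> (rat, 'r, 'm) graded) \<Rightarrow> (rat, 'r, nat \<Rightarrow> 'm) graded" where
  "direct_sum n N =
     \<lparr>carrier = (\<Pi>\<^sub>E j \<in> {..<n}. carrier (N j)),
      monoid.mult = undefined,
      one = undefined,
      ring.zero = (\<lambda>j \<in> {..<n}. \<zero>\<^bsub>N j\<^esub>),
      add = (\<lambda>x y. \<lambda>j \<in> {..<n}. x j \<oplus>\<^bsub>N j\<^esub> y j),
      module.smult = (\<lambda>r x. \<lambda>j \<in> {..<n}. r \<odot>\<^bsub>N j\<^esub> x j),
      hcomp = (\<lambda>q. \<Pi>\<^sub>E j \<in> {..<n}. hcomp (N j) q)\<rparr>"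


section \<open>Finite Frobenius representation type\<close>

text \<open>The module \<open>{}^eR\<close>, with the element \<open>{}^er\<close> represented by \<open>r\<close> itself.\<close>

definition frobenius_module ::
    "nat \<Rightarrow> (nat, 'k::field, 'a) graded \<Rightarrow> (rat, 'a, 'a) graded" where
  "frobenius_module e R =
     \<lparr>carrier = carrier R,
      monoid.mult = monoid.mult R,
      one = \<one>\<^bsub>R\<^esub>,
      ring.zero = \<zero>\<^bsub>R\<^esub>,
      add = add R,
      module.smult = (\<lambda>r s. (r [^]\<^bsub>R\<^esub> (CHAR('k) ^ e)) \<otimes>\<^bsub>R\<^esub> s),
      hcomp = (\<lambda>q. {x. x = \<zero>\<^bsub>R\<^esub> \<or>
                 (\<exists>n. q = of_nat n / of_nat (CHAR('k) ^ e) \<and> x \<in> hcomp R n)})\<rparr>"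

text \<open>
  The modules \<open>M i\<close> are taken with elements in the type \<open>'a\<close> of elements of \<open>R\<close>. This is no
  restriction: an \<open>M i\<close> that occurs in one of the decompositions is, up to a degree shift, isomorphic
  to a direct summand of some \<open>{}^eR\<close>, whose carrier is that of \<open>R\<close>, and an \<open>M i\<close> that never occurs
  can be omitted.
\<close>

definition FFRT :: "(nat, 'k::field, 'a) graded \<Rightarrow> bool" where
  "FFRT R \<longleftrightarrow>
     fg_positively_graded_algebra R \<and>
     (\<exists>(l :: nat) (M :: nat \<Rightarrow> (rat, 'a, 'a) graded).
        (\<forall>i<l. fg_graded_module R (M i)) \<and>
        (\<forall>e\<ge>1. \<exists>(n :: nat) (\<iota> :: nat \<Rightarrow> nat) (d :: nat \<Rightarrow> rat).
           (\<forall>j<n. \<iota> j < l) \<and>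
           graded_iso R (frobenius_module e R) (direct_sum n (\<lambda>j. shift (d j) (M (\<iota> j))))))"


section \<open>Polynomials and the symmetric algebra\<close>

text \<open>Polynomials with coefficients in \<open>'k\<close> and one indeterminate for each element of \<open>'v\<close>.\<close>

type_synonym ('v, 'k) mpoly = "('v \<Rightarrow>\<^sub>0 nat) \<Rightarrow>\<^sub>0 'k"

abbreviation mpoly_ring :: "('v, 'k::field) mpoly ring" where
  "mpoly_ring \<equiv> ring_of_type_algebra"

definition Var :: "'v \<Rightarrow> ('v, 'k::field) mpoly" where
  "Var v = Poly_Mapping.single (Poly_Mapping.single v 1) 1"

definition Const :: "'k \<Rightarrow> ('v, 'k::field) mpoly" where
  "Const c = Poly_Mapping.single 0 c"

definition homogeneous :: "nat \<Rightarrow> ('v, 'k::field) mpoly \<Rightarrow> bool" where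
  "homogeneous n f \<longleftrightarrow>
     (\<forall>m \<in> Poly_Mapping.keys f. (\<Sum>v \<in> Poly_Mapping.keys m. Poly_Mapping.lookup m v) = n)"

definition subst_vars ::
    "('v \<Rightarrow> ('w, 'k) mpoly) \<Rightarrow> ('v, 'k::field) mpoly \<Rightarrow> ('w, 'k) mpoly" where
  "subst_vars \<sigma> f =
     (\<Sum>m \<in> Poly_Mapping.keys f. Const (Poly_Mapping.lookup f m) *
        (\<Prod>v \<in> Poly_Mapping.keys m. \<sigma> v ^ Poly_Mapping.lookup m v))"

text \<open>
  \<open>Sym V\<close> is constructed without choosing a basis: it is the polynomial ring on all elements of \<open>V\<close>
  modulo the ideal forcing \<^const>\<open>Var\<close> to be linear. The vector space \<open>V\<close> is the type \<open>'v\<close> with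
  scalar multiplication \<open>scale\<close>.
\<close>

definition linearity_ideal ::
    "('k \<Rightarrow> 'v \<Rightarrow> 'v) \<Rightarrow> ('v::ab_group_add, 'k::field) mpoly set" where
  "linearity_ideal scale =
     Idl\<^bsub>mpoly_ring\<^esub> ({Var (v + w) - (Var v + Var w) | v w. True} \<union>
                       {Var (scale c v) - Const c * Var v | c v. True})"

definition symmetric_algebra ::
    "('k \<Rightarrow> 'v \<Rightarrow> 'v) \<Rightarrow> (nat, 'k, ('v::ab_group_add, 'k::field) mpoly set) graded" where
  "symmetric_algebra scale =
     (let I = linearity_ideal scale; Q = mpoly_ring Quot I in
      \<lparr>carrier = carrier Q,
       monoid.mult = monoid.mult Q,
       one = \<one>\<^bsub>Q\<^esub>,
       ring.zero = \<zero>\<^bsub>Q\<^esub>,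
       add = add Q,
       module.smult = (\<lambda>c A. (I +>\<^bsub>mpoly_ring\<^esub> Const c) \<otimes>\<^bsub>Q\<^esub> A),
       hcomp = (\<lambda>n. {I +>\<^bsub>mpoly_ring\<^esub> f | f. homogeneous n f})\<rparr>)"


section \<open>Representations and invariants\<close>

definition linear_representation ::
    "('k::field \<Rightarrow> 'v \<Rightarrow> 'v) \<Rightarrow> ('g, 'b) monoid_scheme \<Rightarrow>
       ('g \<Rightarrow> 'v::ab_group_add \<Rightarrow> 'v) \<Rightarrow> bool" where
  "linear_representation scale G \<rho> \<longleftrightarrow>
     group_action G UNIV \<rho> \<and> (\<forall>g \<in> carrier G. Vector_Spaces.linear scale scale (\<rho> g))"

definition monomial_basis ::
    "('k::field \<Rightarrow> 'v \<Rightarrow> 'v) \<Rightarrow> ('g, 'b) monoid_scheme \<Rightarrow>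
       ('g \<Rightarrow> 'v::ab_group_add \<Rightarrow> 'v) \<Rightarrow> 'v set \<Rightarrow> bool" where
  "monomial_basis scale G \<rho> \<Gamma> \<longleftrightarrow>
     \<not> module.dependent scale \<Gamma> \<and> module.span scale \<Gamma> = UNIV \<and>
     (\<forall>g \<in> carrier G. \<forall>\<gamma> \<in> \<Gamma>. \<exists>\<gamma>' \<in> \<Gamma>. \<exists>c. \<rho> g \<gamma> = scale c \<gamma>')"

definition monomial_representation ::
    "('k::field \<Rightarrow> 'v \<Rightarrow> 'v) \<Rightarrow> ('g, 'b) monoid_scheme \<Rightarrow>
       ('g \<Rightarrow> 'v::ab_group_add \<Rightarrow> 'v) \<Rightarrow> bool" where
  "monomial_representation scale G \<rho> \<longleftrightarrow>
     linear_representation scale G \<rho> \<and> (\<exists>\<Gamma>. monomial_basis scale G \<rho> \<Gamma>)"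

text \<open>
  An element of \<open>Sym V\<close> is a coset \<open>A\<close> of the linearity ideal. The automorphism \<open>Var v \<mapsto> Var (\<rho> g v)\<close>
  of the polynomial ring preserves that ideal, so the image of \<open>A\<close> under it is again a coset.
\<close>

definition sym_action ::
    "('g \<Rightarrow> 'v \<Rightarrow> 'v) \<Rightarrow> 'g \<Rightarrow> ('v, 'k::field) mpoly set \<Rightarrow> ('v, 'k) mpoly set" where
  "sym_action \<rho> g A = subst_vars (\<lambda>v. Var (\<rho> g v)) ` A"

definition invariant_ring ::
    "('k \<Rightarrow> 'v \<Rightarrow> 'v) \<Rightarrow> ('g, 'b) monoid_scheme \<Rightarrow> ('g \<Rightarrow> 'v \<Rightarrow> 'v) \<Rightarrow>
       (nat, 'k, ('v::ab_group_add, 'k::field) mpoly set) graded" where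
  "invariant_ring scale G \<rho> =
     (let S = symmetric_algebra scale;
          Inv = {A \<in> carrier S. \<forall>g \<in> carrier G. sym_action \<rho> g A = A}
      in S\<lparr>carrier := Inv, hcomp := \<lambda>n. hcomp S n \<inter> Inv\<rparr>)"


section \<open>Perfect fields\<close>

definition perfect_field :: "'k::field itself \<Rightarrow> bool" where
  "perfect_field _ \<longleftrightarrow> CHAR('k) = 0 \<or> (\<forall>a :: 'k. \<exists>b. b ^ CHAR('k) = a)"

end

theory Submission
  imports Defs
begin

text \<open>
  Why the theorem holds. Let \<open>x\<^sub>1, \<dots>, x\<^sub>n\<close> be a monomial basis of \<open>V\<close>, so that \<open>S = Sym V\<close> is the
  polynomial ring in the \<open>x\<^sub>i\<close>, and let \<open>q = p\<^sup>e\<close>. Every \<open>g\<close> in \<open>G\<close> sends a monomial \<open>x\<^sup>m\<close> to a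
  scalar \<open>wt g m\<close> times the monomial with exponent \<open>mon g m\<close>. The ring \<open>S\<^bsup>1/q\<^esup>\<close> is a free
  \<open>S\<close>-module on the monomials \<open>x\<^bsup>a/q\<^esup>\<close> with all entries of \<open>a\<close> below \<open>q\<close>, and the group permutes
  the lines spanned by these monomials. Grouping them into orbits and taking invariants, the part that
  belongs to the orbit of \<open>a\<close> is determined by its coefficient \<open>s\<close> at \<open>x\<^bsup>a/q\<^esup>\<close>, and the only condition
  on \<open>s\<close> is that each \<open>h\<close> in the stabilizer of \<open>a\<close> multiplies it by the inverse of the \<open>q\<close>-th root of
  \<open>wt h a\<close>. So, up to a degree shift by \<open>deg a/q\<close>, the summand is a module of semi-invariants of a
  subgroup of \<open>G\<close>, a submodule of \<open>S\<close> over the ring of invariants. Once the basis is rescaled so that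
  all coefficients are roots of unity of order dividing \<open>N = |G|\<close>, there are only finitely many
  subgroups with such a character, hence only finitely many of these modules, whatever \<open>e\<close> is. This
  is \<open>frobenius_module_iso\<close> and \<open>R_FFRT\<close>; the existence of the rescaled basis is
  \<open>root_of_unity_basis\<close>.

  The invariant ring and the modules of semi-invariants have to be finitely generated. For this the
  elementary symmetric polynomials in the \<open>N\<close>-th powers of the variables are used. They are
  invariant, and an argument of Goebel for permutation groups shows that every module of
  semi-invariants is generated over the algebra that they generate by its elements with all exponents
  below \<open>n N\<close>: if the exponents of a monomial leave a gap of length \<open>N\<close>, then lowering the \<open>m\<close>
  exponents above the gap by \<open>N\<close> and multiplying with the \<open>m\<close>-th elementary symmetric polynomial gives
  the monomial back, up to monomials for which the sum of the squared exponents is smaller. Since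
  \<open>N\<close>-th powers kill all coefficients, the whole reduction commutes with the group, so it stays
  inside the module. These are \<open>goebel_step\<close>, \<open>goebel_induction\<close> and \<open>semi_finitely_generated\<close>.

  All this takes place in the polynomial ring on the basis, where an element is its coefficient
  function. The symmetric algebra is defined as a quotient of the polynomial ring on all vectors;
  each of its cosets contains exactly one polynomial in the basis (\<open>cls_retract\<close>, \<open>inj_cls\<close>), and the
  structures on cosets are transported along that bijection.
\<close>

section \<open>Polynomials as finitely supported coefficient functions\<close>

abbreviation coef :: "('a \<Rightarrow>\<^sub>0 'b::zero) \<Rightarrow> 'a \<Rightarrow> 'b" where
  "coef \<equiv> Poly_Mapping.lookup"

abbreviation supp :: "('a \<Rightarrow>\<^sub>0 'b::zero) \<Rightarrow> 'a set" where
  "supp \<equiv> Poly_Mapping.keys"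

abbreviation mterm :: "('v \<Rightarrow>\<^sub>0 nat) \<Rightarrow> 'k::field \<Rightarrow> ('v, 'k) mpoly" where
  "mterm \<equiv> Poly_Mapping.single"

definition polys_in :: "'v set \<Rightarrow> ('v, 'k::field) mpoly set" where
  "polys_in \<Gamma> = {f. \<forall>m \<in> supp f. supp m \<subseteq> \<Gamma>}"

definition mdeg :: "('v \<Rightarrow>\<^sub>0 nat) \<Rightarrow> nat" where
  "mdeg m = (\<Sum>v \<in> supp m. coef m v)"

text \<open>
  Substitutions, the group action, the projections onto sets of monomials and the reduction step for
  finite generation are all obtained by linear extension from monomials.
\<close>

definition linear_ext ::
    "(('v \<Rightarrow>\<^sub>0 nat) \<Rightarrow> ('w, 'k) mpoly) \<Rightarrow> ('v, 'k::field) mpoly \<Rightarrow> ('w, 'k) mpoly" where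
  "linear_ext T f = (\<Sum>m \<in> supp f. Const (coef f m) * T m)"

lemma Const_0 [simp]: "Const 0 = 0"
  by (simp add: Const_def)

lemma Const_1 [simp]: "Const 1 = 1"
  by (simp add: Const_def)

lemma Const_add: "Const (a + b) = Const a + Const b"
  by (simp add: Const_def single_add)

lemma Const_mult: "Const (a * b) = Const a * Const b"
  by (simp add: Const_def mult_single)

lemma Const_power: "Const (a ^ n) = Const a ^ n"
  by (induction n) (auto simp: Const_mult)

lemma Const_times_mterm: "Const a * mterm m b = mterm m (a * b)"
  by (simp add: Const_def mult_single)

lemma coef_Const_times [simp]: "coef (Const a * f) m = a * coef f m"
proof -
  have "Const a * f = Poly_Mapping.map ((*) a) f"
    by (simp add: Const_def mult_map_scale_conv_mult)
  then show ?thesis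
    by (simp add: Poly_Mapping.map.rep_eq when_def)
qed

text \<open>
  Exponent vectors are written additively, so this is the \<open>q\<close>-th power of a monomial.
\<close>

definition mscale :: "nat \<Rightarrow> ('v \<Rightarrow>\<^sub>0 nat) \<Rightarrow> 'v \<Rightarrow>\<^sub>0 nat" where
  "mscale q m = Poly_Mapping.map ((*) q) m"

lemma coef_mscale [simp]: "coef (mscale q m) x = q * coef m x"
  by (simp add: mscale_def Poly_Mapping.map.rep_eq when_def)

lemma mscale_single: "mscale q (Poly_Mapping.single v n) = Poly_Mapping.single v (q * n)"
  by (rule poly_mapping_eqI) (simp add: lookup_single when_def)

lemma mterm_power: "mterm m c ^ n = mterm (mscale n m) (c ^ n)"
proof (induction n)
  case 0
  have "mscale 0 m = 0"
    by (rule poly_mapping_eqI) simp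
  then show ?case by simp
next
  case (Suc n)
  have "m + mscale n m = mscale (Suc n) m"
    by (rule poly_mapping_eqI) (simp add: lookup_add)
  then show ?case using Suc by (simp add: mult_single)
qed

text \<open>
  Reduces linear arguments to single terms, through the induction principles that follow.
\<close>

lemma mpoly_expand: "f = (\<Sum>m \<in> supp f. mterm m (coef f m))"
proof (rule poly_mapping_eqI)
  fix k
  have "(\<Sum>m \<in> supp f. coef (mterm m (coef f m)) k) = (\<Sum>m \<in> supp f. if m = k then coef f k else 0)"
    by (rule sum.cong) (auto simp: lookup_single when_def)
  then show "coef f k = coef (\<Sum>m \<in> supp f. mterm m (coef f m)) k"
    by (auto simp: lookup_sum sum.delta in_keys_iff)
qed

lemma mpoly_induct_on [consumes 1, case_names zero monomial plus]:
  assumes "supp f \<subseteq> K"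
    and "P 0"
    and "\<And>m c. m \<in> K \<Longrightarrow> P (mterm m c)"
    and "\<And>f g. P f \<Longrightarrow> P g \<Longrightarrow> P (f + g)"
  shows "P f"
proof -
  have "P (\<Sum>m \<in> A. mterm m (coef f m))" if "finite A" "A \<subseteq> K" for A
    using that by (induction A) (auto intro: assms)
  from this[of "supp f"] show ?thesis
    using assms(1) by (simp flip: mpoly_expand)
qed

lemma mpoly_induct [case_names monomial plus]:
  assumes "\<And>m c. P (mterm m c)"
    and "\<And>f g. P f \<Longrightarrow> P g \<Longrightarrow> P (f + g)"
  shows "P f"
proof -
  have "P 0" using assms(1)[of 0 0] by simp
  with assms show ?thesis by (intro mpoly_induct_on[of f UNIV P]) auto
qed

lemma linear_ext_superset:
  assumes "finite A" "supp f \<subseteq> A"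
  shows "linear_ext T f = (\<Sum>m \<in> A. Const (coef f m) * T m)"
  unfolding linear_ext_def
  by (rule sum.mono_neutral_left) (use assms in \<open>auto simp: in_keys_iff\<close>)

lemma linear_ext_mterm [simp]: "linear_ext T (mterm m c) = Const c * T m"
  by (auto simp: linear_ext_def)

lemma linear_ext_add: "linear_ext T (f + g) = linear_ext T f + linear_ext T g"
proof -
  let ?A = "supp f \<union> supp g"
  have *: "linear_ext T h = (\<Sum>m \<in> ?A. Const (coef h m) * T m)" if "supp h \<subseteq> ?A" for h
    by (rule linear_ext_superset) (use that in auto)
  show ?thesis
    by (subst (1 2 3) *)
      (use keys_add[of f g] in \<open>auto simp: lookup_add Const_add algebra_simps sum.distrib\<close>)
qed

lemma linear_ext_mult:
  assumes "\<And>a b. T (a + b) = T a * T b"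
  shows "linear_ext T (f * g) = linear_ext T f * linear_ext T g"
proof (induction f rule: mpoly_induct)
  case (monomial m c)
  show ?case
    by (induction g rule: mpoly_induct)
      (auto simp: mult_single assms Const_mult linear_ext_add distrib_left distrib_right mult_ac)
qed (simp add: distrib_right linear_ext_add)

lemma linear_ext_Const_times: "linear_ext T (Const c * f) = Const c * linear_ext T f"
  by (induction f rule: mpoly_induct)
    (auto simp: Const_times_mterm Const_mult linear_ext_add distrib_left mult_ac)

lemma supp_linear_ext: "supp (linear_ext T f) \<subseteq> (\<Union>m \<in> supp f. supp (T m))"
proof
  fix k assume "k \<in> supp (linear_ext T f)"
  then have "(\<Sum>m \<in> supp f. coef f m * coef (T m) k) \<noteq> 0"
    by (simp add: in_keys_iff linear_ext_def lookup_sum)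
  then obtain m where "m \<in> supp f" "coef (T m) k \<noteq> 0"
    by (metis (mono_tags, lifting) mult_zero_right sum.neutral)
  then show "k \<in> (\<Union>m \<in> supp f. supp (T m))" by (auto simp: in_keys_iff)
qed

lemma supp_sum: "supp (sum f A) \<subseteq> (\<Union>i \<in> A. supp (f i))"
proof (induction A rule: infinite_finite_induct)
  case (insert x A)
  then show ?case using keys_add[of "f x" "sum f A"] by auto
qed auto

lemma supp_monomial_plus: "supp (a + b :: _ \<Rightarrow>\<^sub>0 nat) = supp a \<union> supp b"
  by (auto simp: in_keys_iff lookup_add)

lemma mdeg_superset: "finite A \<Longrightarrow> supp m \<subseteq> A \<Longrightarrow> mdeg m = (\<Sum>v \<in> A. coef m v)"
  unfolding mdeg_def by (rule sum.mono_neutral_left) (auto simp: in_keys_iff)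

lemma mdeg_add: "mdeg (a + b) = mdeg a + mdeg b"
proof -
  have "mdeg c = (\<Sum>v \<in> supp a \<union> supp b. coef c v)" if "supp c \<subseteq> supp a \<union> supp b" for c
    by (rule mdeg_superset) (use that in auto)
  from this[of a] this[of b] this[of "a + b"] show ?thesis
    by (auto simp: lookup_add sum.distrib supp_monomial_plus)
qed

lemma mdeg_eq_0 [simp]: "mdeg m = 0 \<longleftrightarrow> m = 0"
  by (auto simp: mdeg_def in_keys_iff poly_mapping_eq_iff fun_eq_iff)

lemma mdeg_scaled: "mdeg (mscale q m) = q * mdeg m"
proof -
  have "mdeg (mscale q m) = (\<Sum>v \<in> supp m. coef (mscale q m) v)"
    by (rule mdeg_superset) (auto simp: in_keys_iff)
  then show ?thesis by (simp add: mdeg_def sum_distrib_left)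
qed

lemma homogeneous_iff: "homogeneous n f \<longleftrightarrow> (\<forall>m \<in> supp f. mdeg m = n)"
  by (simp add: homogeneous_def mdeg_def)

lemma homogeneous_0 [simp]: "homogeneous n 0"
  by (simp add: homogeneous_iff)

lemma homogeneous_add: "homogeneous n f \<Longrightarrow> homogeneous n g \<Longrightarrow> homogeneous n (f + g)"
  unfolding homogeneous_iff using keys_add[of f g] by auto

lemma homogeneous_sum: "(\<And>i. i \<in> A \<Longrightarrow> homogeneous n (f i)) \<Longrightarrow> homogeneous n (sum f A)"
  by (induction A rule: infinite_finite_induct) (auto intro: homogeneous_add)

lemma homogeneous_mult: "homogeneous i f \<Longrightarrow> homogeneous j g \<Longrightarrow> homogeneous (i + j) (f * g)"
  unfolding homogeneous_iff using keys_mult[of f g] by (fastforce simp: mdeg_add)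

lemma homogeneous_Const [simp]: "homogeneous 0 (Const c)"
  by (simp add: homogeneous_iff Const_def)

lemma homogeneous_Const_times: "homogeneous n f \<Longrightarrow> homogeneous n (Const c * f)"
  using homogeneous_mult[of 0 "Const c" n f] by simp

lemma homogeneous_Var [simp]: "homogeneous 1 (Var v)"
  by (simp add: homogeneous_iff Var_def mdeg_def)

lemma homogeneous_power: "homogeneous i f \<Longrightarrow> homogeneous (n * i) (f ^ n)"
proof (induction n)
  case 0
  show ?case using homogeneous_Const[of 1] by simp
qed (auto intro: homogeneous_mult)

lemma homogeneous_prod:
  "(\<And>i. i \<in> A \<Longrightarrow> homogeneous (d i) (f i)) \<Longrightarrow> homogeneous (sum d A) (prod f A)"
proof (induction A rule: infinite_finite_induct)
  case empty
  show ?case using homogeneous_Const[of 1] by simp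
next
  case (infinite A)
  then show ?case using homogeneous_Const[of 1] by simp
qed (auto intro: homogeneous_mult)

lemma polys_in_0 [simp]: "0 \<in> polys_in \<Gamma>"
  by (simp add: polys_in_def)

lemma polys_in_add: "f \<in> polys_in \<Gamma> \<Longrightarrow> g \<in> polys_in \<Gamma> \<Longrightarrow> f + g \<in> polys_in \<Gamma>"
  unfolding polys_in_def using keys_add[of f g] by auto

lemma polys_in_uminus: "f \<in> polys_in \<Gamma> \<Longrightarrow> - f \<in> polys_in \<Gamma>"
  by (auto simp: polys_in_def in_keys_iff)

lemma polys_in_mult: "f \<in> polys_in \<Gamma> \<Longrightarrow> g \<in> polys_in \<Gamma> \<Longrightarrow> f * g \<in> polys_in \<Gamma>"
  unfolding polys_in_def using keys_mult[of f g] by (fastforce simp: supp_monomial_plus)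

lemma polys_in_Const [simp]: "Const c \<in> polys_in \<Gamma>"
  by (simp add: polys_in_def Const_def)

lemma polys_in_1 [simp]: "1 \<in> polys_in \<Gamma>"
  using polys_in_Const[of 1] by simp

lemma polys_in_Var: "x \<in> \<Gamma> \<Longrightarrow> Var x \<in> polys_in \<Gamma>"
  by (simp add: polys_in_def Var_def)

lemma polys_in_mterm: "supp m \<subseteq> \<Gamma> \<Longrightarrow> mterm m c \<in> polys_in \<Gamma>"
  by (simp add: polys_in_def)

lemma polys_in_sum: "(\<And>i. i \<in> A \<Longrightarrow> f i \<in> polys_in \<Gamma>) \<Longrightarrow> sum f A \<in> polys_in \<Gamma>"
  by (induction A rule: infinite_finite_induct) (auto intro: polys_in_add)

lemma polys_in_power: "f \<in> polys_in \<Gamma> \<Longrightarrow> f ^ n \<in> polys_in \<Gamma>"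
  by (induction n) (auto intro: polys_in_mult)

lemma mterm_as_product: "mterm m c = Const c * (\<Prod>v \<in> supp m. Var v ^ coef m v)"
proof -
  have "Var v ^ n = (mterm (Poly_Mapping.single v n) 1 :: ('a, 'b) mpoly)" for v n
  proof -
    show ?thesis by (simp add: Var_def mterm_power mscale_single)
  qed
  moreover have "(\<Prod>v \<in> A. mterm (p v) 1) = (mterm (\<Sum>v \<in> A. p v) 1 :: ('a, 'b) mpoly)"
    if "finite A" for A and p :: "'a \<Rightarrow> 'a \<Rightarrow>\<^sub>0 nat"
    using that by (induction A) (auto simp: mult_single)
  moreover have "(\<Sum>v \<in> supp m. Poly_Mapping.single v (coef m v)) = m"
  proof (rule poly_mapping_eqI)
    fix k
    have "(\<Sum>v \<in> supp m. coef (Poly_Mapping.single v (coef m v)) k)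
        = (\<Sum>v \<in> supp m. if v = k then coef m k else 0)"
      by (rule sum.cong) (auto simp: lookup_single when_def)
    then show "coef (\<Sum>v \<in> supp m. Poly_Mapping.single v (coef m v)) k = coef m k"
      by (auto simp: lookup_sum in_keys_iff)
  qed
  ultimately show ?thesis by (simp add: Const_times_mterm)
qed

lemma mpoly_generated_induct [case_names Const Var plus times]:
  fixes f :: "('v, 'k::field) mpoly"
  assumes Const: "\<And>a. P (Const a)" and Var: "\<And>v. P (Var v)"
    and plus: "\<And>f g. P f \<Longrightarrow> P g \<Longrightarrow> P (f + g)" and times: "\<And>f g. P f \<Longrightarrow> P g \<Longrightarrow> P (f * g)"
  shows "P f"
proof (induction f rule: mpoly_induct)
  case (monomial m a)
  have one: "P 1" using Const[of 1] by simp
  have pow: "P (Var v ^ n)" for v n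
    by (induction n) (simp_all add: one Var times)
  have "P (\<Prod>v \<in> A. Var v ^ coef m v)" for A
    by (induction A rule: infinite_finite_induct) (simp_all add: one pow times)
  then show ?case unfolding mterm_as_product by (intro times Const)
qed (rule plus)

lemma subst_vars_linear_ext:
  "subst_vars \<sigma> = linear_ext (\<lambda>m. \<Prod>v \<in> supp m. \<sigma> v ^ coef m v)"
  by (simp add: subst_vars_def linear_ext_def fun_eq_iff)

lemma prod_powers_add:
  fixes s :: "'v \<Rightarrow> 'r::comm_semiring_1"
  shows "(\<Prod>v \<in> supp (a + b). s v ^ coef (a + b) v)
    = (\<Prod>v \<in> supp a. s v ^ coef a v) * (\<Prod>v \<in> supp b. s v ^ coef b v)"
proof -
  let ?A = "supp a \<union> supp b"
  have *: "(\<Prod>v \<in> supp c. s v ^ coef c v) = (\<Prod>v \<in> ?A. s v ^ coef c v)" if "supp c \<subseteq> ?A" for c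
    by (rule prod.mono_neutral_left) (use that in \<open>auto simp: in_keys_iff\<close>)
  show ?thesis
    by (subst (1 2 3) *) (auto simp: supp_monomial_plus lookup_add power_add prod.distrib)
qed

lemma subst_vars_add: "subst_vars \<sigma> (f + g) = subst_vars \<sigma> f + subst_vars \<sigma> g"
  by (simp add: subst_vars_linear_ext linear_ext_add)

lemma subst_vars_mult: "subst_vars \<sigma> (f * g) = subst_vars \<sigma> f * subst_vars \<sigma> g"
  unfolding subst_vars_linear_ext by (rule linear_ext_mult) (rule prod_powers_add)

lemma subst_vars_Const [simp]: "subst_vars \<sigma> (Const c) = Const c"
  by (simp add: subst_vars_linear_ext Const_def)

lemma subst_vars_Var [simp]: "subst_vars \<sigma> (Var v) = \<sigma> v"
  by (simp add: subst_vars_linear_ext Var_def)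

lemma additive_map_simps:
  fixes F :: "'a::ab_group_add \<Rightarrow> 'b::ab_group_add"
  assumes "\<And>f g. F (f + g) = F f + F g"
  shows "F 0 = 0" "F (- f) = - F f" "F (f - g) = F f - F g"
    "F (sum h A) = (\<Sum>i \<in> A. F (h i))"
proof -
  interpret additive F by standard (rule assms)
  show "F 0 = 0" "F (- f) = - F f" "F (f - g) = F f - F g" "F (sum h A) = (\<Sum>i \<in> A. F (h i))"
    by (simp_all add: zero minus diff sum)
qed

text \<open>
  Uniqueness in the universal property of the polynomial ring: a polynomial in the variables \<open>\<Gamma>\<close> is
  built from constants and these variables. It identifies composites of substitutions with the
  group action.
\<close>

lemma ring_hom_eq_on_polys_in:
  fixes F H :: "('v, 'k::field) mpoly \<Rightarrow> ('w, 'k) mpoly"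
  assumes "\<And>f g. F (f + g) = F f + F g" "\<And>f g. F (f * g) = F f * F g"
    and "\<And>f g. H (f + g) = H f + H g" "\<And>f g. H (f * g) = H f * H g"
    and "\<And>c. F (Const c) = H (Const c)" and "\<And>x. x \<in> \<Gamma> \<Longrightarrow> F (Var x) = H (Var x)"
    and "f \<in> polys_in \<Gamma>"
  shows "F f = H f"
proof -
  have pow: "F (Var x ^ n) = H (Var x ^ n)" if "x \<in> \<Gamma>" for x n
    using that assms(5)[of 1] by (induction n) (auto simp: assms)
  have "F (\<Prod>v \<in> A. Var v ^ e v) = H (\<Prod>v \<in> A. Var v ^ e v)" if "finite A" "A \<subseteq> \<Gamma>" for A and e :: "'v \<Rightarrow> nat"
    using that assms(5)[of 1] by (induction A) (auto simp: assms(1-5) pow)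
  then have mono: "F (mterm m c) = H (mterm m c)" if "supp m \<subseteq> \<Gamma>" for m c
    using that by (simp add: mterm_as_product assms)
  have "supp f \<subseteq> {m. supp m \<subseteq> \<Gamma>}"
    using assms(7) by (auto simp: polys_in_def)
  then show ?thesis
  proof (induction f rule: mpoly_induct_on)
    case zero
    then show ?case using assms(5)[of 0] by simp
  qed (auto simp: mono assms)
qed

text \<open>
  Makes the additivity of the \<open>p\<close>-th power available for polynomials, since it depends on the
  characteristic of the ring in which the powers are taken.
\<close>

lemma CHAR_mpoly: "CHAR(('v, 'k::field) mpoly) = CHAR('k)"
proof (rule CHAR_eqI)
  show "of_nat CHAR('k) = (0 :: ('v, 'k) mpoly)"
    by (simp flip: single_of_nat)
next
  fix n assume "of_nat n = (0 :: ('v, 'k) mpoly)"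
  then have "coef (of_nat n :: ('v, 'k) mpoly) 0 = 0" by simp
  then show "CHAR('k) dvd n" by (simp add: lookup_of_nat of_nat_eq_0_iff_char_dvd)
qed

section \<open>Monomial actions and semi-invariants\<close>

text \<open>
  The group permutes the variables through \<open>\<pi>\<close> up to the scalars \<open>c\<close>, which satisfy the cocycle identity
  of a monomial representation and are \<open>N\<close>-th roots of unity. The permutations are defined on the
  whole type of variables, so that the group acts on all polynomials by ring automorphisms.
\<close>

locale monomial_action = group G for G :: "('g, 'b) monoid_scheme" (structure) +
  fixes \<Gamma> :: "'v set" and \<pi> :: "'g \<Rightarrow> 'v \<Rightarrow> 'v" and c :: "'g \<Rightarrow> 'v \<Rightarrow> 'k::field" and N :: nat
  assumes finite_vars: "finite \<Gamma>"
    and finite_group: "finite (carrier G)"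
    and \<pi>_one: "\<pi> \<one> x = x"
    and \<pi>_mult: "g \<in> carrier G \<Longrightarrow> h \<in> carrier G \<Longrightarrow> \<pi> (g \<otimes> h) x = \<pi> g (\<pi> h x)"
    and \<pi>_in: "g \<in> carrier G \<Longrightarrow> x \<in> \<Gamma> \<Longrightarrow> \<pi> g x \<in> \<Gamma>"
    and c_mult: "g \<in> carrier G \<Longrightarrow> h \<in> carrier G \<Longrightarrow> c (g \<otimes> h) x = c g (\<pi> h x) * c h x"
    and c_root: "g \<in> carrier G \<Longrightarrow> c g x ^ N = 1"
    and N_pos: "N > 0"
begin

lemma \<pi>_inv [simp]:
  assumes "g \<in> carrier G"
  shows "\<pi> (inv g) (\<pi> g x) = x" "\<pi> g (\<pi> (inv g) x) = x"
  using assms \<pi>_mult[of g "inv g" x] \<pi>_mult[of "inv g" g x] by (simp_all add: \<pi>_one)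

lemma inj_\<pi>: "g \<in> carrier G \<Longrightarrow> inj (\<pi> g)"
  by (metis \<pi>_inv(1) injI)

lemma \<pi>_image:
  assumes "g \<in> carrier G" shows "\<pi> g ` \<Gamma> = \<Gamma>"
proof -
  have "\<Gamma> \<subseteq> \<pi> g ` \<Gamma>"
  proof
    fix x assume "x \<in> \<Gamma>"
    then have "\<pi> (inv g) x \<in> \<Gamma>" using assms by (simp add: \<pi>_in)
    then show "x \<in> \<pi> g ` \<Gamma>" using assms by (metis \<pi>_inv(2) imageI)
  qed
  then show ?thesis using assms \<pi>_in by blast
qed

lemma \<pi>_in_iff: "g \<in> carrier G \<Longrightarrow> \<pi> g x \<in> \<Gamma> \<longleftrightarrow> x \<in> \<Gamma>"
  by (metis \<pi>_in \<pi>_inv(1) inv_closed)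

lemma c_nonzero: "g \<in> carrier G \<Longrightarrow> c g x \<noteq> 0"
  using c_root[of g x] N_pos by (auto simp: zero_power)

lemma c_one: "c \<one> x = 1"
  using c_mult[of \<one> \<one> x] c_nonzero[of \<one> x] by (simp add: \<pi>_one)

text \<open>
  The exponent of \<open>\<pi> g x\<close> in the image monomial is the exponent of \<open>x\<close>, hence the pullback along the
  inverse of \<open>g\<close>.
\<close>

definition mon :: "'g \<Rightarrow> ('v \<Rightarrow>\<^sub>0 nat) \<Rightarrow> 'v \<Rightarrow>\<^sub>0 nat" where
  "mon g m = Poly_Mapping.map_key (\<pi> (inv g)) m"

lemma coef_mon: "g \<in> carrier G \<Longrightarrow> coef (mon g m) x = coef m (\<pi> (inv g) x)"
  unfolding mon_def by (subst Poly_Mapping.map_key.rep_eq) (auto simp: inj_\<pi>)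

lemma coef_mon_\<pi> [simp]: "g \<in> carrier G \<Longrightarrow> coef (mon g m) (\<pi> g x) = coef m x"
  by (simp add: coef_mon)

lemma mon_eqI:
  assumes "g \<in> carrier G" and "\<And>x. coef b (\<pi> g x) = coef a x"
  shows "mon g a = b"
proof (rule poly_mapping_eqI)
  fix x
  show "coef (mon g a) x = coef b x"
    using assms(1) assms(2)[of "\<pi> (inv g) x"] by (simp add: coef_mon)
qed

lemma mon_mult: "g \<in> carrier G \<Longrightarrow> h \<in> carrier G \<Longrightarrow> mon (g \<otimes> h) m = mon g (mon h m)"
  by (rule mon_eqI) (auto simp: \<pi>_mult)

lemma mon_one [simp]: "mon \<one> m = m"
  by (rule mon_eqI) (auto simp: \<pi>_one)

lemma mon_inv [simp]:
  assumes "g \<in> carrier G" shows "mon (inv g) (mon g m) = m" "mon g (mon (inv g) m) = m"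
  using assms mon_mult[of g "inv g" m] mon_mult[of "inv g" g m] by simp_all

lemma mon_inject: "g \<in> carrier G \<Longrightarrow> mon g a = mon g b \<longleftrightarrow> a = b"
  by (metis mon_inv(1))

lemma mon_add: "g \<in> carrier G \<Longrightarrow> mon g (a + b) = mon g a + mon g b"
  by (rule mon_eqI) (auto simp: lookup_add)

lemma mon_minus: "g \<in> carrier G \<Longrightarrow> mon g (a - b) = mon g a - mon g b"
  by (rule mon_eqI) (auto simp: lookup_minus)

lemma mon_0 [simp]: "g \<in> carrier G \<Longrightarrow> mon g 0 = 0"
  by (rule mon_eqI) auto

lemma mon_mscale: "g \<in> carrier G \<Longrightarrow> mon g (mscale q m) = mscale q (mon g m)"
  by (rule mon_eqI) auto

lemma supp_mon: "g \<in> carrier G \<Longrightarrow> supp (mon g m) = \<pi> g ` supp m"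
proof (intro equalityI subsetI)
  fix x assume "g \<in> carrier G" "x \<in> supp (mon g m)"
  then have "\<pi> (inv g) x \<in> supp m" "x = \<pi> g (\<pi> (inv g) x)" by (auto simp: in_keys_iff coef_mon)
  then show "x \<in> \<pi> g ` supp m" by blast
qed (auto simp: in_keys_iff)

lemma supp_mon_subset: "g \<in> carrier G \<Longrightarrow> supp (mon g m) \<subseteq> \<Gamma> \<longleftrightarrow> supp m \<subseteq> \<Gamma>"
  by (auto simp: supp_mon \<pi>_in_iff)

lemma mdeg_mon: "g \<in> carrier G \<Longrightarrow> mdeg (mon g m) = mdeg m"
  using inj_\<pi>[of g] by (simp add: mdeg_def supp_mon sum.reindex inj_on_subset)

text \<open>
  The scalar by which \<open>g\<close> multiplies a monomial in addition to permuting its variables.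
\<close>

definition wt :: "'g \<Rightarrow> ('v \<Rightarrow>\<^sub>0 nat) \<Rightarrow> 'k" where
  "wt g m = (\<Prod>v \<in> supp m. c g v ^ coef m v)"

lemma wt_add: "wt g (a + b) = wt g a * wt g b"
  unfolding wt_def by (rule prod_powers_add)

lemma wt_0 [simp]: "wt g 0 = 1"
  by (simp add: wt_def)

lemma wt_mult:
  assumes "g \<in> carrier G" "h \<in> carrier G"
  shows "wt (g \<otimes> h) m = wt g (mon h m) * wt h m"
proof -
  have "wt g (mon h m) = (\<Prod>v \<in> supp m. c g (\<pi> h v) ^ coef m v)"
    using assms inj_\<pi>[of h] by (simp add: wt_def supp_mon prod.reindex inj_on_subset)
  then show ?thesis
    using assms by (simp add: wt_def c_mult power_mult_distrib prod.distrib)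
qed

lemma wt_root:
  assumes "g \<in> carrier G" shows "wt g m ^ N = 1"
proof -
  have "(c g v ^ k) ^ N = 1" for v k
    using c_root[OF assms, of v] by (metis mult.commute power_mult power_one)
  then show ?thesis by (simp add: wt_def prod_power_distrib)
qed

lemma wt_mscale: "wt g (mscale q m) = wt g m ^ q"
proof (induction q)
  case 0
  have "mscale 0 m = 0" by (rule poly_mapping_eqI) simp
  then show ?case by simp
next
  case (Suc q)
  have "mscale (Suc q) m = m + mscale q m" by (rule poly_mapping_eqI) (simp add: lookup_add)
  with Suc show ?case by (simp add: wt_add)
qed

text \<open>
  The extension of the monomial action to polynomials; by \<open>act_times\<close> it is by ring automorphisms.
\<close>

definition act :: "'g \<Rightarrow> ('v, 'k) mpoly \<Rightarrow> ('v, 'k) mpoly" where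
  "act g = linear_ext (\<lambda>m. mterm (mon g m) (wt g m))"

lemma act_mterm: "act g (mterm m z) = mterm (mon g m) (z * wt g m)"
  by (simp add: act_def Const_times_mterm)

lemma act_add: "act g (f + h) = act g f + act g h"
  by (simp add: act_def linear_ext_add)

lemmas act_additive = additive_map_simps[where F = "act g" for g, OF act_add]

lemma act_times:
  assumes "g \<in> carrier G" shows "act g (f * h) = act g f * act g h"
  unfolding act_def
  by (rule linear_ext_mult) (use assms in \<open>simp add: mon_add wt_add mult_single\<close>)

lemma act_Const: "g \<in> carrier G \<Longrightarrow> act g (Const z) = Const z"
  by (simp add: Const_def act_mterm)

lemma act_Const_times: "act g (Const z * f) = Const z * act g f"
  by (simp add: act_def linear_ext_Const_times)

lemma act_power: "g \<in> carrier G \<Longrightarrow> act g (f ^ n) = act g f ^ n"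
  using act_Const[of g 1] by (induction n) (auto simp: act_times)

lemma act_mult: "g \<in> carrier G \<Longrightarrow> h \<in> carrier G \<Longrightarrow> act (g \<otimes> h) f = act g (act h f)"
  by (induction f rule: mpoly_induct) (auto simp: act_mterm mon_mult wt_mult act_add mult_ac)

text \<open>
  The action in terms of coefficients. Invariance and semi-invariance become conditions that relate
  the coefficients along each orbit of monomials, and different orbits do not interact.
\<close>

lemma coef_act: "g \<in> carrier G \<Longrightarrow> coef (act g f) (mon g m) = wt g m * coef f m"
  by (induction f rule: mpoly_induct)
    (auto simp: act_mterm lookup_single when_def mon_inject act_add lookup_add algebra_simps)

lemma act_polys_in:
  assumes "g \<in> carrier G" "f \<in> polys_in \<Gamma>" shows "act g f \<in> polys_in \<Gamma>"
  unfolding act_def linear_ext_def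
proof (intro polys_in_sum polys_in_mult polys_in_Const polys_in_mterm)
  show "supp (mon g a) \<subseteq> \<Gamma>" if "a \<in> supp f" for a
    using that assms by (simp add: supp_mon_subset polys_in_def)
qed

text \<open>
  A pair \<open>(h, z)\<close> in \<open>Z\<close> asks that \<open>h\<close> multiplies \<open>f\<close> by the inverse of \<open>z\<close>. With \<open>Z\<close> the graph of a
  character of a subgroup these are the semi-invariants for the inverse character. Allowing any set
  of pairs makes it evident that there are only finitely many such modules once the values \<open>z\<close> are
  confined to a finite set, and it contains the ring of invariants as the case of the trivial
  character of \<open>G\<close>.
\<close>

definition semi :: "('g \<times> 'k) set \<Rightarrow> ('v, 'k) mpoly set" where
  "semi Z = {f \<in> polys_in \<Gamma>. \<forall>(h, z) \<in> Z. Const z * act h f = f}"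

abbreviation invs :: "('v, 'k) mpoly set" where
  "invs \<equiv> semi (carrier G \<times> {1})"

lemma invs_iff: "f \<in> invs \<longleftrightarrow> f \<in> polys_in \<Gamma> \<and> (\<forall>g \<in> carrier G. act g f = f)"
  by (auto simp: semi_def)

lemma semi_polys_in: "f \<in> semi Z \<Longrightarrow> f \<in> polys_in \<Gamma>"
  by (simp add: semi_def)

lemma semi_0 [simp]: "0 \<in> semi Z"
  by (auto simp: semi_def act_additive)

lemma semi_add: "f \<in> semi Z \<Longrightarrow> g \<in> semi Z \<Longrightarrow> f + g \<in> semi Z"
  by (fastforce simp: semi_def act_add distrib_left intro: polys_in_add)

lemma semi_uminus: "f \<in> semi Z \<Longrightarrow> - f \<in> semi Z"
  by (auto simp: semi_def act_additive intro: polys_in_uminus)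

lemma semi_diff: "f \<in> semi Z \<Longrightarrow> g \<in> semi Z \<Longrightarrow> f - g \<in> semi Z"
  using semi_add[of f Z "- g"] semi_uminus[of g Z] by simp

lemma semi_sum: "(\<And>i. i \<in> A \<Longrightarrow> f i \<in> semi Z) \<Longrightarrow> sum f A \<in> semi Z"
  by (induction A rule: infinite_finite_induct) (auto intro: semi_add)

lemma semi_Const_times:
  assumes "f \<in> semi Z" shows "Const z * f \<in> semi Z"
proof -
  have "Const y * act h (Const z * f) = Const z * f" if "(h, y) \<in> Z" for h y
  proof -
    have "Const y * act h f = f" using assms that by (auto simp: semi_def)
    then show ?thesis by (metis act_Const_times mult.left_commute)
  qed
  with assms show ?thesis by (auto simp: semi_def intro: polys_in_mult)
qed

lemma invs_times_semi:
  assumes "Z \<subseteq> carrier G \<times> UNIV" "r \<in> invs" "f \<in> semi Z"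
  shows "r * f \<in> semi Z"
proof -
  have "Const z * act h (r * f) = r * f" if "(h, z) \<in> Z" for h z
  proof -
    have "h \<in> carrier G" using that assms(1) by auto
    moreover have "Const z * act h f = f" using assms(3) that by (auto simp: semi_def)
    ultimately show ?thesis using assms(2) by (metis act_times invs_iff mult.left_commute)
  qed
  with assms(2,3) show ?thesis by (auto simp: semi_def intro: polys_in_mult)
qed

lemma invs_Const [simp]: "Const z \<in> invs"
  by (simp add: invs_iff act_Const)

lemma invs_1 [simp]: "1 \<in> invs"
  using invs_Const[of 1] by simp

lemma invs_mult: "r \<in> invs \<Longrightarrow> s \<in> invs \<Longrightarrow> r * s \<in> invs"
  by (rule invs_times_semi) auto

text \<open>
  An equivariant linear operator preserves semi-invariants, and for a linear operator equivariance only
  has to be checked on monomials.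
\<close>

lemma semi_linear_ext:
  assumes Z: "Z \<subseteq> carrier G \<times> UNIV"
    and T: "\<And>h a. h \<in> carrier G \<Longrightarrow> act h (T a) = Const (wt h a) * T (mon h a)"
    and poly: "\<And>a. supp a \<subseteq> \<Gamma> \<Longrightarrow> T a \<in> polys_in \<Gamma>"
    and f: "f \<in> semi Z"
  shows "linear_ext T f \<in> semi Z"
proof -
  have *: "act h (linear_ext T f) = linear_ext T (act h f)" if "h \<in> carrier G" for h f
    using that
    by (induction f rule: mpoly_induct)
      (auto simp: act_mterm act_Const_times T act_add linear_ext_add Const_mult mult_ac)
  have "Const z * act h (linear_ext T f) = linear_ext T f" if "(h, z) \<in> Z" for h z
  proof -
    have "Const z * act h f = f" "h \<in> carrier G" using f Z that by (auto simp: semi_def)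
    then show ?thesis by (metis * linear_ext_Const_times)
  qed
  moreover have "linear_ext T f \<in> polys_in \<Gamma>"
    unfolding linear_ext_def
  proof (intro polys_in_sum polys_in_mult polys_in_Const poly)
    show "supp a \<subseteq> \<Gamma>" if "a \<in> supp f" for a
      using that f by (simp add: semi_def polys_in_def)
  qed
  ultimately show ?thesis by (auto simp: semi_def)
qed

text \<open>
  If the set \<open>Q\<close> of monomials is stable under the group, this projection preserves semi-invariants. It
  yields the homogeneous components and the case distinction in the generation argument.
\<close>

definition restrict_poly :: "(('v \<Rightarrow>\<^sub>0 nat) \<Rightarrow> bool) \<Rightarrow> ('v, 'k) mpoly \<Rightarrow> ('v, 'k) mpoly" where
  "restrict_poly Q = linear_ext (\<lambda>a. if Q a then mterm a 1 else 0)"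

lemma coef_restrict_poly: "coef (restrict_poly Q f) a = (if Q a then coef f a else 0)"
  by (induction f rule: mpoly_induct)
    (auto simp: restrict_poly_def Const_times_mterm lookup_single when_def linear_ext_add lookup_add)

lemma semi_restrict_poly:
  assumes "Z \<subseteq> carrier G \<times> UNIV" "\<And>g a. g \<in> carrier G \<Longrightarrow> Q (mon g a) \<longleftrightarrow> Q a" "f \<in> semi Z"
  shows "restrict_poly Q f \<in> semi Z"
  unfolding restrict_poly_def
  by (rule semi_linear_ext)
    (use assms in \<open>auto simp: act_mterm act_additive Const_times_mterm polys_in_mterm\<close>)

end

section \<open>Finite generation of semi-invariants\<close>

text \<open>
  Passing from \<open>U\<close> to \<open>W\<close> replaces some values that are at least \<open>t\<close> by equally many values below \<open>t\<close>.
  This makes the sum of squares decrease in the reduction step.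
\<close>

lemma sum_less_of_top_subset:
  fixes b :: "'v \<Rightarrow> nat"
  assumes "finite \<Gamma>" "U \<subseteq> \<Gamma>" "W \<subseteq> \<Gamma>" "card W = card U" "W \<noteq> U"
    and high: "\<And>x. x \<in> U \<Longrightarrow> t \<le> b x" and low: "\<And>x. x \<in> \<Gamma> - U \<Longrightarrow> b x < t"
  shows "sum b W < sum b U"
proof -
  have fin: "finite U" "finite W" using assms finite_subset by blast+
  have card: "card (W - U) = card (U - W)"
    using assms(4) fin by (metis card_Diff_subset_Int finite_Int Int_commute)
  have ne: "W - U \<noteq> {}"
    using assms(4,5) fin card_subset_eq[of U W] by auto
  have "sum b (W - U) < (\<Sum>x \<in> W - U. t)"
    by (rule sum_strict_mono) (use fin ne assms(3) low in auto)
  also have "\<dots> = (\<Sum>x \<in> U - W. t)" using card by simp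
  also have "\<dots> \<le> sum b (U - W)"
    by (rule sum_mono) (use high in auto)
  finally have "sum b (W - U) < sum b (U - W)" .
  moreover have "sum b W = sum b (W - U) + sum b (W \<inter> U)" "sum b U = sum b (U - W) + sum b (W \<inter> U)"
    using fin by (metis sum.Int_Diff add.commute Int_commute)+
  ultimately show ?thesis by simp
qed

lemma finite_bounded_monomials:
  assumes "finite \<Gamma>"
  shows "finite {m :: 'v \<Rightarrow>\<^sub>0 nat. supp m \<subseteq> \<Gamma> \<and> (\<forall>x \<in> \<Gamma>. coef m x < K)}" (is "finite ?M")
proof -
  have "inj_on (\<lambda>m. \<lambda>x \<in> \<Gamma>. coef m x) ?M"
  proof (rule inj_onI, rule poly_mapping_eqI)
    fix a b x assume *: "a \<in> ?M" "b \<in> ?M" "(\<lambda>x \<in> \<Gamma>. coef a x) = (\<lambda>x \<in> \<Gamma>. coef b x)"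
    show "coef a x = coef b x"
    proof (cases "x \<in> \<Gamma>")
      case True
      then show ?thesis using fun_cong[OF *(3), of x] by simp
    next
      case False
      then have "x \<notin> supp a" "x \<notin> supp b" using * by auto
      then show ?thesis by (simp add: in_keys_iff)
    qed
  qed
  moreover have "(\<lambda>m. \<lambda>x \<in> \<Gamma>. coef m x) ` ?M \<subseteq> (\<Pi>\<^sub>E x \<in> \<Gamma>. {..<K})"
    by auto
  ultimately show ?thesis
    using assms by (meson finite_PiE finite_imageD finite_lessThan finite_subset)
qed

text \<open>
  A maximal independent subset of \<open>V\<close> is finite because it lies in the span of finitely many
  monomials.
\<close>

lemma mpoly_subspace_finite_basis:
  fixes V :: "('v, 'k::field) mpoly set"
  assumes "finite A" and "\<And>f. f \<in> V \<Longrightarrow> supp f \<subseteq> A"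
  obtains B where "finite B" "B \<subseteq> V" "\<forall>f \<in> V. \<exists>u. f = (\<Sum>b \<in> B. Const (u b) * b)"
proof -
  interpret mpoly_vs: vector_space "\<lambda>z (f :: ('v, 'k) mpoly). Const z * f"
    by standard (auto simp: distrib_left distrib_right Const_add Const_mult mult_ac)
  obtain B where B: "B \<subseteq> V" "mpoly_vs.independent B" "V \<subseteq> mpoly_vs.span B"
    using mpoly_vs.basis_exists[of V] by metis
  have "V \<subseteq> mpoly_vs.span ((\<lambda>m. mterm m 1) ` A)"
  proof
    fix f assume "f \<in> V"
    then have "f = (\<Sum>m \<in> supp f. Const (coef f m) * mterm m 1)" "supp f \<subseteq> A"
      using assms(2) mpoly_expand[of f] by (simp_all add: Const_times_mterm)
    moreover have "(\<Sum>m \<in> supp f. Const (coef f m) * mterm m 1) \<in> mpoly_vs.span ((\<lambda>m. mterm m 1) ` A)"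
      using calculation(2)
      by (intro mpoly_vs.span_sum mpoly_vs.span_scale mpoly_vs.span_base) auto
    ultimately show "f \<in> mpoly_vs.span ((\<lambda>m. mterm m 1) ` A)" by simp
  qed
  then have "finite B"
    using mpoly_vs.independent_span_bound[of "(\<lambda>m. mterm m 1) ` A" B] B assms(1) by auto
  moreover have "\<exists>u. f = (\<Sum>b \<in> B. Const (u b) * b)" if "f \<in> V" for f
    using that B(3) mpoly_vs.span_finite[OF \<open>finite B\<close>] by auto
  ultimately show thesis using that B(1) by blast
qed

context monomial_action
begin

text \<open>
  The product of the \<open>N\<close>-th powers of the variables in \<open>W\<close>. The group permutes these monomials without
  introducing scalars, by \<open>wt_nind\<close>.
\<close>

definition nind :: "'v set \<Rightarrow> 'v \<Rightarrow>\<^sub>0 nat" where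
  "nind W = (\<Sum>x \<in> W. Poly_Mapping.single x N)"

lemma coef_nind: "finite W \<Longrightarrow> coef (nind W) x = (if x \<in> W then N else 0)"
  by (simp add: nind_def lookup_sum lookup_single when_def)

lemma supp_nind: "finite W \<Longrightarrow> supp (nind W) = W"
  using N_pos by (simp add: set_eq_iff in_keys_iff coef_nind)

lemma mon_nind: "g \<in> carrier G \<Longrightarrow> finite W \<Longrightarrow> mon g (nind W) = nind (\<pi> g ` W)"
  using inj_\<pi>[of g] by (intro mon_eqI) (auto simp: coef_nind dest: injD)

lemma wt_nind: "g \<in> carrier G \<Longrightarrow> finite W \<Longrightarrow> wt g (nind W) = 1"
  by (simp add: wt_def supp_nind coef_nind c_root)

text \<open>
  The \<open>m\<close>-th elementary symmetric polynomial in the \<open>N\<close>-th powers of the variables.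
\<close>

definition esym :: "nat \<Rightarrow> ('v, 'k) mpoly" where
  "esym m = (\<Sum>W | W \<subseteq> \<Gamma> \<and> card W = m. mterm (nind W) 1)"

lemma finite_subset_vars: "W \<subseteq> \<Gamma> \<Longrightarrow> finite W"
  using finite_vars finite_subset by blast

lemma esym_invs: "esym m \<in> invs"
proof -
  let ?S = "{W. W \<subseteq> \<Gamma> \<and> card W = m}"
  have "esym m \<in> polys_in \<Gamma>"
    unfolding esym_def
    by (intro polys_in_sum polys_in_mterm) (auto simp: supp_nind finite_subset_vars)
  moreover have "act g (esym m) = esym m" if g: "g \<in> carrier G" for g
  proof -
    have maps: "\<pi> h ` W \<in> ?S" if "W \<in> ?S" "h \<in> carrier G" for W h
      using that \<pi>_in[of h] inj_\<pi>[of h] by (auto simp: card_image inj_on_subset)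
    have "act g (esym m) = (\<Sum>W \<in> ?S. mterm (nind (\<pi> g ` W)) 1)"
      unfolding esym_def act_additive(4)
      by (rule sum.cong) (auto simp: act_mterm mon_nind wt_nind g finite_subset_vars)
    also have "\<dots> = (\<Sum>W \<in> ?S. mterm (nind W) 1)"
      by (rule sum.reindex_bij_witness[where i = "\<lambda>W. \<pi> (inv g) ` W" and j = "\<lambda>W. \<pi> g ` W"])
        (use g maps in \<open>auto simp: image_image\<close>)
    finally show ?thesis by (simp add: esym_def)
  qed
  ultimately show ?thesis by (simp add: invs_iff)
qed

text \<open>
  The reduction step refers to the window of exponents from \<open>t\<close> up to, but not including, \<open>t + N\<close>. These
  are the variables above the window, and \<open>gap\<close> says that no exponent lies inside it.
\<close>

definition upper :: "nat \<Rightarrow> ('v \<Rightarrow>\<^sub>0 nat) \<Rightarrow> 'v set" where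
  "upper t a = {x \<in> \<Gamma>. t + N \<le> coef a x}"

definition gap :: "nat \<Rightarrow> ('v \<Rightarrow>\<^sub>0 nat) \<Rightarrow> bool" where
  "gap t a \<longleftrightarrow> (\<forall>x \<in> \<Gamma>. coef a x < t \<or> t + N \<le> coef a x)"

definition sqsum :: "('v \<Rightarrow>\<^sub>0 nat) \<Rightarrow> nat" where
  "sqsum a = (\<Sum>x \<in> \<Gamma>. (coef a x)\<^sup>2)"

lemma upper_subset: "upper t a \<subseteq> \<Gamma>"
  by (auto simp: upper_def)

lemma finite_upper [simp]: "finite (upper t a)"
  by (rule finite_subset_vars[OF upper_subset])

lemma upper_mon:
  assumes g: "g \<in> carrier G" shows "upper t (mon g a) = \<pi> g ` upper t a"
proof (intro equalityI subsetI)
  fix x assume "x \<in> upper t (mon g a)"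
  then have "\<pi> (inv g) x \<in> upper t a" using g by (auto simp: upper_def coef_mon \<pi>_in)
  then show "x \<in> \<pi> g ` upper t a" using g by (metis \<pi>_inv(2) imageI)
qed (use g in \<open>auto simp: upper_def \<pi>_in\<close>)

lemma gap_mon:
  assumes g: "g \<in> carrier G" shows "gap t (mon g a) \<longleftrightarrow> gap t a"
proof -
  have "gap t (mon g a) \<longleftrightarrow> (\<forall>x \<in> \<pi> g ` \<Gamma>. coef (mon g a) x < t \<or> t + N \<le> coef (mon g a) x)"
    by (simp add: \<pi>_image g gap_def)
  then show ?thesis using g by (simp add: gap_def)
qed

text \<open>
  Pigeonhole principle: if one exponent is at least \<open>card \<Gamma> * N\<close>, then the others cannot meet all of the
  \<open>card \<Gamma>\<close> windows that begin at a multiple of \<open>N\<close> below that bound.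
\<close>

lemma gap_exists:
  assumes "x0 \<in> \<Gamma>" "card \<Gamma> * N \<le> coef a x0"
  obtains t where "gap t a" "upper t a \<noteq> {}"
proof -
  \<comment> \<open>The windows are indexed by the quotients of the exponents by \<open>N\<close>.\<close>
  let ?D = "(\<lambda>x. coef a x div N) ` (\<Gamma> - {x0})"
  have pos: "card \<Gamma> > 0" using assms(1) finite_vars card_gt_0_iff by blast
  have "card ?D \<le> card (\<Gamma> - {x0})" using finite_vars by (intro card_image_le) auto
  then have "card ?D < card {..<card \<Gamma>}" using assms(1) pos by simp
  then obtain j where j: "j < card \<Gamma>" "j \<notin> ?D"
    by (metis card_mono finite_Diff finite_imageI finite_vars lessThan_iff not_le subsetI)
  have le: "j * N + N \<le> card \<Gamma> * N" using j(1) mult_le_mono1[of "Suc j" "card \<Gamma>" N] by simp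
  have "gap (j * N) a"
    unfolding gap_def
  proof (rule ballI, rule ccontr)
    fix x assume x: "x \<in> \<Gamma>" and *: "\<not> (coef a x < j * N \<or> j * N + N \<le> coef a x)"
    from * have "j * N \<le> coef a x" "coef a x < j * N + N" by auto
    then have "coef a x div N = j" by (intro div_nat_eqI) (simp_all add: mult.commute)
    moreover have "x \<noteq> x0" using * le assms(2) by auto
    ultimately show False using x j(2) by blast
  qed
  moreover have "x0 \<in> upper (j * N) a" using le assms by (auto simp: upper_def)
  ultimately show thesis using that by blast
qed

lemma sqsum_add_nind:
  assumes "W \<subseteq> \<Gamma>"
  shows "sqsum (b + nind W) = sqsum b + 2 * N * sum (coef b) W + card W * N\<^sup>2"
proof -
  have "sqsum (b + nind W) = (\<Sum>x \<in> \<Gamma>. (coef b x)\<^sup>2 + (if x \<in> W then 2 * N * coef b x + N\<^sup>2 else 0))"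
    unfolding sqsum_def
    by (rule sum.cong) (use assms in \<open>auto simp: lookup_add coef_nind finite_subset_vars power2_sum\<close>)
  also have "\<dots> = sqsum b + (\<Sum>x \<in> W. 2 * N * coef b x + N\<^sup>2)"
    using assms finite_vars by (simp add: sqsum_def sum.distrib Int_absorb1 flip: sum.inter_restrict)
  finally show ?thesis by (simp add: sum.distrib sum_distrib_left)
qed

text \<open>
  The subtraction is exact: the variables in \<open>upper t a\<close> have exponents of at least \<open>N\<close>.
\<close>

definition lower :: "nat \<Rightarrow> ('v \<Rightarrow>\<^sub>0 nat) \<Rightarrow> 'v \<Rightarrow>\<^sub>0 nat" where
  "lower t a = a - nind (upper t a)"

lemma lower_plus: "lower t a + nind (upper t a) = a"
  by (rule poly_mapping_eqI, simp add: lower_def lookup_add lookup_minus coef_nind)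
    (auto simp: upper_def)

lemma sqsum_lower:
  assumes "gap t a" "W \<subseteq> \<Gamma>" "card W = card (upper t a)" "W \<noteq> upper t a"
  shows "sqsum (lower t a + nind W) < sqsum a"
proof -
  have "sum (coef (lower t a)) W < sum (coef (lower t a)) (upper t a)"
  proof (rule sum_less_of_top_subset[OF finite_vars upper_subset assms(2-4)])
    show "t \<le> coef (lower t a) x" if "x \<in> upper t a" for x
      using that by (simp add: lower_def lookup_minus coef_nind) (auto simp: upper_def)
    show "coef (lower t a) x < t" if "x \<in> \<Gamma> - upper t a" for x
      using that assms(1) by (simp add: lower_def lookup_minus coef_nind) (auto simp: upper_def gap_def)
  qed
  then have "sqsum (lower t a + nind W) < sqsum (lower t a + nind (upper t a))"
    using N_pos by (simp add: sqsum_add_nind upper_subset assms(2,3))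
  then show ?thesis by (simp add: lower_plus)
qed

lemma sqsum_lower_less:
  assumes "upper t a \<noteq> {}"
  shows "sqsum (lower t a) < sqsum a"
proof -
  have "sqsum a = sqsum (lower t a + nind (upper t a))" by (simp add: lower_plus)
  moreover have "card (upper t a) > 0" using assms by (simp add: card_gt_0_iff)
  ultimately show ?thesis using N_pos by (simp add: sqsum_add_nind upper_subset)
qed

text \<open>
  Lowering is an equivariant operation on monomials because passing from \<open>a\<close> to \<open>lower t a\<close> removes
  \<open>N\<close>-th powers only, so \<open>f'\<close> is again semi-invariant. In the product of \<open>lower t a\<close> with the elementary
  symmetric polynomial, the set \<open>upper t a\<close> contributes \<open>a\<close> itself, and every other set of variables of
  the same size raises some smaller exponents instead and thus yields a smaller sum of squares.
\<close>

lemma goebel_step: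
  assumes Z: "Z \<subseteq> carrier G \<times> UNIV" and f: "f \<in> semi Z"
    and gap: "\<And>a. a \<in> supp f \<Longrightarrow> gap t a \<and> card (upper t a) = m" and "m > 0"
  obtains f' where "f' \<in> semi Z" "f - esym m * f' \<in> semi Z"
    "\<And>b. b \<in> supp f' \<union> supp (f - esym m * f') \<Longrightarrow> \<exists>a \<in> supp f. sqsum b < sqsum a"
proof -
  define f' where "f' = linear_ext (\<lambda>a. mterm (lower t a) 1) f"
  have f': "f' \<in> semi Z"
    unfolding f'_def
  proof (rule semi_linear_ext[OF Z _ _ f])
    show "act h (mterm (lower t a) 1) = Const (wt h a) * mterm (lower t (mon h a)) 1"
      if "h \<in> carrier G" for h a
    proof -
      have "wt h a = wt h (lower t a)"
        using wt_add[of h "lower t a" "nind (upper t a)"] that by (simp add: lower_plus wt_nind)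
      moreover have "mon h (lower t a) = lower t (mon h a)"
        using that by (simp add: lower_def mon_minus mon_nind upper_mon)
      ultimately show ?thesis by (simp add: act_mterm Const_times_mterm)
    qed
    show "mterm (lower t a) 1 \<in> polys_in \<Gamma>" if "supp a \<subseteq> \<Gamma>" for a
      using that by (intro polys_in_mterm) (auto simp: in_keys_iff lower_def lookup_minus)
  qed
  let ?S = "{W. W \<subseteq> \<Gamma> \<and> card W = m}"
  have fin: "finite ?S" using finite_vars by simp
  \<comment> \<open>The error terms: all sets of \<open>m\<close> variables other than \<open>upper t a\<close>.\<close>
  define r where "r a = (\<Sum>W \<in> ?S - {upper t a}. mterm (lower t a + nind W) (1 :: 'k))" for a
  have prod: "esym m * mterm (lower t a) 1 = mterm a 1 + r a" if "a \<in> supp f" for a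
  proof -
    have "upper t a \<in> ?S" using gap[OF that] upper_subset by auto
    then have "(\<Sum>W \<in> ?S. mterm (lower t a + nind W) 1) = mterm a (1 :: 'k) + r a"
      using fin by (simp add: r_def sum.remove[of ?S "upper t a"] lower_plus)
    then show ?thesis by (simp add: esym_def sum_distrib_right mult_single add.commute)
  qed
  have "esym m * f' = (\<Sum>a \<in> supp f. Const (coef f a) * (mterm a 1 + r a))"
    unfolding f'_def linear_ext_def sum_distrib_left
    by (rule sum.cong) (auto simp: mult.left_commute simp flip: prod)
  also have "\<dots> = f + linear_ext r f"
    using mpoly_expand[of f] by (simp add: distrib_left sum.distrib linear_ext_def Const_times_mterm)
  finally have diff: "f - esym m * f' = - linear_ext r f" by simp
  show thesis
  proof (rule that[OF f'])
    show "f - esym m * f' \<in> semi Z"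
      by (intro semi_diff f invs_times_semi Z esym_invs f')
    fix b assume "b \<in> supp f' \<union> supp (f - esym m * f')"
    then consider "b \<in> supp f'" | "b \<in> supp (linear_ext r f)" by (auto simp: diff in_keys_iff)
    then show "\<exists>a \<in> supp f. sqsum b < sqsum a"
    proof cases
      case 1
      then obtain a where a: "a \<in> supp f" "b = lower t a"
        using supp_linear_ext[of "\<lambda>a. mterm (lower t a) 1" f] by (auto simp: f'_def)
      moreover have "upper t a \<noteq> {}" using gap[OF a(1)] \<open>m > 0\<close> by auto
      ultimately show ?thesis using sqsum_lower_less by blast
    next
      case 2
      then obtain a where a: "a \<in> supp f" "b \<in> supp (r a)"
        using supp_linear_ext[of r f] by auto
      then obtain W where "W \<in> ?S - {upper t a}" "b \<in> supp (mterm (lower t a + nind W) (1::'k))"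
        using supp_sum[of "\<lambda>W. mterm (lower t a + nind W) (1::'k)" "?S - {upper t a}"]
        unfolding r_def by blast
      then have "sqsum b < sqsum a" using sqsum_lower[of t a W] gap[OF a(1)] by auto
      with a show ?thesis by blast
    qed
  qed
qed

text \<open>
  The induction is on a bound \<open>s\<close> for the sums of squares and, inside, on the number of terms. The terms
  that share the window and the number of exponents above it form a semi-invariant to which the step
  applies; the remaining terms are fewer.
\<close>

lemma goebel_induction:
  assumes Z: "Z \<subseteq> carrier G \<times> UNIV"
    and small: "\<And>f. f \<in> semi Z \<Longrightarrow> (\<And>a x. a \<in> supp f \<Longrightarrow> x \<in> \<Gamma> \<Longrightarrow> coef a x < card \<Gamma> * N) \<Longrightarrow> f \<in> Y"
    and add: "\<And>f g. f \<in> Y \<Longrightarrow> g \<in> Y \<Longrightarrow> f + g \<in> Y"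
    and mult: "\<And>f m. f \<in> Y \<Longrightarrow> m \<le> card \<Gamma> \<Longrightarrow> esym m * f \<in> Y"
    and f: "f \<in> semi Z"
  shows "f \<in> Y"
proof -
  have "f \<in> Y" if "f \<in> semi Z" "\<And>a. a \<in> supp f \<Longrightarrow> sqsum a < s" for f s
    using that
  proof (induction s arbitrary: f rule: less_induct)
    case (less s)
    have smaller: "h \<in> Y" if "h \<in> semi Z" "\<And>b. b \<in> supp h \<Longrightarrow> \<exists>a \<in> supp f. sqsum b < sqsum a"
        "\<And>a. a \<in> supp f \<Longrightarrow> sqsum a < s" for f h
    proof (cases "s = 0")
      case True
      then have "supp h = {}" using that(2,3) by (metis equals0I not_less0)
      then show ?thesis by (intro small that(1)) simp_all
    next
      case False
      have "sqsum b < s - 1" if "b \<in> supp h" for b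
        using \<open>\<And>b. b \<in> supp h \<Longrightarrow> _\<close>[OF that] \<open>\<And>a. a \<in> supp f \<Longrightarrow> _\<close> by fastforce
      then show ?thesis using less.IH[of "s - 1" h] False that(1) by auto
    qed
    show ?case
      using less.prems
    proof (induction "card (supp f)" arbitrary: f rule: less_induct)
      case (less f)
      show ?case
      proof (cases "\<exists>a \<in> supp f. \<exists>x \<in> \<Gamma>. card \<Gamma> * N \<le> coef a x")
        case False
        then show ?thesis by (intro small less.prems) force+
      next
        case True
        then obtain a0 x0 where a0: "a0 \<in> supp f" "x0 \<in> \<Gamma>" "card \<Gamma> * N \<le> coef a0 x0" by blast
        obtain t where t: "gap t a0" "upper t a0 \<noteq> {}" using gap_exists[OF a0(2,3)] .
        define m where "m = card (upper t a0)"
        define Q where "Q a \<longleftrightarrow> gap t a \<and> card (upper t a) = m" for a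
        have Q: "Q (mon g a) \<longleftrightarrow> Q a" if "g \<in> carrier G" for g a
          using that inj_\<pi>[OF that] by (simp add: Q_def gap_mon upper_mon card_image inj_on_subset)
        let ?f1 = "restrict_poly Q f" and ?f2 = "restrict_poly (\<lambda>a. \<not> Q a) f"
        have semi: "?f1 \<in> semi Z" "?f2 \<in> semi Z"
          using less.prems(1) Q by (auto intro!: semi_restrict_poly Z)
        have supp1: "a \<in> supp ?f1 \<longleftrightarrow> a \<in> supp f \<and> Q a" for a
          by (simp add: in_keys_iff coef_restrict_poly)
        have supp2: "a \<in> supp ?f2 \<longleftrightarrow> a \<in> supp f \<and> \<not> Q a" for a
          by (simp add: in_keys_iff coef_restrict_poly)
        have split: "f = ?f1 + ?f2"
          by (rule poly_mapping_eqI) (simp add: lookup_add coef_restrict_poly)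
        have "Q a0" using t by (simp add: Q_def m_def)
        then have "supp ?f2 \<subset> supp f" using supp2 a0(1) by blast
        then have "?f2 \<in> Y"
          using less.hyps[of ?f2] less.prems(2) semi(2) by (simp add: psubset_card_mono psubset_eq subset_iff)
        moreover have "?f1 \<in> Y"
        proof -
          have "m > 0" using t(2) by (simp add: m_def card_gt_0_iff)
          then obtain f' where f': "f' \<in> semi Z" "?f1 - esym m * f' \<in> semi Z"
            "\<And>b. b \<in> supp f' \<union> supp (?f1 - esym m * f') \<Longrightarrow> \<exists>a \<in> supp ?f1. sqsum b < sqsum a"
            using goebel_step[OF Z semi(1), of t m] supp1 unfolding Q_def by blast
          have *: "\<exists>a \<in> supp f. sqsum b < sqsum a"
            if "b \<in> supp f' \<union> supp (?f1 - esym m * f')" for b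
            using f'(3)[OF that] supp1 by blast
          have "f' \<in> Y" "?f1 - esym m * f' \<in> Y"
            by (rule smaller[of _ f]; use f' * less.prems(2) in blast)+
          moreover have "m \<le> card \<Gamma>"
            unfolding m_def by (intro card_mono finite_vars upper_subset)
          ultimately have "esym m * f' + (?f1 - esym m * f') \<in> Y" by (intro add mult)
          then show ?thesis by simp
        qed
        ultimately show ?thesis using add split by metis
      qed
    qed
  qed
  from this[OF f, of "Suc (Max (sqsum ` supp f))"] show ?thesis by (simp add: less_Suc_eq_le)
qed

text \<open>
  The span of \<open>B\<close> over the algebra generated by the first \<open>card \<Gamma>\<close> of the polynomials \<open>esym\<close>. As an
  inductive set it serves both for generating modules over the invariants and for generating the
  invariants as an algebra.
\<close>

inductive_set esym_span :: "('v, 'k) mpoly set \<Rightarrow> ('v, 'k) mpoly set" for B where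
  base: "b \<in> B \<Longrightarrow> b \<in> esym_span B"
| zero: "0 \<in> esym_span B"
| plus: "f \<in> esym_span B \<Longrightarrow> h \<in> esym_span B \<Longrightarrow> f + h \<in> esym_span B"
| scalar: "f \<in> esym_span B \<Longrightarrow> Const z * f \<in> esym_span B"
| esym: "f \<in> esym_span B \<Longrightarrow> m \<le> card \<Gamma> \<Longrightarrow> esym m * f \<in> esym_span B"

theorem semi_finitely_generated:
  assumes Z: "Z \<subseteq> carrier G \<times> UNIV"
  obtains B where "finite B" "B \<subseteq> semi Z" "semi Z \<subseteq> esym_span B"
proof -
  let ?K = "card \<Gamma> * N"
  let ?V = "{f \<in> semi Z. \<forall>a \<in> supp f. \<forall>x \<in> \<Gamma>. coef a x < ?K}"
  let ?A = "{m :: 'v \<Rightarrow>\<^sub>0 nat. supp m \<subseteq> \<Gamma> \<and> (\<forall>x \<in> \<Gamma>. coef m x < ?K)}"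
  have supp: "supp f \<subseteq> ?A" if "f \<in> ?V" for f
    using that by (auto simp: semi_def polys_in_def)
  obtain B where B: "finite B" "B \<subseteq> ?V"
      "\<forall>f \<in> ?V. \<exists>u. f = (\<Sum>b \<in> B. Const (u b) * b)"
    by (rule mpoly_subspace_finite_basis[OF finite_bounded_monomials[OF finite_vars] supp])
  have "h \<in> esym_span B"
    if h: "h \<in> semi Z" "\<And>a x. a \<in> supp h \<Longrightarrow> x \<in> \<Gamma> \<Longrightarrow> coef a x < ?K" for h
  proof -
    have "h \<in> ?V" using h by simp
    from bspec[OF B(3) this] obtain u where u: "h = (\<Sum>b \<in> B. Const (u b) * b)" ..
    have "(\<Sum>b \<in> C. Const (u b) * b) \<in> esym_span B" if "C \<subseteq> B" for C
      using that
      by (induction C rule: infinite_finite_induct) (auto intro: esym_span.intros)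
    then show ?thesis using u by simp
  qed
  then have "semi Z \<subseteq> esym_span B"
    using goebel_induction[OF Z, of "esym_span B"] by (blast intro: esym_span.plus esym_span.esym)
  moreover have "B \<subseteq> semi Z" using B(2) by blast
  ultimately show thesis using B(1) that by blast
qed

end

section \<open>Splitting the Frobenius over the monomials\<close>

lemma coef_mterm_times:
  "coef (mterm b z * f) (b + m) = z * coef f m"
  by (induction f rule: mpoly_induct)
    (auto simp: mult_single lookup_single when_def distrib_left lookup_add)

lemma coef_mterm_times_outside:
  assumes "\<And>m'. m \<noteq> b + m'"
  shows "coef (mterm b z * f) m = 0"
  using assms
  by (induction f rule: mpoly_induct)
    (auto simp: mult_single lookup_single when_def distrib_left lookup_add)

locale perfect_monomial_action = monomial_action G \<Gamma> \<pi> c N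
  for G :: "('g, 'b) monoid_scheme" (structure) and \<Gamma> :: "'v set" and \<pi> :: "'g \<Rightarrow> 'v \<Rightarrow> 'v"
    and c :: "'g \<Rightarrow> 'v \<Rightarrow> 'k::field" and N :: nat +
  assumes char_pos: "CHAR('k) > 0"
    and perfect: "\<exists>b::'k. b ^ CHAR('k) = a"
begin

lemma power_CHAR_surj: "\<exists>y. (y :: 'k) ^ (CHAR('k) ^ n) = x"
proof (induction n arbitrary: x)
  case (Suc n)
  obtain z where "z ^ CHAR('k) = x" using perfect by blast
  moreover obtain y where "y ^ (CHAR('k) ^ n) = z" using Suc by blast
  ultimately have "y ^ (CHAR('k) ^ n * CHAR('k)) = x" by (simp add: power_mult)
  then show ?case by (metis power_Suc mult.commute)
qed simp

context
  fixes e :: nat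
begin

text \<open>
  Taking \<open>q\<close>-th powers is the \<open>e\<close>-th iterate of the Frobenius endomorphism.
\<close>

definition q :: nat where
  "q = CHAR('k) ^ e"

lemma q_pos: "q > 0"
  using char_pos by (simp add: q_def)

lemma prime_char: "Factorial_Ring.prime CHAR('k)"
  using char_pos by (rule prime_CHAR_semidom)

lemma field_frobenius_add: "(x + y :: 'k) ^ q = x ^ q + y ^ q"
  using prime_char q_def by (rule freshmans_dream')

lemma mpoly_frobenius_add: "(f + g :: ('v, 'k) mpoly) ^ q = f ^ q + g ^ q"
  by (rule freshmans_dream'[of _ e]) (simp_all add: CHAR_mpoly prime_char q_def)

lemma frobenius_inj:
  assumes "(x :: 'k) ^ q = y ^ q" shows "x = y"
proof -
  have "(x - y) ^ q = 0"
    using field_frobenius_add[of "x - y" y] assms by simp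
  then show ?thesis by simp
qed

lemma frobenius_surj: "\<exists>y. (y :: 'k) ^ q = x"
  unfolding q_def by (rule power_CHAR_surj)

definition froot :: "'k \<Rightarrow> 'k" where
  "froot x = (SOME y. y ^ q = x)"

lemma froot_power [simp]: "froot x ^ q = x"
  unfolding froot_def by (rule someI_ex) (rule frobenius_surj)

lemma froot_eqI: "y ^ q = x \<Longrightarrow> froot x = y"
  by (rule frobenius_inj) simp

lemma froot_of_power [simp]: "froot (x ^ q) = x"
  by (rule froot_eqI) simp

lemma froot_0 [simp]: "froot 0 = 0"
  using q_pos by (intro froot_eqI) simp

lemma froot_1 [simp]: "froot 1 = 1"
  by (intro froot_eqI) simp

lemma froot_add: "froot (x + y) = froot x + froot y"
  by (intro froot_eqI) (simp add: field_frobenius_add)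

lemma froot_mult: "froot (x * y) = froot x * froot y"
  by (intro froot_eqI) (simp add: power_mult_distrib)

lemma froot_root_of_unity:
  assumes "x ^ N = 1" shows "froot x ^ N = 1"
proof (rule frobenius_inj)
  have "(froot x ^ N) ^ q = (froot x ^ q) ^ N" by (metis mult.commute power_mult)
  then show "(froot x ^ N) ^ q = 1 ^ q" using assms by simp
qed

text \<open>
  The coefficient of \<open>f\<close>, viewed in \<open>S\<^bsup>1/q\<^esup>\<close>, at the basis element \<open>x\<^bsup>a/q\<^esup>\<close>: it collects
  the terms of \<open>f\<close> whose exponents have the form \<open>mscale q b + a\<close>, and extracts \<open>q\<close>-th roots.
\<close>

definition component :: "('v \<Rightarrow>\<^sub>0 nat) \<Rightarrow> ('v, 'k) mpoly \<Rightarrow> ('v, 'k) mpoly" where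
  "component a f = Poly_Mapping.map froot (Poly_Mapping.map_key (\<lambda>b. mscale q b + a) f)"

lemma inj_frobenius_monomial: "inj (\<lambda>b :: 'v \<Rightarrow>\<^sub>0 nat. mscale q b + a)"
proof (rule injI, rule poly_mapping_eqI)
  fix x y :: "'v \<Rightarrow>\<^sub>0 nat" and k
  assume "mscale q x + a = mscale q y + a"
  then have "coef (mscale q x) k = coef (mscale q y) k" by simp
  then show "coef x k = coef y k" using q_pos by simp
qed

lemma coef_component: "coef (component a f) b = froot (coef f (mscale q b + a))"
  by (simp add: component_def Poly_Mapping.map.rep_eq when_def
      Poly_Mapping.map_key.rep_eq[OF inj_frobenius_monomial])

lemma component_add: "component a (f + g) = component a f + component a g"
  by (rule poly_mapping_eqI) (simp add: coef_component lookup_add froot_add)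

lemmas component_additive = additive_map_simps[where F = "component a" for a, OF component_add]

text \<open>
  The exponents of the \<open>S\<close>-basis of \<open>S\<^bsup>1/q\<^esup>\<close>.
\<close>

definition box :: "('v \<Rightarrow>\<^sub>0 nat) set" where
  "box = {a. supp a \<subseteq> \<Gamma> \<and> (\<forall>x \<in> \<Gamma>. coef a x < q)}"

lemma finite_box: "finite box"
  unfolding box_def by (rule finite_bounded_monomials[OF finite_vars])

lemma box_less:
  assumes "a \<in> box" shows "coef a x < q"
proof (cases "x \<in> \<Gamma>")
  case False
  then have "x \<notin> supp a" using assms by (auto simp: box_def)
  then show ?thesis using q_pos by (simp add: in_keys_iff)
qed (use assms in \<open>simp add: box_def\<close>)

lemma mon_box: "g \<in> carrier G \<Longrightarrow> a \<in> box \<Longrightarrow> mon g a \<in> box"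
  using box_less[of a] by (simp add: box_def supp_mon_subset coef_mon)

lemma mscale_add: "mscale r (a + b) = mscale r a + mscale r b"
  by (rule poly_mapping_eqI) (simp add: lookup_add distrib_left)

text \<open>
  Linearity over \<open>S\<close>. Both sides are additive in \<open>r\<close>, since taking \<open>q\<close>-th powers is, so that \<open>r\<close> may be
  taken to be a single term; the exponents in \<open>a\<close> being below \<open>q\<close>, divisibility of a monomial by a
  \<open>q\<close>-th power can be tested before adding \<open>a\<close>.
\<close>

lemma component_power_times:
  assumes a: "a \<in> box"
  shows "component a (r ^ q * f) = r * component a f"
proof (induction r rule: mpoly_induct)
  case (plus r s)
  then show ?case by (simp add: mpoly_frobenius_add distrib_right component_add)
next
  case (monomial b z)
  show ?case
  proof (rule poly_mapping_eqI)
    fix m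
    show "coef (component a (mterm b z ^ q * f)) m = coef (mterm b z * component a f) m"
    proof (cases "\<exists>m'. m = b + m'")
      case True
      then obtain m' where m: "m = b + m'" ..
      have "coef (mterm (mscale q b) (z ^ q) * f) (mscale q m + a)
          = z ^ q * coef f (mscale q m' + a)"
        using coef_mterm_times[of "mscale q b" "z ^ q" f "mscale q m' + a"]
        by (simp add: m mscale_add add.assoc)
      then show ?thesis
        by (simp add: coef_component mterm_power froot_mult m coef_mterm_times)
    next
      case False
      have "mscale q m + a \<noteq> mscale q b + m'" for m'
      proof
        assume *: "mscale q m + a = mscale q b + m'"
        have "coef b x \<le> coef m x" for x
        proof (rule ccontr)
          assume "\<not> coef b x \<le> coef m x"
          then have "q * coef b x \<ge> q * coef m x + q"
            using mult_le_mono2[of "Suc (coef m x)" "coef b x" q] by simp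
          moreover have "q * coef m x + coef a x = q * coef b x + coef m' x"
            using arg_cong[OF *, of "\<lambda>p. coef p x"] by (simp add: lookup_add)
          ultimately show False using box_less[OF a, of x] by simp
        qed
        then have "m = b + (m - b)"
          by (intro poly_mapping_eqI) (simp add: lookup_add lookup_minus)
        with False show False by blast
      qed
      then have "coef (mterm (mscale q b) (z ^ q) * f) (mscale q m + a) = 0"
        by (rule coef_mterm_times_outside)
      moreover have "coef (mterm b z * component a f) m = 0"
        using False by (intro coef_mterm_times_outside) blast
      ultimately show ?thesis by (simp add: coef_component mterm_power)
    qed
  qed
qed

lemma component_mterm:
  assumes a: "a \<in> box" and b: "b \<in> box"
  shows "component a (mterm b z) = (if a = b then Const (froot z) else 0)"
proof -
  have iff: "b = mscale q m + a \<longleftrightarrow> m = 0 \<and> a = b" for m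
  proof
    assume *: "b = mscale q m + a"
    have "coef m x = 0" for x
    proof (rule ccontr)
      assume "coef m x \<noteq> 0"
      then have "q \<le> q * coef m x" by simp
      also have "\<dots> \<le> coef b x" by (simp add: * lookup_add)
      finally show False using box_less[OF b, of x] by simp
    qed
    then have "m = 0" by (intro poly_mapping_eqI) simp
    moreover have "mscale q 0 = (0 :: 'v \<Rightarrow>\<^sub>0 nat)" by (intro poly_mapping_eqI) simp
    ultimately show "m = 0 \<and> a = b" using * by simp
  next
    have "mscale q 0 = (0 :: 'v \<Rightarrow>\<^sub>0 nat)" by (intro poly_mapping_eqI) simp
    then show "m = 0 \<and> a = b \<Longrightarrow> b = mscale q m + a" by simp
  qed
  show ?thesis
    by (rule poly_mapping_eqI) (auto simp: coef_component lookup_single when_def iff Const_def)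
qed

text \<open>
  The graph of the \<open>q\<close>-th root of the character by which the stabilizer of \<open>a\<close> acts on the monomial \<open>a\<close>.
  Its values are \<open>N\<close>-th roots of unity, in a finite set that does not depend on \<open>e\<close>.
\<close>

definition stab_pairs :: "('v \<Rightarrow>\<^sub>0 nat) \<Rightarrow> ('g \<times> 'k) set" where
  "stab_pairs a = {(h, froot (wt h a)) | h. h \<in> carrier G \<and> mon h a = a}"

lemma stab_pairs_subset: "stab_pairs a \<subseteq> carrier G \<times> {z. z ^ N = 1}"
  by (auto simp: stab_pairs_def wt_root froot_root_of_unity)

lemma coef_invs:
  assumes "f \<in> invs" "h \<in> carrier G"
  shows "coef f (mon h m) = wt h m * coef f m"
  using coef_act[of h f m] assms by (simp add: invs_iff)

lemma component_polys_in: "f \<in> polys_in \<Gamma> \<Longrightarrow> component a f \<in> polys_in \<Gamma>"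
proof -
  assume f: "f \<in> polys_in \<Gamma>"
  have "supp b \<subseteq> \<Gamma>" if "b \<in> supp (component a f)" for b
  proof -
    have "mscale q b + a \<in> supp f"
      using that by (auto simp: in_keys_iff coef_component)
    then have "supp (mscale q b + a) \<subseteq> \<Gamma>" using f by (simp add: polys_in_def)
    moreover have "supp (mscale q b) = supp b" using q_pos by (simp add: set_eq_iff in_keys_iff)
    ultimately show ?thesis by (simp add: supp_monomial_plus)
  qed
  then show ?thesis by (simp add: polys_in_def)
qed

text \<open>
  An element \<open>h\<close> that fixes \<open>a\<close> carries \<open>mscale q m + a\<close> to \<open>mscale q (mon h m) + a\<close>, with the scalar
  \<open>wt h m ^ q * wt h a\<close>. Taking \<open>q\<close>-th roots leaves the action of \<open>h\<close> on \<open>m\<close> and the \<open>q\<close>-th root of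
  \<open>wt h a\<close>.
\<close>

lemma component_semi:
  assumes f: "f \<in> invs"
  shows "component a f \<in> semi (stab_pairs a)"
proof -
  have "Const (froot (wt h a)) * act h (component a f) = component a f"
    if h: "h \<in> carrier G" "mon h a = a" for h
  proof (rule poly_mapping_eqI)
    fix k
    define m where "m = mon (inv h) k"
    have k: "k = mon h m" using h by (simp add: m_def)
    have "mscale q (mon h m) + a = mon h (mscale q m + a)"
      using h by (simp add: mon_add mon_mscale)
    then have "coef (component a f) k = froot (wt h m ^ q * wt h a * coef f (mscale q m + a))"
      using h f by (simp add: coef_component k coef_invs wt_add wt_mscale)
    also have "\<dots> = froot (wt h a) * (wt h m * coef (component a f) m)"
      by (simp add: froot_mult coef_component mult_ac)
    finally show "coef (Const (froot (wt h a)) * act h (component a f)) k = coef (component a f) k"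
      using h by (simp add: k coef_act)
  qed
  then show ?thesis
    using f by (auto simp: semi_def stab_pairs_def component_polys_in)
qed

lemma box_division:
  assumes "supp k \<subseteq> \<Gamma>"
  obtains b a where "k = mscale q b + a" "a \<in> box"
proof
  have div: "coef (Poly_Mapping.map (\<lambda>n. n div q) k) x = coef k x div q" for x
    by (simp add: Poly_Mapping.map.rep_eq when_def)
  have mod: "coef (Poly_Mapping.map (\<lambda>n. n mod q) k) x = coef k x mod q" for x
    by (simp add: Poly_Mapping.map.rep_eq when_def)
  show "k = mscale q (Poly_Mapping.map (\<lambda>n. n div q) k) + Poly_Mapping.map (\<lambda>n. n mod q) k"
    by (rule poly_mapping_eqI) (simp add: lookup_add div mod)
  show "Poly_Mapping.map (\<lambda>n. n mod q) k \<in> box"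
  proof -
    have "x \<in> supp k" if "x \<in> supp (Poly_Mapping.map (\<lambda>n. n mod q) k)" for x
      using that by (metis in_keys_iff mod mod_0)
    then show ?thesis using assms q_pos by (auto simp: box_def mod)
  qed
qed

text \<open>
  One exponent from each orbit of the group on the basis monomials of \<open>S\<^bsup>1/q\<^esup>\<close>.
\<close>

definition transversal :: "('v \<Rightarrow>\<^sub>0 nat) set \<Rightarrow> bool" where
  "transversal T \<longleftrightarrow> T \<subseteq> box \<and> (\<forall>a \<in> box. \<exists>t \<in> T. \<exists>g \<in> carrier G. mon g t = a) \<and>
     (\<forall>t \<in> T. \<forall>t' \<in> T. \<forall>g \<in> carrier G. mon g t = t' \<longrightarrow> t = t')"

lemma transversal_exists: "\<exists>T. transversal T"
proof -
  \<comment> \<open>The chosen representative depends on the orbit only, since it is chosen from the orbit as a set.\<close>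
  define orb where "orb a = {mon g a | g. g \<in> carrier G}" for a
  define rep where "rep a = (SOME b. b \<in> orb a)" for a
  have self: "a \<in> orb a" for a
    unfolding orb_def by (rule CollectI, rule exI[of _ \<one>]) simp
  have rep: "rep a \<in> orb a" for a
    unfolding rep_def by (rule someI[of "\<lambda>b. b \<in> orb a"]) (rule self)
  have sub: "orb (mon g a) \<subseteq> orb a" if "g \<in> carrier G" for g a
  proof
    fix b assume "b \<in> orb (mon g a)"
    then obtain h where h: "h \<in> carrier G" "b = mon h (mon g a)"
      by (auto simp: orb_def)
    then have "b = mon (h \<otimes> g) a" using that by (simp add: mon_mult)
    moreover have "h \<otimes> g \<in> carrier G" using h(1) that by simp
    ultimately show "b \<in> orb a" unfolding orb_def by blast
  qed
  have eq: "orb (mon g a) = orb a" if "g \<in> carrier G" for g a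
    using sub[OF that, of a] sub[of "inv g" "mon g a"] that by simp
  show ?thesis
    unfolding transversal_def
  proof (intro exI[of _ "rep ` box"] conjI ballI impI)
    show "rep ` box \<subseteq> box"
    proof (rule image_subsetI)
      fix a assume "a \<in> box"
      then show "rep a \<in> box" using rep[of a] by (auto simp: orb_def mon_box)
    qed
    show "\<exists>t \<in> rep ` box. \<exists>g \<in> carrier G. mon g t = a" if "a \<in> box" for a
    proof -
      obtain g where g: "g \<in> carrier G" "rep a = mon g a" using rep[of a] by (auto simp: orb_def)
      then have "mon (inv g) (rep a) = a" by simp
      then show ?thesis using g(1) that by blast
    qed
    show "t = t'" if "t \<in> rep ` box" "t' \<in> rep ` box" "g \<in> carrier G" "mon g t = t'" for t t' g
    proof -
      have idem: "rep s = s" if s: "s \<in> rep ` box" for s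
      proof -
        obtain a where a: "s = rep a" using s by blast
        obtain h where h: "h \<in> carrier G" "s = mon h a" using rep[of a] by (auto simp: orb_def a)
        have "orb s = orb a" using eq[OF h(1), of a] h(2) by simp
        then show ?thesis by (simp add: a rep_def)
      qed
      have "orb t' = orb t" using eq[OF that(3), of t] that(4) by simp
      then have "rep t = rep t'" by (simp add: rep_def)
      then show ?thesis using idem that(1,2) by metis
    qed
  qed
qed

context
  fixes T
  assumes T: "transversal T"
begin

lemma T_box: "T \<subseteq> box"
  and T_cover: "a \<in> box \<Longrightarrow> \<exists>t \<in> T. \<exists>g \<in> carrier G. mon g t = a"
  and T_unique: "t \<in> T \<Longrightarrow> t' \<in> T \<Longrightarrow> g \<in> carrier G \<Longrightarrow> mon g t = t' \<Longrightarrow> t = t'"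
  using T unfolding transversal_def by blast+

lemma monomial_decomposition:
  assumes "supp k \<subseteq> \<Gamma>"
  obtains g t b where "g \<in> carrier G" "t \<in> T" "k = mon g (mscale q b + t)"
proof -
  obtain b a where ba: "k = mscale q b + a" "a \<in> box" using box_division[OF assms] .
  obtain t g where tg: "t \<in> T" "g \<in> carrier G" "mon g t = a" using T_cover[OF ba(2)] by blast
  have "k = mon g (mscale q (mon (inv g) b) + t)"
    using tg ba by (simp add: mon_add flip: mon_mscale)
  with tg that show thesis by blast
qed

lemma coef_from_component:
  assumes "f \<in> invs" "g \<in> carrier G"
  shows "coef f (mon g (mscale q b + t)) = wt g (mscale q b + t) * coef (component t f) b ^ q"
  using assms by (simp add: coef_invs coef_component)

text \<open>
  By invariance the coefficients of \<open>f\<close> at one orbit of residues modulo \<open>q\<close> are determined by those at its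
  representative.
\<close>

lemma components_inj:
  assumes f: "f \<in> invs" "f' \<in> invs" and eq: "\<And>t. t \<in> T \<Longrightarrow> component t f = component t f'"
  shows "f = f'"
proof (rule poly_mapping_eqI)
  fix k
  show "coef f k = coef f' k"
  proof (cases "supp k \<subseteq> \<Gamma>")
    case True
    then obtain g t b where "g \<in> carrier G" "t \<in> T" "k = mon g (mscale q b + t)"
      using monomial_decomposition by blast
    then show ?thesis using f eq by (simp add: coef_from_component)
  next
    case False
    then have "k \<notin> supp f" "k \<notin> supp f'"
      using f semi_polys_in unfolding polys_in_def by blast+
    then show ?thesis by (simp add: in_keys_iff)
  qed
qed

text \<open>
  The degree shift: a term of degree \<open>d\<close> in the component at \<open>t\<close> comes from a term of degree
  \<open>q * d + mdeg t\<close>, and the group preserves degrees.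
\<close>

lemma homogeneous_iff_components:
  assumes f: "f \<in> invs"
  shows "homogeneous n f \<longleftrightarrow> (\<forall>t \<in> T. \<forall>b \<in> supp (component t f). q * mdeg b + mdeg t = n)"
proof
  assume hom: "homogeneous n f"
  show "\<forall>t \<in> T. \<forall>b \<in> supp (component t f). q * mdeg b + mdeg t = n"
  proof (intro ballI)
    fix t b assume "b \<in> supp (component t f)"
    then have "mscale q b + t \<in> supp f"
      by (auto simp: in_keys_iff coef_component)
    then have "mdeg (mscale q b + t) = n" using hom by (simp add: homogeneous_iff)
    then show "q * mdeg b + mdeg t = n" by (simp add: mdeg_add mdeg_scaled)
  qed
next
  assume *: "\<forall>t \<in> T. \<forall>b \<in> supp (component t f). q * mdeg b + mdeg t = n"
  show "homogeneous n f"
    unfolding homogeneous_iff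
  proof
    fix k assume k: "k \<in> supp f"
    then have "supp k \<subseteq> \<Gamma>" using f by (auto simp: semi_def polys_in_def)
    then obtain g t b where gtb: "g \<in> carrier G" "t \<in> T" "k = mon g (mscale q b + t)"
      using monomial_decomposition by blast
    then have "coef (component t f) b \<noteq> 0"
      using k f q_pos by (auto simp: in_keys_iff coef_from_component)
    then have "q * mdeg b + mdeg t = n" using * gtb(2) by (simp add: in_keys_iff)
    then show "mdeg k = n" using gtb by (simp add: mdeg_mon mdeg_add mdeg_scaled)
  qed
qed

text \<open>
  Given the components at the representatives, spread the polynomial \<open>mterm t 1 * F t ^ q\<close> over the orbit
  of \<open>t\<close> by choosing for each \<open>a\<close> in the orbit an element that carries \<open>t\<close> to \<open>a\<close>. The semi-invariance of
  \<open>F t\<close> says exactly that the stabilizer of \<open>t\<close> fixes this polynomial, so the result does not depend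
  on the choice and is invariant.
\<close>

lemma components_surj:
  assumes F: "\<And>t. t \<in> T \<Longrightarrow> F t \<in> semi (stab_pairs t)"
  obtains f where "f \<in> invs" "\<And>t. t \<in> T \<Longrightarrow> component t f = F t"
proof -
  define E where "E t = mterm t 1 * F t ^ q" for t
  have stab: "act s (E t) = E t" if "t \<in> T" "s \<in> carrier G" "mon s t = t" for s t
  proof -
    have "Const (froot (wt s t)) * act s (F t) = F t"
      using F[OF that(1)] that(2,3) by (auto simp: semi_def stab_pairs_def)
    then have "F t ^ q = Const (wt s t) * act s (F t) ^ q"
      by (metis Const_power froot_power power_mult_distrib)
    moreover have "act s (E t) = mterm t (wt s t) * act s (F t) ^ q"
      using that by (simp add: E_def act_times act_mterm act_power)
    moreover have "mterm t (wt s t) = mterm t 1 * Const (wt s t)"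
      by (simp add: Const_def mult_single)
    ultimately show ?thesis by (simp add: E_def mult.assoc)
  qed
  \<comment> \<open>Elements that carry \<open>t\<close> to the same monomial differ by an element of the stabilizer.\<close>
  have coset: "act g (E t) = act g' (E t)"
    if "t \<in> T" "g \<in> carrier G" "g' \<in> carrier G" "mon g t = mon g' t" for g g' t
  proof -
    have "mon (inv g' \<otimes> g) t = t" using that by (simp add: mon_mult)
    then have "act (inv g' \<otimes> g) (E t) = E t" using stab that by simp
    then have "act (g' \<otimes> (inv g' \<otimes> g)) (E t) = act g' (E t)"
      using that by (simp add: act_mult)
    then show ?thesis using that by (simp flip: m_assoc)
  qed
  have "\<exists>t g. t \<in> T \<and> g \<in> carrier G \<and> mon g t = a" if "a \<in> box" for a
    using T_cover[OF that] by blast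
  then obtain \<tau> \<gamma> where \<tau>\<gamma>: "\<And>a. a \<in> box \<Longrightarrow> \<tau> a \<in> T \<and> \<gamma> a \<in> carrier G \<and> mon (\<gamma> a) (\<tau> a) = a"
    by metis
  have \<tau>: "\<tau> a \<in> T" and \<gamma>: "\<gamma> a \<in> carrier G" and \<gamma>\<tau>: "mon (\<gamma> a) (\<tau> a) = a" if "a \<in> box" for a
    using \<tau>\<gamma>[OF that] by blast+
  define f where "f = (\<Sum>a \<in> box. act (\<gamma> a) (E (\<tau> a)))"
  have poly: "E t \<in> polys_in \<Gamma>" if "t \<in> T" for t
    unfolding E_def using F[OF that] T_box that
    by (intro polys_in_mult polys_in_mterm polys_in_power) (auto simp: box_def semi_def)
  have "f \<in> polys_in \<Gamma>"
    unfolding f_def by (intro polys_in_sum act_polys_in poly \<tau> \<gamma>)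
  moreover have "act h f = f" if h: "h \<in> carrier G" for h
  proof -
    have "act h (act (\<gamma> a) (E (\<tau> a))) = act (\<gamma> (mon h a)) (E (\<tau> (mon h a)))" if a: "a \<in> box" for a
    proof -
      have ha: "mon h a \<in> box" using h a by (rule mon_box)
      have "mon (h \<otimes> \<gamma> a) (\<tau> a) = mon h a" using h a \<gamma> \<gamma>\<tau> by (simp add: mon_mult)
      also have "\<dots> = mon (\<gamma> (mon h a)) (\<tau> (mon h a))" using \<gamma>\<tau> ha by simp
      finally have *: "mon (h \<otimes> \<gamma> a) (\<tau> a) = mon (\<gamma> (mon h a)) (\<tau> (mon h a))" .
      then have "mon (inv (\<gamma> (mon h a)) \<otimes> (h \<otimes> \<gamma> a)) (\<tau> a) = \<tau> (mon h a)"
        using h a ha \<gamma> by (simp add: mon_mult)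
      then have "\<tau> a = \<tau> (mon h a)"
        by (rule T_unique[rotated 3]) (use h a ha \<gamma> \<tau> in auto)
      then show ?thesis
        using * coset[of "\<tau> a" "h \<otimes> \<gamma> a" "\<gamma> (mon h a)"] h a ha \<gamma> \<tau> by (simp add: act_mult)
    qed
    then have "act h f = (\<Sum>a \<in> box. act (\<gamma> (mon h a)) (E (\<tau> (mon h a))))"
      by (simp add: f_def act_additive(4))
    also have "\<dots> = f"
      unfolding f_def
      by (rule sum.reindex_bij_witness[where i = "mon (inv h)" and j = "mon h"])
        (use h in \<open>auto simp: mon_box\<close>)
    finally show ?thesis .
  qed
  ultimately have "f \<in> invs" by (simp add: invs_iff)
  moreover have "component t f = F t" if t: "t \<in> T" for t
  proof -
    have tb: "t \<in> box" using t T_box by blast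
    have "component t (act (\<gamma> a) (E (\<tau> a))) = (if a = t then F t else 0)" if a: "a \<in> box" for a
    proof (cases "a = t")
      case True
      have "\<tau> t = t" using T_unique[OF \<tau>[OF tb] t \<gamma>[OF tb] \<gamma>\<tau>[OF tb]] .
      then have "act (\<gamma> a) (E (\<tau> a)) = E t"
        using stab[OF t \<gamma>[OF tb]] \<gamma>\<tau>[OF tb] True by simp
      moreover have "component t (E t) = F t"
        using component_power_times[OF tb, of "F t" "mterm t 1"] component_mterm[OF tb tb, of 1]
        by (simp add: E_def mult.commute)
      ultimately show ?thesis using True by simp
    next
      case False
      have "act (\<gamma> a) (E (\<tau> a)) = act (\<gamma> a) (F (\<tau> a)) ^ q * mterm a (wt (\<gamma> a) (\<tau> a))"
        using a \<gamma> \<gamma>\<tau> by (simp add: E_def act_times act_power act_mterm mult.commute)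
      then show ?thesis
        using False component_power_times[OF tb] component_mterm[OF tb a] by simp
    qed
    then have "component t f = (\<Sum>a \<in> box. if a = t then F t else 0)"
      unfolding f_def component_additive(4) by (rule sum.cong[OF refl])
    then show ?thesis using tb finite_box by simp
  qed
  ultimately show thesis by (rule that)
qed

end

end

end

section \<open>Graded structures carried by polynomials\<close>

lemma (in abelian_monoid) finsum_image_sum:
  fixes \<psi> :: "'p::comm_monoid_add \<Rightarrow> 'a"
  assumes "\<psi> 0 = \<zero>" and "0 \<in> Y" and "\<And>f g. f \<in> Y \<Longrightarrow> g \<in> Y \<Longrightarrow> f + g \<in> Y"
    and "\<psi> ` Y \<subseteq> carrier G" and "\<And>f g. f \<in> Y \<Longrightarrow> g \<in> Y \<Longrightarrow> \<psi> f \<oplus> \<psi> g = \<psi> (f + g)"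
    and "\<And>i. i \<in> A \<Longrightarrow> F i \<in> Y"
  shows "(\<Oplus>i \<in> A. \<psi> (F i)) = \<psi> (\<Sum>i \<in> A. F i)"
proof -
  have closed: "(\<Sum>i \<in> B. F i) \<in> Y" if "B \<subseteq> A" for B
    using that by (induction B rule: infinite_finite_induct) (auto intro: assms)
  have "(\<Oplus>i \<in> B. \<psi> (F i)) = \<psi> (\<Sum>i \<in> B. F i)" if "B \<subseteq> A" for B
    using that
  proof (induction B rule: infinite_finite_induct)
    case (insert b B)
    then have "F b \<in> Y" "(\<Sum>i \<in> B. F i) \<in> Y" "(\<lambda>i. \<psi> (F i)) \<in> B \<rightarrow> carrier G"
      using assms(4,6) closed by blast+
    then show ?case using insert assms(4,5) by (subst finsum_insert) auto
  qed (simp_all add: assms(1) finsum_infinite)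
  then show ?thesis by blast
qed

lemma bij_betw_image_of_subset:
  assumes "bij_betw \<phi> A B" "H \<subseteq> A" "K \<subseteq> B" "\<And>x. x \<in> A \<Longrightarrow> x \<in> H \<longleftrightarrow> \<phi> x \<in> K"
  shows "\<phi> ` H = K"
  using assms unfolding bij_betw_def by blast

text \<open>
  The structure \<open>R\<close> is the ring of invariant polynomials, transported along a map \<open>\<psi>\<close> that is injective on
  the polynomials in \<open>\<Gamma>\<close>. For the symmetric algebra \<open>\<psi>\<close> is the passage to cosets. The operations of \<open>R\<close>
  are described on the image of all polynomials in \<open>\<Gamma>\<close>, not only of the invariant ones, because the
  modules of semi-invariants use them too.
\<close>

locale invariant_model = perfect_monomial_action G \<Gamma> \<pi> c N
  for G :: "('g, 'b) monoid_scheme" (structure) and \<Gamma> :: "'v set" and \<pi> :: "'g \<Rightarrow> 'v \<Rightarrow> 'v"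
    and c :: "'g \<Rightarrow> 'v \<Rightarrow> 'k::field" and N :: nat +
  fixes \<psi> :: "('v, 'k) mpoly \<Rightarrow> 'a" and R :: "(nat, 'k, 'a) graded"
  assumes inj_\<psi>: "inj_on \<psi> (polys_in \<Gamma>)"
    and carrier_R: "carrier R = \<psi> ` invs"
    and zero_R: "\<zero>\<^bsub>R\<^esub> = \<psi> 0"
    and one_R: "\<one>\<^bsub>R\<^esub> = \<psi> 1"
    and add_R: "f \<in> polys_in \<Gamma> \<Longrightarrow> h \<in> polys_in \<Gamma> \<Longrightarrow> \<psi> f \<oplus>\<^bsub>R\<^esub> \<psi> h = \<psi> (f + h)"
    and mult_R: "f \<in> polys_in \<Gamma> \<Longrightarrow> h \<in> polys_in \<Gamma> \<Longrightarrow> \<psi> f \<otimes>\<^bsub>R\<^esub> \<psi> h = \<psi> (f * h)"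
    and smult_R: "f \<in> polys_in \<Gamma> \<Longrightarrow> z \<odot>\<^bsub>R\<^esub> \<psi> f = \<psi> (Const z * f)"
    and hcomp_R: "hcomp R n = \<psi> ` {f \<in> invs. homogeneous n f}"
begin

lemma \<psi>_eq_iff: "f \<in> polys_in \<Gamma> \<Longrightarrow> h \<in> polys_in \<Gamma> \<Longrightarrow> \<psi> f = \<psi> h \<longleftrightarrow> f = h"
  using inj_\<psi> by (auto dest: inj_onD)

lemma \<psi>_mem_image_iff:
  "f \<in> polys_in \<Gamma> \<Longrightarrow> Y \<subseteq> polys_in \<Gamma> \<Longrightarrow> \<psi> f \<in> \<psi> ` Y \<longleftrightarrow> f \<in> Y"
  using inj_\<psi> by (auto dest: inj_onD)

text \<open>
  Shared description of \<open>R\<close> and of the modules of semi-invariants: the parameter \<open>d\<close> converts degrees of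
  monomials to the type of degrees of the structure, natural numbers for \<open>R\<close> and rational numbers for
  the modules.
\<close>

definition graded_model :: "('i, 'r, 'a) graded \<Rightarrow> ('g \<times> 'k) set \<Rightarrow> (nat \<Rightarrow> 'i) \<Rightarrow> bool" where
  "graded_model M Z d \<longleftrightarrow> Z \<subseteq> carrier G \<times> UNIV \<and>
     carrier M = \<psi> ` semi Z \<and> \<zero>\<^bsub>M\<^esub> = \<psi> 0 \<and> add M = add R \<and>
     (\<forall>i. hcomp M i = \<psi> ` {f \<in> semi Z. \<forall>m \<in> supp f. d (mdeg m) = i})"

context
  fixes M :: "('i, 'r, 'a) graded" and Z d
  assumes model: "graded_model M Z d"
begin

lemma model_carrier: "carrier M = \<psi> ` semi Z"
  and model_zero: "\<zero>\<^bsub>M\<^esub> = \<psi> 0"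
  and model_Z: "Z \<subseteq> carrier G \<times> UNIV"
  and model_hcomp: "hcomp M i = \<psi> ` {f \<in> semi Z. \<forall>m \<in> supp f. d (mdeg m) = i}"
  using model by (auto simp: graded_model_def)

lemma model_add: "f \<in> polys_in \<Gamma> \<Longrightarrow> h \<in> polys_in \<Gamma> \<Longrightarrow> \<psi> f \<oplus>\<^bsub>M\<^esub> \<psi> h = \<psi> (f + h)"
  using model by (simp add: graded_model_def add_R)

lemma model_abelian_group: "abelian_group M"
proof (rule abelian_groupI)
  fix x assume "x \<in> carrier M"
  then obtain f where f: "f \<in> semi Z" "x = \<psi> f" by (auto simp: model_carrier)
  then have "\<psi> (- f) \<in> carrier M" "\<psi> (- f) \<oplus>\<^bsub>M\<^esub> x = \<zero>\<^bsub>M\<^esub>"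
    by (auto simp: model_carrier semi_uminus model_add model_zero semi_polys_in[of _ Z] polys_in_uminus)
  then show "\<exists>y \<in> carrier M. y \<oplus>\<^bsub>M\<^esub> x = \<zero>\<^bsub>M\<^esub>" by blast
qed (auto simp: model_carrier model_zero model_add semi_add semi_polys_in[of _ Z] polys_in_add add_ac)

lemma model_finsum:
  assumes "\<And>i. i \<in> A \<Longrightarrow> F i \<in> semi Z"
  shows "(\<Oplus>\<^bsub>M\<^esub>i \<in> A. \<psi> (F i)) = \<psi> (\<Sum>i \<in> A. F i)"
proof -
  interpret M: abelian_group M by (rule model_abelian_group)
  show ?thesis
    by (rule M.finsum_image_sum[where Y = "semi Z"])
      (auto simp: model_zero model_carrier model_add semi_add semi_polys_in[of _ Z] assms)
qed

lemma model_hcomp_subgroup: "additive_subgroup (hcomp M i) M"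
proof (rule additive_subgroupI)
  interpret M: abelian_group M by (rule model_abelian_group)
  let ?H = "{f \<in> semi Z. \<forall>m \<in> supp f. d (mdeg m) = i}"
  show "subgroup (hcomp M i) (add_monoid M)"
  proof (rule M.add.subgroupI)
    show "hcomp M i \<subseteq> carrier M" by (auto simp: model_hcomp model_carrier)
    have "0 \<in> ?H" by simp
    then show "hcomp M i \<noteq> {}" unfolding model_hcomp by blast
    show "\<ominus>\<^bsub>M\<^esub> x \<in> hcomp M i" if "x \<in> hcomp M i" for x
    proof -
      obtain f where f: "f \<in> ?H" "x = \<psi> f" using \<open>x \<in> hcomp M i\<close> by (auto simp: model_hcomp)
      have mem: "- f \<in> ?H" using f(1) by (auto simp: semi_uminus in_keys_iff)
      have eq: "\<ominus>\<^bsub>M\<^esub> x = \<psi> (- f)"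
        using f by (intro M.minus_equality)
          (auto simp: model_carrier semi_uminus model_add model_zero semi_polys_in[of _ Z] polys_in_uminus)
      show ?thesis unfolding eq model_hcomp using mem by (rule imageI)
    qed
    show "x \<oplus>\<^bsub>M\<^esub> y \<in> hcomp M i" if xy: "x \<in> hcomp M i" "y \<in> hcomp M i" for x y
    proof -
      obtain f h where fh: "f \<in> ?H" "x = \<psi> f" "h \<in> ?H" "y = \<psi> h"
        using xy by (auto simp: model_hcomp)
      have mem: "f + h \<in> ?H" using fh(1,3) keys_add[of f h] by (auto simp: semi_add)
      have eq: "x \<oplus>\<^bsub>M\<^esub> y = \<psi> (f + h)" using fh by (simp add: model_add semi_polys_in[of _ Z])
      show ?thesis unfolding eq model_hcomp using mem by (rule imageI)
    qed
  qed
qed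

text \<open>
  The homogeneous components of \<open>f\<close> are its projections onto the monomials of a fixed degree. Uniqueness
  is read off from coefficients: of the given components only the one in the degree of a monomial
  can contain that monomial.
\<close>

lemma model_direct_sum: "is_direct_sum_of_hcomps M"
  unfolding is_direct_sum_of_hcomps_def
proof (intro conjI allI ballI model_hcomp_subgroup)
  fix x assume "x \<in> carrier M"
  then obtain f where f: "f \<in> semi Z" "x = \<psi> f" by (auto simp: model_carrier)
  define y where "y i = restrict_poly (\<lambda>m. d (mdeg m) = i) f" for i
  have y_semi: "y i \<in> semi Z" for i
    unfolding y_def by (rule semi_restrict_poly[OF model_Z _ f(1)]) (simp add: mdeg_mon)
  have coef_y: "coef (y i) m = (if d (mdeg m) = i then coef f m else 0)" for i m
    by (simp add: y_def coef_restrict_poly)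
  have nz: "\<psi> h = \<zero>\<^bsub>M\<^esub> \<longleftrightarrow> h = 0" if "h \<in> semi Z" for h
    using \<psi>_eq_iff[of h 0] that by (simp add: model_zero semi_polys_in[of _ Z])
  show "\<exists>!c. (\<forall>i. c i \<in> hcomp M i) \<and> finite {i. c i \<noteq> \<zero>\<^bsub>M\<^esub>} \<and>
      x = (\<Oplus>\<^bsub>M\<^esub>i \<in> {i. c i \<noteq> \<zero>\<^bsub>M\<^esub>}. c i)"
  proof (rule ex1I[of _ "\<lambda>i. \<psi> (y i)"], intro conjI allI)
    have "i \<in> (\<lambda>m. d (mdeg m)) ` supp f" if nz: "y i \<noteq> 0" for i
    proof -
      obtain m where "coef (y i) m \<noteq> 0" using nz by (metis lookup_zero poly_mapping_eqI)
      then show ?thesis by (auto simp: coef_y in_keys_iff split: if_splits)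
    qed
    then have sub: "{i. y i \<noteq> 0} \<subseteq> (\<lambda>m. d (mdeg m)) ` supp f" by blast
    have set_eq: "{i. \<psi> (y i) \<noteq> \<zero>\<^bsub>M\<^esub>} = {i. y i \<noteq> 0}" using nz y_semi by simp
    show fin: "finite {i. \<psi> (y i) \<noteq> \<zero>\<^bsub>M\<^esub>}"
      unfolding set_eq using sub by (rule finite_subset) simp
    show "\<psi> (y i) \<in> hcomp M i" for i
      unfolding model_hcomp
      by (rule imageI) (use y_semi in \<open>auto simp: coef_y in_keys_iff split: if_splits\<close>)
    have "f = (\<Sum>i | y i \<noteq> 0. y i)"
    proof (rule poly_mapping_eqI)
      fix m
      have "(\<Sum>i | y i \<noteq> 0. coef (y i) m) = (\<Sum>i | y i \<noteq> 0. if i = d (mdeg m) then coef f m else 0)"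
        by (rule sum.cong) (auto simp: coef_y)
      also have "\<dots> = coef f m"
        using fin coef_y[of "d (mdeg m)" m] unfolding set_eq by (auto simp: sum.delta)
      finally show "coef f m = coef (\<Sum>i | y i \<noteq> 0. y i) m" by (simp add: lookup_sum)
    qed
    then show "x = (\<Oplus>\<^bsub>M\<^esub>i \<in> {i. \<psi> (y i) \<noteq> \<zero>\<^bsub>M\<^esub>}. \<psi> (y i))"
      unfolding set_eq f(2) by (subst model_finsum) (use y_semi in auto)
  next
    fix c' assume c': "(\<forall>i. c' i \<in> hcomp M i) \<and> finite {i. c' i \<noteq> \<zero>\<^bsub>M\<^esub>} \<and>
      x = (\<Oplus>\<^bsub>M\<^esub>i \<in> {i. c' i \<noteq> \<zero>\<^bsub>M\<^esub>}. c' i)"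
    then have "\<forall>i. \<exists>h. c' i = \<psi> h \<and> h \<in> semi Z \<and> (\<forall>m \<in> supp h. d (mdeg m) = i)"
      by (auto simp: model_hcomp)
    then obtain w where w: "\<And>i. c' i = \<psi> (w i)" "\<And>i. w i \<in> semi Z"
        "\<And>i m. m \<in> supp (w i) \<Longrightarrow> d (mdeg m) = i"
      by metis
    have set_eq: "{i. c' i \<noteq> \<zero>\<^bsub>M\<^esub>} = {i. w i \<noteq> 0}" using nz w by simp
    have fin: "finite {i. w i \<noteq> 0}" using c' set_eq by simp
    have "\<psi> f = (\<Oplus>\<^bsub>M\<^esub>i \<in> {i. w i \<noteq> 0}. \<psi> (w i))" using c' f w(1) set_eq by simp
    also have "\<dots> = \<psi> (\<Sum>i | w i \<noteq> 0. w i)" by (rule model_finsum) (rule w(2))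
    finally have sum: "f = (\<Sum>i | w i \<noteq> 0. w i)"
      using f(1) w(2) by (subst (asm) \<psi>_eq_iff) (auto intro!: semi_polys_in[of _ Z] semi_sum)
    have "w i = y i" for i
    proof (rule poly_mapping_eqI)
      fix m
      have zero: "coef (w i) m = 0" if "i \<noteq> d (mdeg m)" for i
        using w(3)[of m i] that by (auto simp: in_keys_iff)
      have "coef f m = (\<Sum>i | w i \<noteq> 0. coef (w i) m)" by (subst sum) (simp add: lookup_sum)
      also have "\<dots> = (\<Sum>i | w i \<noteq> 0. if i = d (mdeg m) then coef (w i) m else 0)"
        by (rule sum.cong) (use zero in auto)
      also have "\<dots> = coef (w (d (mdeg m))) m" using fin by (auto simp: sum.delta)
      finally show "coef (w i) m = coef (y i) m" using zero by (simp add: coef_y)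
    qed
    then show "c' = (\<lambda>i. \<psi> (y i))" using w(1) by auto
  qed
qed

end

lemma R_model: "graded_model R (carrier G \<times> {1}) id"
  by (auto simp: graded_model_def carrier_R zero_R hcomp_R homogeneous_iff)

lemmas invs_polys_in = semi_polys_in[where Z = "carrier G \<times> {1}"]

lemma R_cring: "cring R"
proof (rule cringI)
  show "abelian_group R" by (rule model_abelian_group[OF R_model])
  show "comm_monoid R"
    by (rule comm_monoidI)
      (auto simp: carrier_R one_R mult_R invs_mult invs_polys_in polys_in_mult mult_ac)
qed (auto simp: carrier_R add_R mult_R invs_polys_in polys_in_mult polys_in_add semi_add
    invs_mult distrib_right)

lemma R_power: "f \<in> invs \<Longrightarrow> \<psi> f [^]\<^bsub>R\<^esub> (n :: nat) = \<psi> (f ^ n)"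
  by (induction n) (auto simp: one_R mult_R invs_polys_in polys_in_power mult.commute)

text \<open>
  The invariants are the semi-invariants for the trivial character, so the generators of the module found
  above, together with the polynomials \<open>esym\<close>, generate them as an algebra over the constants.
\<close>

theorem R_fg_positively_graded_algebra: "fg_positively_graded_algebra R"
  unfolding fg_positively_graded_algebra_def
proof (intro conjI allI ballI)
  interpret R: cring R by (rule R_cring)
  show "algebra (ring_of_type_algebra :: 'k ring) R"
  proof (rule algebraI[OF cring_from_type_algebra R_cring])
    fix a b :: 'k and x y assume "x \<in> carrier R" "y \<in> carrier R"
    then obtain f h where f: "f \<in> invs" "x = \<psi> f" and h: "h \<in> invs" "y = \<psi> h"
      unfolding carrier_R by blast
    note fh = f(2) h(2) f(1)[THEN invs_polys_in] h(1)[THEN invs_polys_in]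
    show "a \<odot>\<^bsub>R\<^esub> x \<in> carrier R"
      using f by (simp add: carrier_R smult_R invs_polys_in semi_Const_times)
    show "(a \<oplus>\<^bsub>ring_of_type_algebra\<^esub> b) \<odot>\<^bsub>R\<^esub> x = a \<odot>\<^bsub>R\<^esub> x \<oplus>\<^bsub>R\<^esub> b \<odot>\<^bsub>R\<^esub> x"
      "a \<odot>\<^bsub>R\<^esub> (x \<oplus>\<^bsub>R\<^esub> y) = a \<odot>\<^bsub>R\<^esub> x \<oplus>\<^bsub>R\<^esub> a \<odot>\<^bsub>R\<^esub> y"
      "(a \<otimes>\<^bsub>ring_of_type_algebra\<^esub> b) \<odot>\<^bsub>R\<^esub> x = a \<odot>\<^bsub>R\<^esub> (b \<odot>\<^bsub>R\<^esub> x)"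
      "\<one>\<^bsub>ring_of_type_algebra\<^esub> \<odot>\<^bsub>R\<^esub> x = x"
      "(a \<odot>\<^bsub>R\<^esub> x) \<otimes>\<^bsub>R\<^esub> y = a \<odot>\<^bsub>R\<^esub> (x \<otimes>\<^bsub>R\<^esub> y)"
      by (simp_all add: fh ring_of_type_algebra_def smult_R add_R mult_R polys_in_mult polys_in_add
          Const_add Const_mult distrib_left distrib_right mult.assoc)
  qed
  show "is_direct_sum_of_hcomps R" by (rule model_direct_sum[OF R_model])
  show "x \<otimes>\<^bsub>R\<^esub> y \<in> hcomp R (i + j)" if "x \<in> hcomp R i" "y \<in> hcomp R j" for i j x y
  proof -
    obtain f h where fh: "f \<in> invs" "homogeneous i f" "x = \<psi> f" "h \<in> invs" "homogeneous j h" "y = \<psi> h"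
      using \<open>x \<in> hcomp R i\<close> \<open>y \<in> hcomp R j\<close> by (auto simp: hcomp_R)
    then have "x \<otimes>\<^bsub>R\<^esub> y = \<psi> (f * h)" "f * h \<in> invs" "homogeneous (i + j) (f * h)"
      by (simp_all add: mult_R invs_polys_in invs_mult homogeneous_mult)
    then show ?thesis by (auto simp: hcomp_R)
  qed
  have smult_one: "z \<odot>\<^bsub>R\<^esub> \<one>\<^bsub>R\<^esub> = \<psi> (Const z)" for z by (simp add: one_R smult_R)
  have const: "f = Const (coef f 0)" if "homogeneous 0 f" for f :: "('v, 'k) mpoly"
  proof (rule poly_mapping_eqI)
    fix m
    show "coef f m = coef (Const (coef f 0)) m"
      using that by (cases "m = 0") (auto simp: homogeneous_iff Const_def lookup_single in_keys_iff)
  qed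
  show "bij_betw (\<lambda>z. z \<odot>\<^bsub>R\<^esub> \<one>\<^bsub>R\<^esub>) UNIV (hcomp R 0)"
    unfolding bij_betw_def smult_one
  proof
    show "inj (\<lambda>z. \<psi> (Const z))"
    proof (rule injI)
      fix y z assume "\<psi> (Const y) = \<psi> (Const z)"
      then have "coef (Const y :: ('v, 'k) mpoly) 0 = coef (Const z :: ('v, 'k) mpoly) 0"
        by (subst (asm) \<psi>_eq_iff) auto
      then show "y = z" by (simp add: Const_def)
    qed
    show "range (\<lambda>z. \<psi> (Const z)) = hcomp R 0"
    proof (intro equalityI subsetI)
      fix x assume "x \<in> hcomp R 0"
      then obtain f where "homogeneous 0 f" "x = \<psi> f" by (auto simp: hcomp_R)
      then show "x \<in> range (\<lambda>z. \<psi> (Const z))" using const[of f] by (metis rangeI)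
    qed (auto simp: hcomp_R)
  qed
  obtain B where B: "finite B" "B \<subseteq> invs" "invs \<subseteq> esym_span B"
    by (rule semi_finitely_generated[of "carrier G \<times> {1}"]) auto
  let ?S = "\<psi> ` (B \<union> esym ` {..card \<Gamma>})"
  let ?A = "generate_ring R (hcomp R 0 \<union> ?S)"
  show "\<exists>S. finite S \<and> S \<subseteq> carrier R \<and> carrier R = generate_ring R (hcomp R 0 \<union> S)"
  proof (intro exI[of _ ?S] conjI)
    show "finite ?S" using B(1) by simp
    show S: "?S \<subseteq> carrier R" using B(2) esym_invs by (auto simp: carrier_R)
    show "carrier R = ?A"
    proof
      show "?A \<subseteq> carrier R"
      proof (rule subsetI, rule R.generate_ring_in_carrier)
        show "hcomp R 0 \<union> ?S \<subseteq> carrier R" using S by (auto simp: hcomp_R carrier_R)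
      qed
      have incl: "\<psi> (Const z) \<in> ?A" "b \<in> B \<Longrightarrow> \<psi> b \<in> ?A" "m \<le> card \<Gamma> \<Longrightarrow> \<psi> (esym m) \<in> ?A" for z b m
        by (auto intro!: generate_ring.incl simp: hcomp_R)
      let ?Y = "{f \<in> invs. \<psi> f \<in> ?A}"
      have mult: "r * f \<in> ?Y" if "r \<in> invs" "\<psi> r \<in> ?A" "f \<in> ?Y" for r f
        using that generate_ring.eng_mult[of "\<psi> r" R _ "\<psi> f"]
        by (simp add: invs_mult mult_R invs_polys_in)
      have "f \<in> ?Y" if "f \<in> esym_span B" for f
        using that
      proof induction
        case (base b)
        then show ?case using B(2) incl(2) by blast
      next
        case zero
        show ?case using incl(1)[of 0] by simp
      next
        case (plus f h)
        then show ?case using generate_ring.eng_add[of "\<psi> f" R _ "\<psi> h"]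
          by (simp add: semi_add add_R invs_polys_in)
      next
        case (scalar f z)
        then show ?case by (intro mult[OF invs_Const incl(1)])
      next
        case (esym f m)
        then show ?case by (intro mult[OF esym_invs incl(3)])
      qed
      with B(3) have "invs \<subseteq> ?Y" by blast
      then show "carrier R \<subseteq> ?A" by (auto simp: carrier_R)
    qed
  qed
qed

text \<open>
  The modules that occur in the decompositions. The degrees are those of \<open>S\<close>, and non-integral
  degrees arise from the shifts only.
\<close>

definition semi_module :: "('g \<times> 'k) set \<Rightarrow> (rat, 'a, 'a) graded" where
  "semi_module Z = \<lparr>carrier = \<psi> ` semi Z, monoid.mult = undefined, one = undefined,
     ring.zero = \<psi> 0, add = add R, module.smult = monoid.mult R,
     hcomp = (\<lambda>i. \<psi> ` {f \<in> semi Z. \<forall>m \<in> supp f. of_nat (mdeg m) = i})\<rparr>"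

lemma semi_module_model: "Z \<subseteq> carrier G \<times> UNIV \<Longrightarrow> graded_model (semi_module Z) Z of_nat"
  by (simp add: graded_model_def semi_module_def)

lemma semi_module_simps [simp]:
  "carrier (semi_module Z) = \<psi> ` semi Z" "add (semi_module Z) = add R"
  "\<zero>\<^bsub>semi_module Z\<^esub> = \<psi> 0" "module.smult (semi_module Z) = monoid.mult R"
  by (simp_all add: semi_module_def)

text \<open>
  The polynomials \<open>esym\<close> are invariant, so generation over the algebra they generate implies generation
  over \<open>R\<close>.
\<close>

theorem semi_module_fg:
  assumes Z: "Z \<subseteq> carrier G \<times> UNIV"
  shows "fg_graded_module R (semi_module Z)"
  unfolding fg_graded_module_def
proof (intro conjI allI ballI)
  note model = semi_module_model[OF Z]
  note closed = invs_times_semi[OF Z] semi_polys_in semi_add polys_in_mult polys_in_add invs_mult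
  show "module R (semi_module Z)"
    by (rule moduleI[OF R_cring model_abelian_group[OF model]])
      (auto simp: carrier_R one_R add_R mult_R closed distrib_left distrib_right mult_ac)
  show "is_direct_sum_of_hcomps (semi_module Z)" by (rule model_direct_sum[OF model])
  show "r \<odot>\<^bsub>semi_module Z\<^esub> x \<in> hcomp (semi_module Z) (of_nat n + i)"
    if "r \<in> hcomp R n" "x \<in> hcomp (semi_module Z) i" for n i r x
  proof -
    obtain s where s: "s \<in> invs" "homogeneous n s" "r = \<psi> s"
      using \<open>r \<in> hcomp R n\<close> by (auto simp: hcomp_R)
    obtain f where f: "f \<in> semi Z" "\<And>m. m \<in> supp f \<Longrightarrow> of_nat (mdeg m) = i" "x = \<psi> f"
      using \<open>x \<in> hcomp (semi_module Z) i\<close> by (auto simp: model_hcomp[OF model])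
    have "of_nat (mdeg m) = of_nat n + i" if m: "m \<in> supp (s * f)" for m
    proof -
      obtain a b where "a \<in> supp s" "b \<in> supp f" "m = a + b" using m keys_mult[of s f] by blast
      then show ?thesis using s(2) f(2)[of b] by (simp add: homogeneous_iff mdeg_add)
    qed
    moreover have "s * f \<in> semi Z" using s(1) f(1) by (rule invs_times_semi[OF Z])
    moreover have "r \<odot>\<^bsub>semi_module Z\<^esub> x = \<psi> (s * f)"
      using s f by (simp add: mult_R semi_polys_in)
    ultimately show ?thesis by (simp add: model_hcomp[OF model])
  qed
  obtain B where B: "finite B" "B \<subseteq> semi Z" "semi Z \<subseteq> esym_span B"
    by (rule semi_finitely_generated[OF Z])
  have inj: "inj_on \<psi> B" using inj_\<psi> B(2) semi_polys_in by (meson inj_on_subset subsetI subsetD)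
  define Y where "Y = {f. \<exists>u \<in> B \<rightarrow> invs. f = (\<Sum>b \<in> B. u b * b)}"
  have YI: "(\<Sum>b \<in> B. u b * b) \<in> Y" if "u \<in> B \<rightarrow> invs" for u
    using that unfolding Y_def by blast
  have Y_mult: "r * f \<in> Y" if "r \<in> invs" "f \<in> Y" for r f
  proof -
    obtain u where u: "u \<in> B \<rightarrow> invs" "f = (\<Sum>b \<in> B. u b * b)" using \<open>f \<in> Y\<close> by (auto simp: Y_def)
    have eq: "r * f = (\<Sum>b \<in> B. (r * u b) * b)" by (simp add: u(2) sum_distrib_left mult.assoc)
    show ?thesis unfolding eq by (rule YI) (use u(1) \<open>r \<in> invs\<close> in \<open>auto intro: invs_mult\<close>)
  qed
  have span: "f \<in> Y" if "f \<in> esym_span B" for f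
    using that
  proof induction
    case (base b)
    then have "(\<Sum>b' \<in> B. (if b' = b then 1 else 0) * b') = b"
      using B(1) by (simp add: if_distrib[of "\<lambda>x. x * _"] sum.delta cong: if_cong)
    then show ?case using YI[of "\<lambda>b'. if b' = b then 1 else 0"] by simp
  next
    case zero
    show ?case using YI[of "\<lambda>_. 0"] by simp
  next
    case (plus f g)
    then obtain u v where u: "u \<in> B \<rightarrow> invs" "f = (\<Sum>b \<in> B. u b * b)"
        and v: "v \<in> B \<rightarrow> invs" "g = (\<Sum>b \<in> B. v b * b)"
      by (auto simp: Y_def)
    have eq: "f + g = (\<Sum>b \<in> B. (u b + v b) * b)" by (simp add: u(2) v(2) sum.distrib distrib_right)
    show ?case unfolding eq by (rule YI) (use u(1) v(1) in \<open>auto intro: semi_add\<close>)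
  qed (auto intro: Y_mult esym_invs)
  show "\<exists>S. finite S \<and> S \<subseteq> carrier (semi_module Z) \<and>
      (\<forall>x \<in> carrier (semi_module Z). \<exists>u \<in> S \<rightarrow> carrier R.
        x = (\<Oplus>\<^bsub>semi_module Z\<^esub>y \<in> S. u y \<odot>\<^bsub>semi_module Z\<^esub> y))"
  proof (intro exI[of _ "\<psi> ` B"] conjI ballI)
    fix x assume "x \<in> carrier (semi_module Z)"
    then obtain f where f: "f \<in> semi Z" "x = \<psi> f" by auto
    obtain u where u: "u \<in> B \<rightarrow> invs" "f = (\<Sum>b \<in> B. u b * b)" using span B(3) f(1) by (auto simp: Y_def)
    let ?inv = "inv_into B \<psi>"
    interpret M: abelian_group "semi_module Z" by (rule model_abelian_group[OF model])
    have inB: "?inv y \<in> B" "\<psi> (?inv y) = y" if "y \<in> \<psi> ` B" for y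
      using that by (auto simp: inv_into_into f_inv_into_f)
    have uinv: "u (?inv y) \<in> invs" "?inv y \<in> semi Z" if "y \<in> \<psi> ` B" for y
      using inB(1)[OF that] u(1) B(2) by auto
    have "(\<Oplus>\<^bsub>semi_module Z\<^esub>y \<in> \<psi> ` B. \<psi> (u (?inv y)) \<odot>\<^bsub>semi_module Z\<^esub> y)
        = (\<Oplus>\<^bsub>semi_module Z\<^esub>y \<in> \<psi> ` B. \<psi> (u (?inv y) * ?inv y))"
    proof (rule M.finsum_cong')
      fix y assume y: "y \<in> \<psi> ` B"
      have "\<psi> (u (?inv y)) \<otimes>\<^bsub>R\<^esub> \<psi> (?inv y) = \<psi> (u (?inv y) * ?inv y)"
        by (rule mult_R) (use uinv[OF y] semi_polys_in in blast)+
      then show "\<psi> (u (?inv y)) \<odot>\<^bsub>semi_module Z\<^esub> y = \<psi> (u (?inv y) * ?inv y)"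
        using inB(2)[OF y] by simp
    qed (use uinv invs_times_semi[OF Z] in auto)
    also have "\<dots> = \<psi> (\<Sum>y \<in> \<psi> ` B. u (?inv y) * ?inv y)"
      by (rule model_finsum[OF model]) (use uinv invs_times_semi[OF Z] in blast)
    also have "(\<Sum>y \<in> \<psi> ` B. u (?inv y) * ?inv y) = f"
      by (simp add: sum.reindex[OF inj] u(2) inv_into_f_f[OF inj])
    finally have "x = (\<Oplus>\<^bsub>semi_module Z\<^esub>y \<in> \<psi> ` B. \<psi> (u (?inv y)) \<odot>\<^bsub>semi_module Z\<^esub> y)"
      by (simp add: f(2))
    moreover have "(\<lambda>y. \<psi> (u (?inv y))) \<in> \<psi> ` B \<rightarrow> carrier R"
      using uinv(1) by (auto simp: carrier_R)
    ultimately show "\<exists>u \<in> \<psi> ` B \<rightarrow> carrier R.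
        x = (\<Oplus>\<^bsub>semi_module Z\<^esub>y \<in> \<psi> ` B. u y \<odot>\<^bsub>semi_module Z\<^esub> y)"
      by (rule rev_bexI[rotated])
  next
    show "finite (\<psi> ` B)" using B(1) by simp
    show "\<psi> ` B \<subseteq> carrier (semi_module Z)" using B(2) by auto
  qed
qed

end

section \<open>The decomposition of the Frobenius modules\<close>

lemma direct_sum_cong:
  fixes K L :: "nat \<Rightarrow> (rat, 'r, 'm) graded"
  assumes "\<And>j. j < n \<Longrightarrow> K j = L j"
  shows "direct_sum n K = direct_sum n L"
proof -
  have "(\<Pi>\<^sub>E j \<in> {..<n}. carrier (K j)) = (\<Pi>\<^sub>E j \<in> {..<n}. carrier (L j))"
    "(\<lambda>i. \<Pi>\<^sub>E j \<in> {..<n}. hcomp (K j) i) = (\<lambda>i. \<Pi>\<^sub>E j \<in> {..<n}. hcomp (L j) i)"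
    "(\<lambda>j \<in> {..<n}. \<zero>\<^bsub>K j\<^esub>) = (\<lambda>j \<in> {..<n}. \<zero>\<^bsub>L j\<^esub>)"
    "(\<lambda>x y. \<lambda>j \<in> {..<n}. x j \<oplus>\<^bsub>K j\<^esub> y j) = (\<lambda>x y. \<lambda>j \<in> {..<n}. x j \<oplus>\<^bsub>L j\<^esub> y j)"
    "(\<lambda>r x. \<lambda>j \<in> {..<n}. r \<odot>\<^bsub>K j\<^esub> x j) = (\<lambda>r x. \<lambda>j \<in> {..<n}. r \<odot>\<^bsub>L j\<^esub> x j)"
    by (intro ext PiE_cong restrict_ext; simp add: assms)+
  then show ?thesis by (simp add: direct_sum_def)
qed

context invariant_model
begin

lemma frobenius_model:
  "carrier (frobenius_module e R) = \<psi> ` invs"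
  "f \<in> polys_in \<Gamma> \<Longrightarrow> h \<in> polys_in \<Gamma> \<Longrightarrow> \<psi> f \<oplus>\<^bsub>frobenius_module e R\<^esub> \<psi> h = \<psi> (f + h)"
  "r \<in> invs \<Longrightarrow> f \<in> invs \<Longrightarrow> \<psi> r \<odot>\<^bsub>frobenius_module e R\<^esub> \<psi> f = \<psi> (r ^ q e * f)"
  by (simp_all add: frobenius_module_def carrier_R add_R R_power mult_R invs_polys_in
      polys_in_power q_def)

lemma frobenius_hcomp:
  assumes "f \<in> invs"
  shows "\<psi> f \<in> hcomp (frobenius_module e R) i \<longleftrightarrow>
    f = 0 \<or> (\<exists>n. i = of_nat n / of_nat (q e) \<and> homogeneous n f)"
proof -
  have "\<psi> f = \<psi> 0 \<longleftrightarrow> f = 0" using assms by (simp add: \<psi>_eq_iff invs_polys_in)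
  moreover have "\<psi> f \<in> hcomp R n \<longleftrightarrow> homogeneous n f" for n
    unfolding hcomp_R using assms
    by (subst \<psi>_mem_image_iff) (auto simp: invs_polys_in)
  ultimately show ?thesis
    by (simp add: frobenius_module_def zero_R q_def)
qed

text \<open>
  The isomorphism takes an invariant to the family of its components at a transversal.
\<close>

theorem frobenius_module_iso:
  obtains n t where "graded_iso R (frobenius_module e R)
      (direct_sum n (\<lambda>j. shift (- of_nat (mdeg (t j)) / of_nat (q e)) (semi_module (stab_pairs e (t j)))))"
proof -
  obtain T where T: "transversal e T" using transversal_exists by blast
  have "finite T" using T_box[OF T] finite_box by (rule finite_subset)
  then obtain t where t: "bij_betw t {..<card T} T"
    using ex_bij_betw_nat_finite[of T] by (auto simp: atLeast0LessThan)
  define n where "n = card T"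
  have t_T: "t j \<in> T" if "j < n" for j using t that by (auto simp: bij_betw_def n_def)
  define \<phi>0 where "\<phi>0 f = (\<lambda>j \<in> {..<n}. \<psi> (component e (t j) f))" for f
  define \<phi> where "\<phi> x = \<phi>0 (inv_into (polys_in \<Gamma>) \<psi> x)" for x
  have \<phi>: "\<phi> (\<psi> f) = \<phi>0 f" if "f \<in> polys_in \<Gamma>" for f
    using that inj_\<psi> by (simp add: \<phi>_def)
  \<comment> \<open>In \<open>S\<^bsup>1/q\<^esup>\<close> a term of degree \<open>i\<close> at the basis element of degree \<open>mdeg (t j) / q\<close> has a
    coefficient of degree \<open>i - mdeg (t j) / q\<close>; the shift is negative because the shift by \<open>d\<close> puts
    degree \<open>d + i\<close> in degree \<open>i\<close>.\<close>
  define d where "d j = - of_nat (mdeg (t j)) / (of_nat (q e) :: rat)" for j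
  let ?M = "\<lambda>j. shift (d j) (semi_module (stab_pairs e (t j)))"
  let ?D = "direct_sum n ?M"
  note comp_semi = component_semi[of _ e]
  have comp_poly: "component e a f \<in> polys_in \<Gamma>" if "f \<in> invs" for a f
    using comp_semi[OF that] by (rule semi_polys_in)
  have carrier_M: "carrier (?M j) = \<psi> ` semi (stab_pairs e (t j))" for j
    by (simp add: shift_def)
  have carrier_D: "carrier ?D = (\<Pi>\<^sub>E j \<in> {..<n}. \<psi> ` semi (stab_pairs e (t j)))"
    by (simp add: direct_sum_def carrier_M)
  have comp_eq: "component e (t j) f = component e (t j) f'"
    if "\<phi>0 f = \<phi>0 f'" "f \<in> invs" "f' \<in> invs" "j < n" for f f' j
  proof -
    have "\<psi> (component e (t j) f) = \<psi> (component e (t j) f')"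
      using fun_cong[OF that(1), of j] that(4) by (simp add: \<phi>0_def)
    then show ?thesis using that by (simp add: \<psi>_eq_iff comp_poly)
  qed
  have T_range: "\<exists>j < n. t j = s" if "s \<in> T" for s
    using t that unfolding bij_betw_def n_def by (metis imageE lessThan_iff)
  have bij: "bij_betw \<phi> (carrier (frobenius_module e R)) (carrier ?D)"
    unfolding bij_betw_def frobenius_model(1)
  proof
    show "inj_on \<phi> (\<psi> ` invs)"
    proof (rule inj_onI)
      fix x y assume "x \<in> \<psi> ` invs" "y \<in> \<psi> ` invs" and eq: "\<phi> x = \<phi> y"
      then obtain f h where fh: "f \<in> invs" "x = \<psi> f" "h \<in> invs" "y = \<psi> h" by blast
      then have "\<phi>0 f = \<phi>0 h" using eq by (simp add: \<phi> invs_polys_in)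
      then have "component e s f = component e s h" if "s \<in> T" for s
        using comp_eq fh T_range[OF that] by blast
      then have "f = h" using components_inj[OF T fh(1,3)] by simp
      then show "x = y" using fh by simp
    qed
    show "\<phi> ` \<psi> ` invs = carrier ?D"
    proof (intro equalityI subsetI)
      fix x assume "x \<in> \<phi> ` \<psi> ` invs"
      then obtain f where f: "f \<in> invs" "x = \<phi>0 f" by (auto simp: \<phi> invs_polys_in)
      then show "x \<in> carrier ?D"
        by (auto simp: carrier_D \<phi>0_def comp_semi)
    next
      fix x assume x: "x \<in> carrier ?D"
      then have "\<forall>j \<in> {..<n}. \<exists>F. F \<in> semi (stab_pairs e (t j)) \<and> x j = \<psi> F"
        unfolding carrier_D by blast
      then obtain F where F: "\<And>j. j < n \<Longrightarrow> F j \<in> semi (stab_pairs e (t j)) \<and> x j = \<psi> (F j)"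
        by (metis lessThan_iff)
      define F' where "F' s = F (inv_into {..<n} t s)" for s
      have F'_t: "F' (t j) = F j" if "j < n" for j
        using that bij_betw_imp_inj_on[OF t] by (simp add: F'_def n_def)
      have F': "F' s \<in> semi (stab_pairs e s)" if "s \<in> T" for s
        using T_range[OF that] F F'_t by metis
      obtain f where f: "f \<in> invs" "\<And>s. s \<in> T \<Longrightarrow> component e s f = F' s"
        using components_surj[OF T, of F'] F' by blast
      have "x = \<phi>0 f"
      proof
        fix j show "x j = \<phi>0 f j"
        proof (cases "j < n")
          case True
          then show ?thesis using F f(2)[OF t_T[OF True]] F'_t by (simp add: \<phi>0_def)
        next
          case False
          then show ?thesis using x by (auto simp: carrier_D \<phi>0_def PiE_def extensional_def)
        qed
      qed
      then have "x = \<phi> (\<psi> f)" using f(1) by (simp add: \<phi> invs_polys_in)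
      then show "x \<in> \<phi> ` \<psi> ` invs" using f(1) by blast
    qed
  qed
  have add: "\<phi> (x \<oplus>\<^bsub>frobenius_module e R\<^esub> y) = \<phi> x \<oplus>\<^bsub>?D\<^esub> \<phi> y"
    if "x \<in> carrier (frobenius_module e R)" "y \<in> carrier (frobenius_module e R)" for x y
  proof -
    obtain f h where fh: "f \<in> invs" "x = \<psi> f" "h \<in> invs" "y = \<psi> h"
      using \<open>x \<in> _\<close> \<open>y \<in> _\<close> unfolding frobenius_model by blast
    have "\<phi>0 (f + h) = \<phi>0 f \<oplus>\<^bsub>?D\<^esub> \<phi>0 h"
      using fh(1,3)
      by (auto simp: \<phi>0_def direct_sum_def shift_def component_add add_R comp_poly)
    then show ?thesis using fh by (simp add: frobenius_model \<phi> invs_polys_in polys_in_add)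
  qed
  have smult: "\<phi> (r \<odot>\<^bsub>frobenius_module e R\<^esub> x) = r \<odot>\<^bsub>?D\<^esub> \<phi> x"
    if "r \<in> carrier R" "x \<in> carrier (frobenius_module e R)" for r x
  proof -
    obtain s f where fs: "s \<in> invs" "r = \<psi> s" "f \<in> invs" "x = \<psi> f"
      using \<open>r \<in> _\<close> \<open>x \<in> _\<close> unfolding frobenius_model carrier_R by blast
    have "component e (t j) (s ^ q e * f) = s * component e (t j) f" if "j < n" for j
      using T_box[OF T] t_T[OF that] by (intro component_power_times) auto
    then have "\<phi>0 (s ^ q e * f) = \<psi> s \<odot>\<^bsub>?D\<^esub> \<phi>0 f"
      using fs(1,3)
      by (auto simp: \<phi>0_def direct_sum_def shift_def mult_R comp_poly invs_polys_in)
    then show ?thesis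
      using fs by (simp add: frobenius_model \<phi> invs_polys_in polys_in_mult polys_in_power)
  qed
  have q: "(of_nat (q e) :: rat) > 0" using q_pos[of e] by simp
  have hcomp: "\<phi> ` hcomp (frobenius_module e R) i = hcomp ?D i" for i
  proof (rule bij_betw_image_of_subset[OF bij])
    show "hcomp (frobenius_module e R) i \<subseteq> carrier (frobenius_module e R)"
      by (auto simp: frobenius_module_def hcomp_R carrier_R zero_R)
    show "hcomp ?D i \<subseteq> carrier ?D"
      unfolding carrier_D by (auto simp: direct_sum_def shift_def semi_module_def intro!: PiE_mono)
    fix x assume "x \<in> carrier (frobenius_module e R)"
    then obtain f where f: "f \<in> invs" "x = \<psi> f" unfolding frobenius_model by blast
    have deg: "(of_nat (mdeg b) = d j + i) \<longleftrightarrow>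
        i = of_nat (q e * mdeg b + mdeg (t j)) / of_nat (q e)" for b j
    proof -
      have "of_nat (q e * mdeg b + mdeg (t j)) / of_nat (q e) = of_nat (mdeg b) - d j"
        using q by (simp add: d_def add_divide_distrib)
      then show ?thesis by auto
    qed
    have mem: "\<psi> (component e (t j) f) \<in> hcomp (?M j) i \<longleftrightarrow>
        (\<forall>b \<in> supp (component e (t j) f). i = of_nat (q e * mdeg b + mdeg (t j)) / of_nat (q e))" for j
    proof -
      have "\<psi> (component e (t j) f) \<in> hcomp (?M j) i \<longleftrightarrow> component e (t j) f \<in>
          {h \<in> semi (stab_pairs e (t j)). \<forall>m \<in> supp h. of_nat (mdeg m) = d j + i}"
        unfolding shift_def semi_module_def
        by (simp, subst \<psi>_mem_image_iff) (use f comp_poly semi_polys_in in auto)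
      then show ?thesis using comp_semi[OF f(1)] by (simp add: deg)
    qed
    have "\<phi>0 f \<in> hcomp ?D i \<longleftrightarrow> (\<forall>j < n. \<psi> (component e (t j) f) \<in> hcomp (?M j) i)"
      by (auto simp: direct_sum_def \<phi>0_def PiE_iff)
    also have "\<dots> \<longleftrightarrow> (\<forall>s \<in> T. \<forall>b \<in> supp (component e s f).
        i = of_nat (q e * mdeg b + mdeg s) / of_nat (q e))"
      unfolding mem using T_range t_T by metis
    also have "\<dots> \<longleftrightarrow> f = 0 \<or> (\<exists>n. i = of_nat n / of_nat (q e) \<and> homogeneous n f)"
      (is "?A \<longleftrightarrow> ?B")
    proof
      assume ?A
      show ?B
      proof (cases "f = 0")
        case False
        then obtain s where s: "s \<in> T" "component e s f \<noteq> 0"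
          using components_inj[OF T f(1), of 0] component_additive(1) by (metis semi_0)
        then obtain b where b: "b \<in> supp (component e s f)"
          by (metis lookup_zero in_keys_iff poly_mapping_eqI)
        define m where "m = q e * mdeg b + mdeg s"
        have i: "i = of_nat m / of_nat (q e)" using \<open>?A\<close> s(1) b by (simp add: m_def)
        have "q e * mdeg b' + mdeg s' = m" if "s' \<in> T" "b' \<in> supp (component e s' f)" for s' b'
        proof -
          have "of_nat m / of_nat (q e) = (of_nat (q e * mdeg b' + mdeg s') / of_nat (q e) :: rat)"
            using \<open>?A\<close> that i by blast
          then show ?thesis using q by (simp only: divide_cancel_right of_nat_eq_iff) auto
        qed
        then have "homogeneous m f" by (subst homogeneous_iff_components[OF T f(1)]) auto
        then show ?thesis using i by blast
      qed simp
    next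
      assume ?B
      then show ?A
      proof
        assume "f = 0"
        then show ?A by (simp add: component_additive)
      next
        assume "\<exists>n. i = of_nat n / of_nat (q e) \<and> homogeneous n f"
        then show ?A using homogeneous_iff_components[OF T f(1)] by metis
      qed
    qed
    also have "\<dots> \<longleftrightarrow> x \<in> hcomp (frobenius_module e R) i"
      by (simp only: f(2) frobenius_hcomp[OF f(1)])
    finally show "x \<in> hcomp (frobenius_module e R) i \<longleftrightarrow> \<phi> x \<in> hcomp ?D i"
      using f by (simp add: \<phi> invs_polys_in)
  qed
  have "graded_iso R (frobenius_module e R) ?D"
    unfolding graded_iso_def using bij add smult hcomp by blast
  then show thesis using that[of n t] by (simp add: d_def)
qed

lemma finite_roots_of_unity: "finite {z :: 'k. z ^ N = 1}"
proof -
  have "finite {z. poly (monom 1 N - 1 :: 'k poly) z = 0}"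
  proof (rule poly_roots_finite)
    have "coeff (monom 1 N - 1 :: 'k poly) N = 1" using N_pos by simp
    then show "monom 1 N - 1 \<noteq> (0 :: 'k poly)" by (metis coeff_0 zero_neq_one)
  qed
  then show ?thesis by (simp add: poly_monom)
qed

text \<open>
  The finite list consists of the modules for all sets of pairs of a group element and an \<open>N\<close>-th root of
  unity; \<open>stab_pairs_subset\<close> says that all summands are among them, for every \<open>e\<close>.
\<close>

theorem R_FFRT: "FFRT R"
  unfolding FFRT_def
proof
  show "fg_positively_graded_algebra R" by (rule R_fg_positively_graded_algebra)
  let ?P = "Pow (carrier G \<times> {z :: 'k. z ^ N = 1})"
  have "finite ?P" using finite_group finite_roots_of_unity by simp
  then obtain Z where Z: "bij_betw Z {..<card ?P} ?P"
    using ex_bij_betw_nat_finite[of ?P] by (auto simp: atLeast0LessThan)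
  define l where "l = card ?P"
  have Z_sub: "Z i \<subseteq> carrier G \<times> UNIV" if "i < l" for i
    using Z that unfolding bij_betw_def l_def by blast
  have Z_range: "\<exists>i < l. Z i = Y" if "Y \<in> ?P" for Y
  proof -
    have "Y \<in> Z ` {..<l}" using Z that by (simp add: bij_betw_def l_def)
    then show ?thesis by auto
  qed
  have "\<exists>n \<iota> d. (\<forall>j<n. \<iota> j < l) \<and>
      graded_iso R (frobenius_module e R) (direct_sum n (\<lambda>j. shift (d j) (semi_module (Z (\<iota> j)))))" for e
  proof -
    obtain n t where nt: "graded_iso R (frobenius_module e R)
        (direct_sum n (\<lambda>j. shift (- of_nat (mdeg (t j)) / of_nat (q e)) (semi_module (stab_pairs e (t j)))))"
      by (rule frobenius_module_iso[of e])
    have "\<forall>j. \<exists>i. j < n \<longrightarrow> i < l \<and> Z i = stab_pairs e (t j)"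
      using Z_range stab_pairs_subset by (meson PowI)
    then obtain \<iota> where \<iota>: "\<And>j. j < n \<Longrightarrow> \<iota> j < l \<and> Z (\<iota> j) = stab_pairs e (t j)" by metis
    let ?d = "\<lambda>j. - of_nat (mdeg (t j)) / of_nat (q e)"
    have eq: "direct_sum n (\<lambda>j. shift (?d j) (semi_module (stab_pairs e (t j))))
        = direct_sum n (\<lambda>j. shift (?d j) (semi_module (Z (\<iota> j))))"
      by (rule direct_sum_cong) (use \<iota> in auto)
    show ?thesis
      by (intro exI[of _ n] exI[of _ \<iota>] exI[of _ ?d] conjI nt[unfolded eq]) (use \<iota> in blast)
  qed
  then show "\<exists>l (M :: nat \<Rightarrow> (rat, 'a, 'a) graded). (\<forall>i<l. fg_graded_module R (M i)) \<and>
      (\<forall>e\<ge>1. \<exists>n \<iota> d. (\<forall>j<n. \<iota> j < l) \<and>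
        graded_iso R (frobenius_module e R) (direct_sum n (\<lambda>j. shift (d j) (M (\<iota> j)))))"
    using Z_sub semi_module_fg by (intro exI[of _ l] exI[of _ "\<lambda>i. semi_module (Z i)"]) blast
qed

end

section \<open>Monomial bases with roots of unity as coefficients\<close>

locale linear_rep = V: vector_space scale + group G
  for scale :: "'k::field \<Rightarrow> 'v::ab_group_add \<Rightarrow> 'v" and G :: "('g, 'b) monoid_scheme" (structure) +
  fixes \<rho> :: "'g \<Rightarrow> 'v \<Rightarrow> 'v"
  assumes action: "group_action G UNIV \<rho>"
    and linear: "g \<in> carrier G \<Longrightarrow> Vector_Spaces.linear scale scale (\<rho> g)"
begin

lemma \<rho>_mult: "g \<in> carrier G \<Longrightarrow> h \<in> carrier G \<Longrightarrow> \<rho> (g \<otimes> h) v = \<rho> g (\<rho> h v)"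
  using group_action.composition_rule[OF action] by simp

lemma \<rho>_one: "\<rho> \<one> v = v"
  using fun_cong[OF group_action.id_eq_one[OF action], of v] by simp

lemma \<rho>_inv:
  assumes "g \<in> carrier G" shows "\<rho> (inv g) (\<rho> g v) = v" "\<rho> g (\<rho> (inv g) v) = v"
  using assms \<rho>_mult[of "inv g" g v] \<rho>_mult[of g "inv g" v] by (simp_all add: \<rho>_one)

lemma \<rho>_scale: "g \<in> carrier G \<Longrightarrow> \<rho> g (scale a v) = scale a (\<rho> g v)"
proof -
  assume "g \<in> carrier G"
  then interpret Vector_Spaces.linear scale scale "\<rho> g" by (rule linear)
  show ?thesis by (rule scale)
qed

lemma \<rho>_add: "g \<in> carrier G \<Longrightarrow> \<rho> g (v + w) = \<rho> g v + \<rho> g w"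
proof -
  assume "g \<in> carrier G"
  then interpret Vector_Spaces.linear scale scale "\<rho> g" by (rule linear)
  show ?thesis by (rule add)
qed

lemma \<rho>_eq_0: "g \<in> carrier G \<Longrightarrow> \<rho> g v = 0 \<longleftrightarrow> v = 0"
proof -
  assume g: "g \<in> carrier G"
  have "\<rho> g 0 = 0" using \<rho>_scale[OF g, of 0 0] by simp
  then show ?thesis using \<rho>_inv(1)[OF g] by (metis)
qed

text \<open>
  Consequently a monomial action is given by a permutation of the basis together with a cocycle of
  scalars.
\<close>

lemma independent_lines:
  assumes "V.independent \<Gamma>" "x \<in> \<Gamma>" "y \<in> \<Gamma>" "scale a x = scale b y" "a \<noteq> 0"
  shows "x = y \<and> a = b"
proof -
  have x0: "x \<noteq> 0" using assms(1,2) V.dependent_zero by blast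
  have "x = y"
  proof (rule ccontr)
    assume "x \<noteq> y"
    have "x = scale (1 / a) (scale a x)" using assms(5) by simp
    also have "\<dots> = scale (b / a) y" by (simp add: assms(4))
    finally have "x \<in> V.span (\<Gamma> - {x})"
      using \<open>x \<noteq> y\<close> assms(3) by (metis DiffI V.span_base V.span_scale singletonD)
    then show False using assms(1,2) V.dependent_def by blast
  qed
  then have "scale (a - b) x = 0" using assms(4) by (simp add: V.scale_left_diff_distrib)
  with x0 \<open>x = y\<close> show ?thesis by simp
qed

text \<open>
  In each orbit of the lines spanned by basis vectors choose a representative \<open>r\<close>, and on each line of
  the orbit replace the basis vector by an image of \<open>r\<close> under the group. If \<open>g\<close> maps the new basis vector
  on one line to \<open>z\<close> times the one on another line, then transporting back to the line of \<open>r\<close> gives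
  an element \<open>h\<close> of the group with \<open>\<rho> h r = z r\<close>. The order of \<open>h\<close> divides that of the group, so \<open>z\<close> is
  a root of unity.
\<close>

lemma root_of_unity_basis:
  assumes fd: "finite_dimensional_vector_space scale B"
    and basis: "monomial_basis scale G \<rho> \<Gamma>"
    and fin: "finite (carrier G)"
  obtains \<Gamma>' where "finite \<Gamma>'" "V.independent \<Gamma>'" "V.span \<Gamma>' = UNIV"
    "\<forall>g \<in> carrier G. \<forall>x \<in> \<Gamma>'. \<exists>y \<in> \<Gamma>'. \<exists>z. z ^ Coset.order G = 1 \<and> \<rho> g x = scale z y"
proof -
  interpret fd: finite_dimensional_vector_space scale B by (rule fd)
  have indep: "V.independent \<Gamma>" and span: "V.span \<Gamma> = UNIV"
    and mono: "\<And>g x. g \<in> carrier G \<Longrightarrow> x \<in> \<Gamma> \<Longrightarrow> \<exists>y \<in> \<Gamma>. \<exists>a. \<rho> g x = scale a y"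
    using basis unfolding monomial_basis_def by auto
  have fin\<Gamma>: "finite \<Gamma>" using indep by (rule fd.finiteI_independent)
  have nz: "x \<noteq> 0" if "x \<in> \<Gamma>" for x using that indep V.dependent_zero by blast
  have mono': "\<exists>y \<in> \<Gamma>. \<exists>a. a \<noteq> 0 \<and> \<rho> g x = scale a y" if "g \<in> carrier G" "x \<in> \<Gamma>" for g x
  proof -
    obtain y a where ya: "y \<in> \<Gamma>" "\<rho> g x = scale a y" using mono \<open>g \<in> _\<close> \<open>x \<in> _\<close> by blast
    have "a \<noteq> 0" using ya(2) nz[OF \<open>x \<in> \<Gamma>\<close>] \<rho>_eq_0[OF \<open>g \<in> _\<close>, of x] by auto
    with ya show ?thesis by blast
  qed
  \<comment> \<open>Basis vectors are related if their lines lie in the same orbit.\<close>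
  define rel where "rel x y \<longleftrightarrow> (\<exists>g \<in> carrier G. \<exists>a. a \<noteq> 0 \<and> \<rho> g x = scale a y)" for x y
  have rel_refl: "rel x x" for x
    unfolding rel_def by (intro bexI[of _ \<one>] exI[of _ 1]) (simp_all add: \<rho>_one)
  have rel_trans: "rel x z" if "rel x y" "rel y z" for x y z
  proof -
    obtain g a h b where gh: "g \<in> carrier G" "a \<noteq> 0" "\<rho> g x = scale a y"
      "h \<in> carrier G" "b \<noteq> 0" "\<rho> h y = scale b z"
      using \<open>rel x y\<close> \<open>rel y z\<close> unfolding rel_def by blast
    then have "\<rho> (h \<otimes> g) x = scale (a * b) z" by (simp add: \<rho>_mult \<rho>_scale)
    moreover have "h \<otimes> g \<in> carrier G" "a * b \<noteq> 0" using gh by simp_all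
    ultimately show ?thesis unfolding rel_def by blast
  qed
  have rel_sym: "rel y x" if "rel x y" for x y
  proof -
    obtain g a where g: "g \<in> carrier G" "a \<noteq> 0" "\<rho> g x = scale a y"
      using \<open>rel x y\<close> unfolding rel_def by blast
    have "\<rho> (inv g) (scale a y) = x" using g(1) by (simp add: \<rho>_inv flip: g(3))
    then have "\<rho> (inv g) y = scale (1 / a) x" using g(1,2) by (metis V.scale_one V.scale_scale \<rho>_scale inv_closed nonzero_divide_eq_eq)
    moreover have "inv g \<in> carrier G" "1 / a \<noteq> 0" using g by simp_all
    ultimately show ?thesis unfolding rel_def by blast
  qed
  define r where "r x = (SOME y. y \<in> \<Gamma> \<and> rel y x)" for x
  have r: "r x \<in> \<Gamma>" "rel (r x) x" if "x \<in> \<Gamma>" for x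
    using someI[of "\<lambda>y. y \<in> \<Gamma> \<and> rel y x" x] that rel_refl by (auto simp: r_def)
  have r_eq: "r x = r y" if "rel x y" for x y
  proof -
    have "rel z x \<longleftrightarrow> rel z y" for z using that rel_sym rel_trans by blast
    then show ?thesis by (simp add: r_def)
  qed
  have "\<forall>x \<in> \<Gamma>. \<exists>g a. g \<in> carrier G \<and> a \<noteq> 0 \<and> \<rho> g (r x) = scale a x"
    using r(2) unfolding rel_def by blast
  then obtain k d where kd: "\<And>x. x \<in> \<Gamma> \<Longrightarrow> k x \<in> carrier G \<and> d x \<noteq> 0 \<and> \<rho> (k x) (r x) = scale (d x) x"
    by metis
  \<comment> \<open>By the choice of \<open>k\<close> and \<open>d\<close>, the vector \<open>scale (d x) x\<close> is the image of \<open>r x\<close> under \<open>k x\<close>.\<close>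
  define \<Gamma>' where "\<Gamma>' = (\<lambda>x. scale (d x) x) ` \<Gamma>"
  have "x \<in> V.span \<Gamma>'" if "x \<in> \<Gamma>" for x
  proof -
    have "x = scale (1 / d x) (scale (d x) x)" using kd[OF that] by simp
    moreover have "scale (d x) x \<in> \<Gamma>'" using that by (simp add: \<Gamma>'_def)
    ultimately show ?thesis by (metis V.span_base V.span_scale)
  qed
  then have "V.span \<Gamma> \<subseteq> V.span \<Gamma>'" by (intro V.span_minimal) auto
  then have span': "V.span \<Gamma>' = UNIV" using span by auto
  have fin': "finite \<Gamma>'" using fin\<Gamma> by (simp add: \<Gamma>'_def)
  have "card \<Gamma>' \<le> card \<Gamma>" using fin\<Gamma> by (simp add: \<Gamma>'_def card_image_le)
  also have "card \<Gamma> = V.dim UNIV" using indep span by (intro V.basis_card_eq_dim) auto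
  finally have indep': "V.independent \<Gamma>'"
    using fin' span' by (intro fd.card_le_dim_spanning[of _ UNIV]) auto
  have "\<exists>y \<in> \<Gamma>'. \<exists>z. z ^ Coset.order G = 1 \<and> \<rho> g x' = scale z y"
    if g: "g \<in> carrier G" and x': "x' \<in> \<Gamma>'" for g x'
  proof -
    obtain x where x: "x \<in> \<Gamma>" "x' = scale (d x) x" using x' by (auto simp: \<Gamma>'_def)
    obtain y a where ya: "y \<in> \<Gamma>" "a \<noteq> 0" "\<rho> g x = scale a y" using mono'[OF g x(1)] by blast
    then have "rel x y" using g unfolding rel_def by blast
    then have r: "r x = r y" by (rule r_eq)
    note kx = kd[OF x(1)] and ky = kd[OF ya(1)]
    define z where "z = d x * a / d y"
    have gx': "\<rho> g x' = scale z (scale (d y) y)"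
      using ya ky g by (simp add: x(2) z_def \<rho>_scale)
    define h where "h = inv (k y) \<otimes> (g \<otimes> k x)"
    have h: "h \<in> carrier G" using g kx ky by (simp add: h_def)
    have "\<rho> h (r y) = \<rho> (inv (k y)) (\<rho> g x')"
      using g kx ky r by (simp add: h_def \<rho>_mult x(2))
    also have "\<dots> = scale z (\<rho> (inv (k y)) (\<rho> (k y) (r y)))"
      using ky by (simp only: gx' \<rho>_scale inv_closed)
    also have "\<dots> = scale z (r y)" using conjunct1[OF ky] by (simp only: \<rho>_inv)
    finally have hr: "\<rho> h (r y) = scale z (r y)" .
    have "\<rho> (h [^] n) (r y) = scale (z ^ n) (r y)" for n :: nat
      by (induction n) (use h hr in \<open>simp_all add: \<rho>_one \<rho>_mult \<rho>_scale mult.commute\<close>)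
    from this[of "Coset.order G"] have "scale (z ^ Coset.order G - 1) (r y) = 0"
      using h by (simp add: pow_order_eq_1 \<rho>_one V.scale_left_diff_distrib)
    moreover have "r y \<noteq> 0" using nz \<open>\<And>x. x \<in> \<Gamma> \<Longrightarrow> r x \<in> \<Gamma>\<close>[OF ya(1)] by blast
    ultimately have "z ^ Coset.order G = 1" by simp
    moreover have "scale (d y) y \<in> \<Gamma>'" using ya(1) by (simp add: \<Gamma>'_def)
    ultimately show ?thesis using gx' by blast
  qed
  with fin' indep' span' show thesis using that by blast
qed

end

section \<open>The symmetric algebra as a polynomial ring\<close>

locale monomial_rep = linear_rep scale G \<rho>
  for scale :: "'k::field \<Rightarrow> 'v::ab_group_add \<Rightarrow> 'v" and G :: "('g, 'b) monoid_scheme" (structure)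
    and \<rho> :: "'g \<Rightarrow> 'v \<Rightarrow> 'v" +
  fixes \<Gamma> :: "'v set"
  assumes fin_G: "finite (carrier G)"
    and fin_basis: "finite \<Gamma>" and indep: "V.independent \<Gamma>" and span: "V.span \<Gamma> = UNIV"
    and monomial: "g \<in> carrier G \<Longrightarrow> x \<in> \<Gamma> \<Longrightarrow> \<exists>y \<in> \<Gamma>. \<exists>z. z ^ Coset.order G = 1 \<and> \<rho> g x = scale z y"
begin

text \<open>
  Off the basis the permutation is the identity and the factor is one, so that the identities for a
  product of group elements hold for all vectors.
\<close>

definition perm :: "'g \<Rightarrow> 'v \<Rightarrow> 'v" where
  "perm g x = (if x \<in> \<Gamma> then SOME y. y \<in> \<Gamma> \<and> (\<exists>z. z ^ Coset.order G = 1 \<and> \<rho> g x = scale z y) else x)"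

definition factor :: "'g \<Rightarrow> 'v \<Rightarrow> 'k" where
  "factor g x = (if x \<in> \<Gamma> then SOME z. z ^ Coset.order G = 1 \<and> \<rho> g x = scale z (perm g x) else 1)"

lemma perm_factor:
  assumes "g \<in> carrier G" "x \<in> \<Gamma>"
  shows "perm g x \<in> \<Gamma>" "factor g x ^ Coset.order G = 1" "\<rho> g x = scale (factor g x) (perm g x)"
proof -
  have "\<exists>y. y \<in> \<Gamma> \<and> (\<exists>z. z ^ Coset.order G = 1 \<and> \<rho> g x = scale z y)"
    using monomial[OF assms] by blast
  from someI_ex[OF this]
  have *: "perm g x \<in> \<Gamma> \<and> (\<exists>z. z ^ Coset.order G = 1 \<and> \<rho> g x = scale z (perm g x))"
    using assms(2) by (simp add: perm_def)
  then show "perm g x \<in> \<Gamma>" by simp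
  have "factor g x ^ Coset.order G = 1 \<and> \<rho> g x = scale (factor g x) (perm g x)"
    using someI_ex[OF conjunct2[OF *]] assms(2) by (simp add: factor_def)
  then show "factor g x ^ Coset.order G = 1" "\<rho> g x = scale (factor g x) (perm g x)" by simp_all
qed

lemma order_pos: "Coset.order G > 0"
  using fin_G order_gt_0_iff_finite by blast

lemma perm_factor_unique:
  assumes "g \<in> carrier G" "x \<in> \<Gamma>" "y \<in> \<Gamma>" "\<rho> g x = scale z y"
  shows "perm g x = y \<and> factor g x = z"
proof (rule independent_lines[OF indep])
  show "perm g x \<in> \<Gamma>" using perm_factor assms by blast
  show "scale (factor g x) (perm g x) = scale z y" using perm_factor(3) assms by simp
  show "factor g x \<noteq> 0" using perm_factor(2)[OF assms(1,2)] order_pos by (auto simp: zero_power)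
qed (rule assms(3))

lemma monomial_action: "monomial_action G \<Gamma> perm factor (Coset.order G)"
proof
  show "perm \<one> x = x" for x
    using perm_factor_unique[of \<one> x x 1] by (cases "x \<in> \<Gamma>") (auto simp: \<rho>_one perm_def)
  fix g h x assume gh: "g \<in> carrier G" "h \<in> carrier G"
  have *: "perm (g \<otimes> h) x = perm g (perm h x) \<and> factor (g \<otimes> h) x = factor g (perm h x) * factor h x"
    if x: "x \<in> \<Gamma>"
  proof (rule perm_factor_unique)
    have hx: "perm h x \<in> \<Gamma>" using perm_factor(1) gh x by blast
    show "perm g (perm h x) \<in> \<Gamma>" using perm_factor(1) gh hx by blast
    show "\<rho> (g \<otimes> h) x = scale (factor g (perm h x) * factor h x) (perm g (perm h x))"
      using gh by (simp add: \<rho>_mult perm_factor(3)[OF gh(2) x] \<rho>_scale perm_factor(3)[OF gh(1) hx] mult.commute)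
  qed (use gh x in auto)
  then show "perm (g \<otimes> h) x = perm g (perm h x)" by (cases "x \<in> \<Gamma>") (auto simp: perm_def)
  show "factor (g \<otimes> h) x = factor g (perm h x) * factor h x"
    using * by (cases "x \<in> \<Gamma>") (auto simp: perm_def factor_def)
next
  show "factor g x ^ Coset.order G = 1" if "g \<in> carrier G" for g x
    using perm_factor(2)[OF that, of x] by (cases "x \<in> \<Gamma>") (auto simp: factor_def)
qed (use fin_basis fin_G perm_factor order_pos in auto)

sublocale A: monomial_action G \<Gamma> perm factor "Coset.order G"
  by (rule monomial_action)

abbreviation I :: "('v, 'k) mpoly set" where
  "I \<equiv> linearity_ideal scale"

lemma mpoly_ring_simps:
  "carrier mpoly_ring = UNIV" "x \<oplus>\<^bsub>mpoly_ring\<^esub> y = x + y" "x \<otimes>\<^bsub>mpoly_ring\<^esub> y = x * y"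
  "\<zero>\<^bsub>mpoly_ring\<^esub> = 0" "\<one>\<^bsub>mpoly_ring\<^esub> = 1"
  by (simp_all add: ring_of_type_algebra_def)

lemma ideal_I: "ideal I mpoly_ring"
  unfolding linearity_ideal_def
  by (rule ring.genideal_ideal) (auto simp: mpoly_ring_simps)

lemma generators_in_I: "Var (v + w) - (Var v + Var w) \<in> I" "Var (scale a v) - Const a * Var v \<in> I"
proof -
  have "{Var (v + w) - (Var v + Var w) | v w. True} \<union> {Var (scale a v) - Const a * Var v | a v. True} \<subseteq> I"
    unfolding linearity_ideal_def
    by (rule ring.genideal_self) (auto simp: mpoly_ring_simps)
  then show "Var (v + w) - (Var v + Var w) \<in> I" "Var (scale a v) - Const a * Var v \<in> I" by blast+
qed

lemma I_add: "f \<in> I \<Longrightarrow> h \<in> I \<Longrightarrow> f + h \<in> I"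
  using additive_subgroup.a_closed[OF ideal.axioms(1)[OF ideal_I]] by (simp add: mpoly_ring_simps)

lemma I_0: "0 \<in> I"
  using additive_subgroup.zero_closed[OF ideal.axioms(1)[OF ideal_I]] by (simp add: mpoly_ring_simps)

lemma I_mult: "f \<in> I \<Longrightarrow> h * f \<in> I"
  using ideal.I_l_closed[OF ideal_I, of f h] by (simp add: mpoly_ring_simps)

lemma I_uminus: "f \<in> I \<Longrightarrow> - f \<in> I"
  using I_mult[of f "- 1"] by simp

text \<open>
  Minimality of the linearity ideal, used to show that a ring homomorphism kills it or preserves it
  by looking at the generators.
\<close>

lemma I_minimal:
  assumes J: "\<And>v w. Var (v + w) - (Var v + Var w) \<in> J" "\<And>a v. Var (scale a v) - Const a * Var v \<in> J"
    and "0 \<in> J" "\<And>f h. f \<in> J \<Longrightarrow> h \<in> J \<Longrightarrow> f + h \<in> J" "\<And>f h. f \<in> J \<Longrightarrow> h * f \<in> J"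
  shows "I \<subseteq> J"
  unfolding linearity_ideal_def
proof (rule ring.genideal_minimal)
  show R: "ring (mpoly_ring :: ('v, 'k) mpoly ring)" ..
  interpret ring "mpoly_ring :: ('v, 'k) mpoly ring" by (rule R)
  show "ideal J mpoly_ring"
  proof (rule idealI[OF R])
    show "subgroup J (add_monoid mpoly_ring)"
    proof (rule add.subgroupI)
      show "\<ominus>\<^bsub>mpoly_ring\<^esub> f \<in> J" if "f \<in> J" for f
      proof -
        have eq: "\<ominus>\<^bsub>mpoly_ring\<^esub> f = - 1 * f"
          by (rule minus_equality) (simp_all add: mpoly_ring_simps)
        show ?thesis unfolding eq by (rule assms(5)[OF that])
      qed
    qed (use assms in \<open>auto simp: mpoly_ring_simps\<close>)
  qed (use assms(5) in \<open>auto simp: mpoly_ring_simps mult.commute\<close>)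
qed (use J in auto)

text \<open>
  The polynomial in the basis that represents \<open>v\<close> in the symmetric algebra. Substituting these linear
  forms, the map \<open>retract\<close> rewrites a polynomial on all vectors as a polynomial in the basis.
\<close>

definition linear_form :: "'v \<Rightarrow> ('v, 'k) mpoly" where
  "linear_form v = (\<Sum>x \<in> \<Gamma>. Const (V.representation \<Gamma> v x) * Var x)"

definition retract :: "('v, 'k) mpoly \<Rightarrow> ('v, 'k) mpoly" where
  "retract = subst_vars linear_form"

lemma linear_form_basis:
  assumes "x \<in> \<Gamma>" shows "linear_form x = Var x"
proof -
  have "linear_form x = (\<Sum>y \<in> \<Gamma>. if y = x then Var y else 0)"
    unfolding linear_form_def V.representation_basis[OF indep assms]
    by (rule sum.cong) auto
  then show ?thesis using assms fin_basis by (simp add: sum.delta)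
qed

lemma linear_form_add: "linear_form (v + w) = linear_form v + linear_form w"
  by (simp add: linear_form_def V.representation_add indep span Const_add distrib_right sum.distrib)

lemma linear_form_scale: "linear_form (scale a v) = Const a * linear_form v"
  by (simp add: linear_form_def V.representation_scale indep span Const_mult sum_distrib_left mult.assoc)

lemma linear_form_poly: "linear_form v \<in> polys_in \<Gamma>"
  unfolding linear_form_def by (intro polys_in_sum polys_in_mult polys_in_Const polys_in_Var)

lemma homogeneous_linear_form: "homogeneous 1 (linear_form v)"
  unfolding linear_form_def by (intro homogeneous_sum homogeneous_Const_times homogeneous_Var)

lemma retract_simps:
  "retract (f + h) = retract f + retract h" "retract (f * h) = retract f * retract h"
  "retract (Const a) = Const a" "retract (Var v) = linear_form v"
  by (simp_all add: retract_def subst_vars_add subst_vars_mult)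

lemmas retract_additive = additive_map_simps[of retract, OF retract_simps(1)]

lemma retract_poly: "retract f \<in> polys_in \<Gamma>"
  by (induction f rule: mpoly_generated_induct)
    (simp_all add: retract_simps linear_form_poly polys_in_add polys_in_mult)

lemma retract_id: "f \<in> polys_in \<Gamma> \<Longrightarrow> retract f = f"
  by (rule ring_hom_eq_on_polys_in[where F = retract and H = "\<lambda>f. f"])
    (simp_all add: retract_simps linear_form_basis)

lemma retract_homogeneous:
  assumes "homogeneous n f" shows "homogeneous n (retract f)"
  unfolding retract_def subst_vars_def
proof (intro homogeneous_sum homogeneous_Const_times)
  fix m assume "m \<in> supp f"
  then have "n = (\<Sum>v \<in> supp m. coef m v * 1)" using assms by (simp add: homogeneous_def)
  then show "homogeneous n (\<Prod>v \<in> supp m. linear_form v ^ coef m v)"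
    by (simp only:) (intro homogeneous_prod homogeneous_power homogeneous_linear_form)
qed

text \<open>
  With \<open>minus_retract\<close> below, this shows that the linearity ideal is the kernel of \<open>retract\<close>.
\<close>

lemma retract_I: "f \<in> I \<Longrightarrow> retract f = 0"
proof -
  have "I \<subseteq> {f. retract f = 0}"
    by (rule I_minimal)
      (simp_all add: retract_simps retract_additive linear_form_add linear_form_scale)
  then show "f \<in> I \<Longrightarrow> retract f = 0" by blast
qed

lemma Var_linear_form: "Var v - linear_form v \<in> I"
proof -
  have sum: "Var (\<Sum>x \<in> A. scale (a x) x) - (\<Sum>x \<in> A. Const (a x) * Var x) \<in> I" for A a
  proof (induction A rule: infinite_finite_induct)
    case (insert x A)
    let ?S = "\<Sum>x \<in> A. scale (a x) x" and ?T = "\<Sum>x \<in> A. Const (a x) * Var x"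
    have "(Var (scale (a x) x + ?S) - (Var (scale (a x) x) + Var ?S))
        + (Var (scale (a x) x) - Const (a x) * Var x) + (Var ?S - ?T) \<in> I"
      by (intro I_add generators_in_I insert.IH)
    with insert show ?case by (simp add: algebra_simps)
  qed (use generators_in_I(2)[of 0 0] in simp_all)
  have "(\<Sum>x \<in> \<Gamma>. scale (V.representation \<Gamma> v x) x) = v"
    by (rule V.sum_representation_eq) (simp_all add: indep span fin_basis)
  then show ?thesis using sum[of "V.representation \<Gamma> v" \<Gamma>] by (simp add: linear_form_def)
qed

lemma minus_retract: "f - retract f \<in> I"
proof (induction f rule: mpoly_generated_induct)
  case (Var v)
  show ?case by (simp add: retract_simps Var_linear_form)
next
  case (plus f h)
  have "f + h - retract (f + h) = (f - retract f) + (h - retract h)" by (simp add: retract_simps)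
  then show ?case using plus I_add by metis
next
  case (times f h)
  have "f * h - retract (f * h) = f * (h - retract h) + retract h * (f - retract f)"
    by (simp add: retract_simps algebra_simps)
  then show ?case using times I_add I_mult by metis
qed (simp add: retract_simps I_0)

definition cls :: "('v, 'k) mpoly \<Rightarrow> ('v, 'k) mpoly set" where
  "cls f = I +>\<^bsub>mpoly_ring\<^esub> f"

lemma cls_image: "cls f = (\<lambda>i. i + f) ` I"
  by (auto simp: cls_def a_r_coset_def' mpoly_ring_simps)

lemma cls_eq_iff: "cls f = cls h \<longleftrightarrow> f - h \<in> I"
proof
  assume "cls f = cls h"
  moreover have "f \<in> cls f" using I_0 by (force simp: cls_image)
  ultimately show "f - h \<in> I" by (auto simp: cls_image)
next
  assume fh: "f - h \<in> I"
  have sub: "cls f \<subseteq> cls h" if "f - h \<in> I" for f h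
  proof
    fix y assume "y \<in> cls f"
    then obtain i where "i \<in> I" "y = i + f" by (auto simp: cls_image)
    then have "i + (f - h) \<in> I" "y = (i + (f - h)) + h" using I_add that by simp_all
    then show "y \<in> cls h" unfolding cls_image by blast
  qed
  have "h - f \<in> I" using I_uminus[OF fh] by simp
  then show "cls f = cls h" using sub fh by blast
qed

text \<open>
  Every coset contains a polynomial in the basis, and by \<open>inj_cls\<close> only one.
\<close>

lemma cls_retract: "cls (retract f) = cls f"
  using I_uminus[OF minus_retract, of f] by (simp add: cls_eq_iff)

lemma inj_cls: "inj_on cls (polys_in \<Gamma>)"
proof (rule inj_onI)
  fix f h assume "f \<in> polys_in \<Gamma>" "h \<in> polys_in \<Gamma>" "cls f = cls h"
  then show "f = h"
    using retract_I[of "f - h"] by (simp add: cls_eq_iff retract_additive retract_id)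
qed

definition subst_action :: "'g \<Rightarrow> ('v, 'k) mpoly \<Rightarrow> ('v, 'k) mpoly" where
  "subst_action g = subst_vars (\<lambda>v. Var (\<rho> g v))"

lemma subst_action_simps:
  "subst_action g (f + h) = subst_action g f + subst_action g h"
  "subst_action g (f * h) = subst_action g f * subst_action g h"
  "subst_action g (Const a) = Const a" "subst_action g (Var v) = Var (\<rho> g v)"
  by (simp_all add: subst_action_def subst_vars_add subst_vars_mult)

lemmas subst_action_additive = additive_map_simps[of "subst_action g" for g, OF subst_action_simps(1)]

lemma subst_action_inv:
  assumes "g \<in> carrier G"
  shows "subst_action g (subst_action (inv g) f) = f"
  by (induction f rule: mpoly_generated_induct) (simp_all add: subst_action_simps \<rho>_inv assms)

lemma subst_action_I: "g \<in> carrier G \<Longrightarrow> f \<in> I \<Longrightarrow> subst_action g f \<in> I"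
proof -
  assume g: "g \<in> carrier G"
  have "I \<subseteq> {f. subst_action g f \<in> I}"
    by (rule I_minimal)
      (simp_all add: subst_action_simps subst_action_additive \<rho>_add \<rho>_scale g generators_in_I I_0
        I_add I_mult)
  then show "f \<in> I \<Longrightarrow> subst_action g f \<in> I" by blast
qed

text \<open>
  The image of a coset is all of the coset of the image, since the substitution for \<open>g\<close> maps the
  linearity ideal onto itself, with the substitution for the inverse of \<open>g\<close> as its inverse.
\<close>

lemma sym_action_cls:
  assumes g: "g \<in> carrier G"
  shows "sym_action \<rho> g (cls f) = cls (subst_action g f)"
proof -
  have "subst_action g ` cls f = cls (subst_action g f)"
  proof (intro equalityI subsetI)
    fix y assume "y \<in> subst_action g ` cls f"
    then obtain i where "i \<in> I" "y = subst_action g i + subst_action g f"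
      by (auto simp: cls_image subst_action_simps)
    then show "y \<in> cls (subst_action g f)" using subst_action_I[OF g] by (auto simp: cls_image)
  next
    fix y assume "y \<in> cls (subst_action g f)"
    then obtain i where i: "i \<in> I" "y = i + subst_action g f" by (auto simp: cls_image)
    then have "y = subst_action g (subst_action (inv g) i + f)"
      by (simp add: subst_action_simps subst_action_inv g)
    moreover have "subst_action (inv g) i + f \<in> cls f"
      using subst_action_I[of "inv g"] g i by (auto simp: cls_image)
    ultimately show "y \<in> subst_action g ` cls f" by blast
  qed
  then show ?thesis by (simp add: sym_action_def subst_action_def)
qed

lemma act_Var:
  assumes g: "g \<in> carrier G"
  shows "A.act g (Var x) = Const (factor g x) * Var (perm g x)"
proof -
  have "A.mon g (Poly_Mapping.single x 1) = Poly_Mapping.single (perm g x) 1"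
    by (rule A.mon_eqI[OF g])
      (use A.inj_\<pi>[OF g] in \<open>auto simp: lookup_single when_def dest: injD\<close>)
  then show ?thesis by (simp add: Var_def A.act_mterm A.wt_def Const_times_mterm)
qed

text \<open>
  Both sides are ring homomorphisms in \<open>f\<close>, and they agree on the basis by the definition of \<open>perm\<close> and
  \<open>factor\<close>.
\<close>

lemma retract_subst_action:
  assumes g: "g \<in> carrier G" and f: "f \<in> polys_in \<Gamma>"
  shows "retract (subst_action g f) = A.act g f"
proof (rule ring_hom_eq_on_polys_in[OF _ _ _ _ _ _ f])
  show "retract (subst_action g (Var x)) = A.act g (Var x)" if "x \<in> \<Gamma>" for x
    using g that perm_factor[OF g that]
    by (simp add: subst_action_simps retract_simps linear_form_scale linear_form_basis act_Var)
qed (simp_all add: subst_action_simps retract_simps A.act_add A.act_times A.act_Const g)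

lemma sym_action_fixed_iff:
  assumes g: "g \<in> carrier G" and f: "f \<in> polys_in \<Gamma>"
  shows "sym_action \<rho> g (cls f) = cls f \<longleftrightarrow> A.act g f = f"
proof -
  have "sym_action \<rho> g (cls f) = cls (A.act g f)"
    using cls_retract[of "subst_action g f"] by (simp add: sym_action_cls retract_subst_action g f)
  then show ?thesis using inj_cls A.act_polys_in[OF g f] f by (auto dest: inj_onD)
qed

lemma symmetric_algebra_carrier: "carrier (symmetric_algebra scale) = cls ` polys_in \<Gamma>"
proof -
  have "carrier (symmetric_algebra scale) = range cls"
    by (auto simp: symmetric_algebra_def Let_def FactRing_def A_RCOSETS_def' cls_def mpoly_ring_simps)
  also have "\<dots> = cls ` polys_in \<Gamma>"
  proof (intro equalityI subsetI)
    fix x assume "x \<in> range cls"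
    then obtain f where "x = cls f" by (rule rangeE)
    then have "x = cls (retract f)" by (simp only: cls_retract)
    then show "x \<in> cls ` polys_in \<Gamma>" using retract_poly by (rule image_eqI)
  qed blast
  finally show ?thesis .
qed

lemma symmetric_algebra_ops:
  "cls f \<oplus>\<^bsub>symmetric_algebra scale\<^esub> cls h = cls (f + h)"
  "cls f \<otimes>\<^bsub>symmetric_algebra scale\<^esub> cls h = cls (f * h)"
  "a \<odot>\<^bsub>symmetric_algebra scale\<^esub> cls f = cls (Const a * f)"
  "\<zero>\<^bsub>symmetric_algebra scale\<^esub> = cls 0" "\<one>\<^bsub>symmetric_algebra scale\<^esub> = cls 1"
proof -
  have add: "set_add mpoly_ring (cls f) (cls h) = cls (f + h)" for f h
    using ideal.a_rcos_sum[OF ideal_I, of f h] by (simp add: cls_def mpoly_ring_simps)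
  have mult: "rcoset_mult mpoly_ring I (cls f) (cls h) = cls (f * h)" for f h
    using ideal.rcoset_mult_add[OF ideal_I, of f h] by (simp add: cls_def mpoly_ring_simps)
  show "cls f \<oplus>\<^bsub>symmetric_algebra scale\<^esub> cls h = cls (f + h)"
    "cls f \<otimes>\<^bsub>symmetric_algebra scale\<^esub> cls h = cls (f * h)"
    "a \<odot>\<^bsub>symmetric_algebra scale\<^esub> cls f = cls (Const a * f)"
    "\<one>\<^bsub>symmetric_algebra scale\<^esub> = cls 1"
    by (simp_all add: symmetric_algebra_def Let_def FactRing_def add mult mpoly_ring_simps
        flip: cls_def)
  show "\<zero>\<^bsub>symmetric_algebra scale\<^esub> = cls 0"
    by (simp add: symmetric_algebra_def Let_def FactRing_def cls_image)
qed

lemma invariant_ring_carrier: "carrier (invariant_ring scale G \<rho>) = cls ` A.invs"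
proof -
  have "carrier (invariant_ring scale G \<rho>)
      = {A \<in> cls ` polys_in \<Gamma>. \<forall>g \<in> carrier G. sym_action \<rho> g A = A}"
    by (simp add: invariant_ring_def Let_def symmetric_algebra_carrier)
  also have "\<dots> = cls ` A.invs"
  proof (intro equalityI subsetI)
    fix x assume "x \<in> {A \<in> cls ` polys_in \<Gamma>. \<forall>g \<in> carrier G. sym_action \<rho> g A = A}"
    then obtain f where f: "f \<in> polys_in \<Gamma>" "x = cls f" "\<forall>g \<in> carrier G. sym_action \<rho> g (cls f) = cls f"
      by blast
    then have "f \<in> A.invs" by (simp add: A.invs_iff sym_action_fixed_iff)
    with f(2) show "x \<in> cls ` A.invs" by blast
  next
    fix x assume "x \<in> cls ` A.invs"
    then obtain f where "f \<in> A.invs" "x = cls f" by blast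
    then show "x \<in> {A \<in> cls ` polys_in \<Gamma>. \<forall>g \<in> carrier G. sym_action \<rho> g A = A}"
      by (simp add: A.invs_iff sym_action_fixed_iff)
  qed
  finally show ?thesis .
qed

text \<open>
  A homogeneous representative of a coset may involve arbitrary vectors; rewriting it in the basis
  preserves its degree.
\<close>

lemma invariant_ring_hcomp:
  "hcomp (invariant_ring scale G \<rho>) n = cls ` {f \<in> A.invs. homogeneous n f}"
proof (intro equalityI subsetI)
  fix x assume "x \<in> hcomp (invariant_ring scale G \<rho>) n"
  then obtain f where f: "homogeneous n f" "x = cls f" "x \<in> carrier (invariant_ring scale G \<rho>)"
    by (auto simp: invariant_ring_def symmetric_algebra_def Let_def cls_def)
  then obtain h where h: "h \<in> A.invs" "x = cls h" unfolding invariant_ring_carrier by blast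
  have "cls h = cls (retract f)" using f(2) h(2) cls_retract by simp
  then have "h = retract f" using inj_cls h(1) retract_poly by (auto dest: inj_onD simp: A.semi_polys_in)
  then show "x \<in> cls ` {f \<in> A.invs. homogeneous n f}" using h retract_homogeneous[OF f(1)] by blast
next
  fix x assume "x \<in> cls ` {f \<in> A.invs. homogeneous n f}"
  then obtain f where f: "f \<in> A.invs" "homogeneous n f" "x = cls f" by blast
  then have "x \<in> carrier (invariant_ring scale G \<rho>)" by (auto simp: invariant_ring_carrier)
  with f show "x \<in> hcomp (invariant_ring scale G \<rho>) n"
    by (auto simp: invariant_ring_def symmetric_algebra_def Let_def cls_def)
qed

lemma invariant_ring_FFRT:
  assumes "CHAR('k) > 0" and "\<And>a :: 'k. \<exists>b. b ^ CHAR('k) = a"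
  shows "FFRT (invariant_ring scale G \<rho>)"
proof -
  have same: "add (invariant_ring scale G \<rho>) = add (symmetric_algebra scale)"
    "monoid.mult (invariant_ring scale G \<rho>) = monoid.mult (symmetric_algebra scale)"
    "module.smult (invariant_ring scale G \<rho>) = module.smult (symmetric_algebra scale)"
    "\<zero>\<^bsub>invariant_ring scale G \<rho>\<^esub> = \<zero>\<^bsub>symmetric_algebra scale\<^esub>"
    "\<one>\<^bsub>invariant_ring scale G \<rho>\<^esub> = \<one>\<^bsub>symmetric_algebra scale\<^esub>"
    by (simp_all add: invariant_ring_def Let_def)
  interpret invariant_model G \<Gamma> perm factor "Coset.order G" cls "invariant_ring scale G \<rho>"
    by unfold_locales
      (simp_all add: assms inj_cls invariant_ring_carrier invariant_ring_hcomp same symmetric_algebra_ops)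
  show ?thesis by (rule R_FFRT)
qed

end

section \<open>Invariants of monomial representations\<close>

theorem theorem4p1:
  fixes scale :: "'k::field \<Rightarrow> 'v::ab_group_add \<Rightarrow> 'v"
    and G :: "('g, 'b) monoid_scheme"
    and \<rho> :: "'g \<Rightarrow> 'v \<Rightarrow> 'v"
  assumes "perfect_field TYPE('k)" and "CHAR('k) > 0"
    and "group G" and "finite (carrier G)"
    and "\<exists>B. finite_dimensional_vector_space scale B"
    and "monomial_representation scale G \<rho>"
  shows "FFRT (invariant_ring scale G \<rho>)"
proof -
  obtain B where B: "finite_dimensional_vector_space scale B" using assms(5) by blast
  obtain \<Gamma>0 where \<Gamma>0: "monomial_basis scale G \<rho> \<Gamma>0"
    using assms(6) unfolding monomial_representation_def by blast
  interpret linear_rep scale G \<rho>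
    using assms(3,6) finite_dimensional_vector_space.axioms(1)[OF B]
    by (intro linear_rep.intro linear_rep_axioms.intro)
      (auto simp: monomial_representation_def linear_representation_def)
  obtain \<Gamma> where \<Gamma>: "finite \<Gamma>" "V.independent \<Gamma>" "V.span \<Gamma> = UNIV"
    "\<forall>g \<in> carrier G. \<forall>x \<in> \<Gamma>. \<exists>y \<in> \<Gamma>. \<exists>z. z ^ Coset.order G = 1 \<and> \<rho> g x = scale z y"
    by (rule root_of_unity_basis[OF B \<Gamma>0 assms(4)])
  interpret monomial_rep scale G \<rho> \<Gamma>
    by unfold_locales (use assms(4) \<Gamma> in auto)
  show ?thesis
    by (rule invariant_ring_FFRT) (use assms(1,2) in \<open>auto simp: perfect_field_def\<close>)
qed

end
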